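(* Assume the setting and uniform local assumptions described in the context, and let $y_\infty\in Y$ satisfy $p_\infty=r_x(x_\infty,y_\infty)$. For $y$ near $y_\infty$ and $z=(\xi,\pi)=(x-x_\infty,p-p_\infty)\in\mathbb R^{2d}$ define $$\mathcal B_y(z_0,z_T)=\binom{\xi_0}{\pi_T-\bigl(r_x(x_\infty+\xi_T,y)-r_x(x_\infty,y)\bigr)},\qquad \Delta_{\rm oc}(x_{\rm in},y)=\binom{x_{\rm in}-x_\infty}{r_x(x_\infty,y)-p_\infty}.$$ Then $\mathcal B_y(z_0,z_T)=\Delta_{\rm oc}(x_{\rm in},y)$ is equivalent to $x_0=x_{\rm in}$, $p_T=r_x(x_T,y)$. Suppose the rows $D\mathcal B_{y_\infty}(0,0)$, together with $L=D\widetilde{\mathcal F}(0,0)$, satisfy the uniform Green property with constants $(C_G,\gamma,T_0)$. Let $$E_T(y)=\begin{pmatrix}0&0\\-[r_{xx}(x_\infty,y)-r_{xx}(x_\infty,y_\infty)]&0\end{pmatrix}$$ and choose a neighborhood $Y_1$ of $y_\infty$, relatively compact in $Y_0$, so small that $\bar\vartheta:=2C_G\sup_{y\in Y_1}\|E_T(y)\|<1$. Then for all $y\in Y_1$ the rows $D\mathcal B_y(0,0)$ satisfy the uniform Green property with exponent $\gamma$, initial horizon $T_0$ and the common constant $\bar C_G=C_G\frac{1+\bar\vartheta}{1-\bar\vartheta}$. Fix $0<\alpha<\gamma/2$, set $C_B=M_{\rm ter}$, $c=\bar C_G$, $a=2\bar C_GC_{\rm conv}C_N(1+e^\alpha)^2+16\bar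 C_GC_B$, choose $R_*>0$ such that the weighted ball of radius $R_*$ lies in the fixed tube and $2aR_*<1$, and put $\delta_*=(R_*-aR_*^2)/c$. Then, for every $T\ge T_0$ and every $(x_{\rm in},y)$ with $y\in Y_1$ and $d_\Delta:=\|\Delta_{\rm oc}(x_{\rm in},y)\|<\delta_*$, the problem admits a unique local stationary Pontryagin branch $(z,u)$ in the fixed ball $\|z\|_{w,T}\le R_*$; it satisfies $\|z\|_{w,T}\le\frac{1-\sqrt{1-4ac\,d_\Delta}}{2a}$ (read as $c\,d_\Delta$ if $a=0$), uniformly in $T$ and $y$. For fixed $y$, let $z^{\rm lin}_{T,y}=(\xi^{\rm lin},\pi^{\rm lin})$ be the linear branch formed with $D\mathcal B_y(0,0)$, i.e. the solution of $L[h_t,h_{t+1}]=0$ $(0\le t<T)$, $D\mathcal B_y(0,0)[h_0,h_T]=\Delta_{\rm oc}(x_{\rm in},y)$, and put $u_t^{\rm lin}=D\nu(x_\infty,p_\infty)[\xi_t^{\rm lin},\pi_{t+1}^{\rm lin}]$. There is a constant $C$ independent of $T$ such that for $0\le t<T$ $$\|z_t\|+\|u_t-u_\infty\|\le Cw_T(t)\,d_\Delta,$$ $$\|z_t-z^{\rm lin}_{T,y,t}\|+\|(u_t-u_\infty)-u_t^{\rm lin}\|\le Cw_T(t)^2d_\Delta^2 .$$ For two branches with the same $y$ and data $\Delta^1_{\rm oc},\Delta^2_{\rm oc}$, $$\|z_t^1-z_t^2\|+\|u_t^1-u_t^2\|\le Cw_T(t)\|\Delta_{\rm oc}^1-\Delta_{\rm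 oc}^2\| .$$ The $z$-estimates also hold at $t=T$. (The expansion is with respect to the combined datum $\Delta_{\rm oc}$; at fixed $y$ it is an expansion at $x_{\rm in}=x_\infty$ only when $r_x(x_\infty,y)=p_\infty$.) If, in addition, $y\mapsto r_x(x,y)$ and $y\mapsto r_{xx}(x,y)$ are locally Lipschitz uniformly in $x$ on the terminal tube $x_\infty+B_x$, then the branch is jointly locally Lipschitz in $(x_{\rm in},y)$ on this neighborhood of the endpoint data. Finally, the Green hypothesis on $(L,D\mathcal B_{y_\infty}(0,0))$ holds whenever: $\det L_1\neq0$; $M:=-L_1^{-1}L_0$ is hyperbolic; with the columns of $V_s,V_u$ bases of its stable and unstable subspaces, $MV_s=V_sD_s$, $MV_u=V_uD_u$, and, for some $K\ge1$, $\|V_sD_s^k\|\le Ke^{-\gamma k}$, $\|V_uD_u^{-k}\|\le Ke^{-\gamma k}$ for all $k\ge0$; and, writing $D\mathcal B_{y_\infty}(0,0)[a,b]=\mathsf B_0a+\mathsf B_Tb$, the matrices $\widehat\Gamma_T=[\,\mathsf B_0V_s+\mathsf B_TV_sD_s^{\,T}\ \ \mathsf B_0V_uD_u^{-T}+\mathsf B_TV_u\,]$ (with $D_s^{\,T},D_u^{-T}$ powers) are invertible for every $T\ge T_0$ with $\sup_{T\ge T_0}\|\widehat\Gamma_T^{-1}\|<\infty$.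
   Context: Setting. $U\subset\mathbb R^m$ is compact and convex, $Y\subset\mathbb R^q$ open, $\lambda>0$. The dynamics are $x_{t+1}=F(x_t,u_t)\in\mathbb R^d$, $0\le t<T$; the maximization objective is $J_T(u)=r(x_T,y)-\lambda\sum_{t=0}^{T-1}\ell(x_t,u_t)$; the Hamiltonian is $H(x,u,p)=-\lambda\ell(x,u)+\langle p,F(x,u)\rangle$. $(x_\infty,u_\infty,p_\infty)$ is an interior stationary reference: $x_\infty=F(x_\infty,u_\infty)$, $p_\infty=H_x(x_\infty,u_\infty,p_\infty)$, $H_u(x_\infty,u_\infty,p_\infty)=0$, $u_\infty\in\operatorname{int}U$. $F,\ell$ are $C^3$ near the reference, $r(\cdot,y)$ is $C^3$ in $x$, and $\det H_{uu}(x_\infty,u_\infty,p_\infty)\ne0$. Control elimination. By the implicit function theorem there are neighborhoods $\Omega$ of $(x_\infty,p_\infty)$ and $V$ of $u_\infty$ (relatively compact in $\operatorname{int}U$) and a unique $C^2$ map $\nu:\Omega\to V$ with $H_u(x,\nu(x,p_+),p_+)=0$, $\nu(x_\infty,p_\infty)=u_\infty$. With $z_t=(x_t,p_t)$ the reduced step is $\mathcal F(z_t,z_{t+1})=0$, where $$\mathcal F(z_t,z_{t+1})=\binom{x_{t+1}-F(x_t,\nu(x_t,p_{t+1}))}{p_t-H_x(x_t,\nu(x_t,p_{t+1}),p_{t+1})},$$ and $\widetilde{\mathcal F}(z,z^+)=\mathcal F((x_\infty,p_\infty)+z,(x_\infty,p_\infty)+z^+)$. Write $L=D\widetilde{\mathcal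 F}(0,0)$, $L[h,h^+]=L_0h+L_1h^+$. Uniform local assumptions. A product neighborhood $Z=Z_x\times Z_p$ of $0$ in $\Omega-(x_\infty,p_\infty)$, a convex $U_0$ relatively compact in $\operatorname{int}U$, compact balls $B_x\subset Z_x$, $B_p\subset Z_p$ about $0$, and a neighborhood $Y_0$ of $y_\infty$ relatively compact in $Y$ are fixed such that $\nu(x_\infty+\xi,p_\infty+\pi^+)\in U_0$ for all mixed arguments, and for constants $M_{\rm int},M_{\rm ter}$: $\sup_{(x_\infty,p_\infty)+Z}\|D\nu\|+\sup_{(x_\infty,p_\infty)+Z}\|D^2\nu\|\le M_{\rm int}$; $\|D^2\widetilde{\mathcal F}\|\le M_{\rm int}$ on $(B_x\times B_p)^2$; $\|D_x^jr(x,y)\|\le M_{\rm ter}$ for $x\in x_\infty+B_x$, $y\in Y_0$, $j=1,2,3$. The maps $y\mapsto r_x(x,y)$, $y\mapsto r_{xx}(x,y)$ are continuous uniformly for $x\in x_\infty+B_x$. The "fixed tube" is $B_x\times B_p$ at every time; a weighted ball of radius $R_*$ lies in it if $\|z\|_{w,T}\le R_*$ implies $z_t\in B_x\times B_p$ for all $t$ and all $T\ge T_0$. Norms are Euclidean, $\mathbb R^{2d}$ has the product Euclidean norm, and matrices have induced norms. Local stationary Pontryagin branch: $z=(\xi,\pi)$ with $x=x_\infty+\xi$, $p=p_\infty+\pi$, $u_t=\nu(x_t,p_{t+1})\in\operatorname{int}U$, satisfying $x_{t+1}=F(x_t,u_t)$, $p_t=H_x(x_t,u_t,p_{t+1})$,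 $H_u(x_t,u_t,p_{t+1})=0$ for $0\le t<T$ and $x_0=x_{\rm in}$, $p_T=r_x(x_T,y)$. Constants and weights. $w_T(t)=e^{-\alpha t}+e^{-\alpha(T-t)}$, $\|z\|_{w,T}=\max_{0\le t\le T}\|z_t\|/w_T(t)$. $C_N$ is a constant with $\|N(a,b)\|\le C_N(\|a\|+\|b\|)^2$ and $\|N(a,b)-N(\tilde a,\tilde b)\|\le C_N(\|a\|+\|b\|+\|\tilde a\|+\|\tilde b\|)(\|a-\tilde a\|+\|b-\tilde b\|)$ on the tube, where $N=\widetilde{\mathcal F}-L$. With $\kappa_T(t,s)=e^{-\gamma|t-s|}+e^{-\gamma(t+T-s)}+e^{-\gamma(T-t+s)}$, $C_{\rm conv}$ is a $T$-independent constant with $\sum_{s=0}^{T-1}\kappa_T(t,s)w_T(s)^2\le C_{\rm conv}w_T(t)^2$ and $e^{-\gamma t}+e^{-\gamma(T-t)}\le C_{\rm conv}w_T(t)^2$; e.g. $C_{\rm conv}=4\bigl(\frac1{1-q_-}+\frac{q_+}{1-q_+}\bigr)$, $q_\pm=e^{-(\gamma\pm2\alpha)}$. Uniform Green property. A linear $L:\mathbb R^n\times\mathbb R^n\to\mathbb R^n$ and rows $\mathsf B_0,\mathsf B_T\in\mathbb R^{n\times n}$ (here $n=2d$; a linear map $[a,b]\mapsto\mathsf B_0a+\mathsf B_Tb$ is identified with its rows) have it with constants $C_G\ge1,\gamma>0,T_0\ge1$ if for every $T\ge T_0$ and all $f_t,b\in\mathbb R^n$ the problem $L[h_t,h_{t+1}]=f_t$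 $(0\le t<T)$, $\mathsf B_0h_0+\mathsf B_Th_T=b$ has a unique solution and it satisfies $\|h_t\|\le C_G[(e^{-\gamma t}+e^{-\gamma(T-t)})\|b\|+\sum_{s=0}^{T-1}\kappa_T(t,s)\|f_s\|]$ for $0\le t\le T$. *)

theory Defs
  imports "HOL-Analysis.Analysis"
begin

subsection \<open>Derivatives\<close>

text \<open>\<open>C\<^sup>k\<close> on an open set of a finite-dimensional space: the directional derivatives along
  every fixed vector are again \<open>C\<^sup>k\<^sup>-\<^sup>1\<close>.\<close>

fun Ck_on :: "nat \<Rightarrow> ('a::euclidean_space \<Rightarrow> 'b::real_normed_vector) \<Rightarrow> 'a set \<Rightarrow> bool" where
  "Ck_on 0 f S = continuous_on S f"
| "Ck_on (Suc k) f S \<longleftrightarrow>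
     (\<forall>x\<in>S. f differentiable (at x)) \<and> (\<forall>v. Ck_on k (\<lambda>x. frechet_derivative f (at x) v) S)"

definition grad :: "('a::euclidean_space \<Rightarrow> real) \<Rightarrow> 'a \<Rightarrow> 'a" where
  "grad f x = (\<Sum>b\<in>Basis. frechet_derivative f (at x) b *\<^sub>R b)"

fun iter_deriv :: "('a::real_normed_vector \<Rightarrow> 'b::real_normed_vector) \<Rightarrow> 'a list \<Rightarrow> 'a \<Rightarrow> 'b" where
  "iter_deriv f [] = f"
| "iter_deriv f (h # hs) = (\<lambda>x. frechet_derivative (iter_deriv f hs) (at x) h)"

text \<open>Induced norm of the \<open>j\<close>-linear map \<open>D\<^sup>jf(x)\<close>; the supremum is finite wherever
  \<open>f\<close> is \<open>C\<^sup>j\<close>.\<close>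

definition deriv_norm ::
    "nat \<Rightarrow> ('a::real_normed_vector \<Rightarrow> 'b::real_normed_vector) \<Rightarrow> 'a \<Rightarrow> real" where
  "deriv_norm j f x =
     Sup {norm (iter_deriv f hs x) | hs. length hs = j \<and> (\<forall>h\<in>set hs. norm h \<le> 1)}"

definition rel_compact_in :: "'a::topological_space set \<Rightarrow> 'a set \<Rightarrow> bool" where
  "rel_compact_in A B \<longleftrightarrow> compact (closure A) \<and> closure A \<subseteq> B"


subsection \<open>Hamiltonian and reduced step\<close>

definition ham ::
    "real \<Rightarrow> (real^'d \<Rightarrow> real^'m \<Rightarrow> real) \<Rightarrow> (real^'d \<Rightarrow> real^'m \<Rightarrow> real^'d) \<Rightarrow>
     real^'d \<Rightarrow> real^'m \<Rightarrow> real^'d \<Rightarrow> real" where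
  "ham lam l F x u p = - lam * l x u + p \<bullet> F x u"

definition ham_x ::
    "real \<Rightarrow> (real^'d \<Rightarrow> real^'m \<Rightarrow> real) \<Rightarrow> (real^'d \<Rightarrow> real^'m \<Rightarrow> real^'d) \<Rightarrow>
     real^'d \<Rightarrow> real^'m \<Rightarrow> real^'d \<Rightarrow> real^'d" where
  "ham_x lam l F x u p = grad (\<lambda>x'. ham lam l F x' u p) x"

definition ham_u ::
    "real \<Rightarrow> (real^'d \<Rightarrow> real^'m \<Rightarrow> real) \<Rightarrow> (real^'d \<Rightarrow> real^'m \<Rightarrow> real^'d) \<Rightarrow>
     real^'d \<Rightarrow> real^'m \<Rightarrow> real^'d \<Rightarrow> real^'m" where
  "ham_u lam l F x u p = grad (\<lambda>u'. ham lam l F x u' p) u"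

definition ham_uu ::
    "real \<Rightarrow> (real^'d \<Rightarrow> real^'m \<Rightarrow> real) \<Rightarrow> (real^'d \<Rightarrow> real^'m \<Rightarrow> real^'d) \<Rightarrow>
     real^'d \<Rightarrow> real^'m \<Rightarrow> real^'d \<Rightarrow> real^'m^'m" where
  "ham_uu lam l F x u p = matrix (frechet_derivative (\<lambda>u'. ham_u lam l F x u' p) (at u))"

definition reduced_step ::
    "real \<Rightarrow> (real^'d \<Rightarrow> real^'m \<Rightarrow> real) \<Rightarrow> (real^'d \<Rightarrow> real^'m \<Rightarrow> real^'d) \<Rightarrow>
     ((real^'d) \<times> (real^'d) \<Rightarrow> real^'m) \<Rightarrow>
     ((real^'d) \<times> (real^'d)) \<times> ((real^'d) \<times> (real^'d)) \<Rightarrow> (real^'d) \<times> (real^'d)" where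
  "reduced_step lam l F nu = (\<lambda>((x, p), (x', p')).
     (x' - F x (nu (x, p')), p - ham_x lam l F x (nu (x, p')) p'))"

definition shifted_step ::
    "real \<Rightarrow> (real^'d \<Rightarrow> real^'m \<Rightarrow> real) \<Rightarrow> (real^'d \<Rightarrow> real^'m \<Rightarrow> real^'d) \<Rightarrow>
     ((real^'d) \<times> (real^'d) \<Rightarrow> real^'m) \<Rightarrow> (real^'d) \<times> (real^'d) \<Rightarrow>
     ((real^'d) \<times> (real^'d)) \<times> ((real^'d) \<times> (real^'d)) \<Rightarrow> (real^'d) \<times> (real^'d)" where
  "shifted_step lam l F nu zinf = (\<lambda>(z, z'). reduced_step lam l F nu (zinf + z, zinf + z'))"


subsection \<open>Terminal reward and endpoint conditions\<close>

definition r_x :: "(real^'d \<Rightarrow> real^'q \<Rightarrow> real) \<Rightarrow> real^'d \<Rightarrow> real^'q \<Rightarrow> real^'d" where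
  "r_x r x y = grad (\<lambda>x'. r x' y) x"

text \<open>The Hessian is kept as a linear map, so that its induced norm is \<^const>\<open>onorm\<close>.\<close>

definition r_xx :: "(real^'d \<Rightarrow> real^'q \<Rightarrow> real) \<Rightarrow> real^'d \<Rightarrow> real^'q \<Rightarrow> real^'d \<Rightarrow> real^'d" where
  "r_xx r x y = frechet_derivative (\<lambda>x'. r_x r x' y) (at x)"

definition endpoint_map ::
    "(real^'d \<Rightarrow> real^'q \<Rightarrow> real) \<Rightarrow> real^'d \<Rightarrow> real^'q \<Rightarrow>
     ((real^'d) \<times> (real^'d)) \<times> ((real^'d) \<times> (real^'d)) \<Rightarrow> (real^'d) \<times> (real^'d)" where
  "endpoint_map r xinf y = (\<lambda>((\<xi>0, \<pi>0), (\<xi>T, \<pi>T)).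
     (\<xi>0, \<pi>T - (r_x r (xinf + \<xi>T) y - r_x r xinf y)))"

definition endpoint_lin ::
    "(real^'d \<Rightarrow> real^'q \<Rightarrow> real) \<Rightarrow> real^'d \<Rightarrow> real^'q \<Rightarrow>
     ((real^'d) \<times> (real^'d)) \<times> ((real^'d) \<times> (real^'d)) \<Rightarrow> (real^'d) \<times> (real^'d)" where
  "endpoint_lin r xinf y = frechet_derivative (endpoint_map r xinf y) (at (0, 0))"

definition oc_datum ::
    "(real^'d \<Rightarrow> real^'q \<Rightarrow> real) \<Rightarrow> real^'d \<Rightarrow> real^'d \<Rightarrow> real^'d \<Rightarrow> real^'q \<Rightarrow>
     (real^'d) \<times> (real^'d)" where
  "oc_datum r xinf pinf xin y = (xin - xinf, r_x r xinf y - pinf)"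

definition endpoint_perturbation ::
    "(real^'d \<Rightarrow> real^'q \<Rightarrow> real) \<Rightarrow> real^'d \<Rightarrow> real^'q \<Rightarrow> real^'q \<Rightarrow>
     (real^'d) \<times> (real^'d) \<Rightarrow> (real^'d) \<times> (real^'d)" where
  "endpoint_perturbation r xinf yinf y =
     (\<lambda>(\<xi>, \<pi>). (0, - (r_xx r xinf y \<xi> - r_xx r xinf yinf \<xi>)))"


subsection \<open>Weights and the uniform Green property\<close>

text \<open>Sequences on \<open>0..T\<close> (or \<open>0..<T\<close>) are functions on \<^typ>\<open>nat\<close> whose values beyond the
  horizon are irrelevant.\<close>

definition weight :: "real \<Rightarrow> nat \<Rightarrow> nat \<Rightarrow> real" where
  "weight \<alpha> T t = exp (- \<alpha> * real t) + exp (- \<alpha> * (real T - real t))"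

definition wnorm :: "real \<Rightarrow> nat \<Rightarrow> (nat \<Rightarrow> 'a::real_normed_vector) \<Rightarrow> real" where
  "wnorm \<alpha> T z = Max ((\<lambda>t. norm (z t) / weight \<alpha> T t) ` {0..T})"

definition kappa :: "real \<Rightarrow> nat \<Rightarrow> nat \<Rightarrow> nat \<Rightarrow> real" where
  "kappa \<gamma> T t s = exp (- \<gamma> * \<bar>real t - real s\<bar>) + exp (- \<gamma> * (real t + real T - real s))
     + exp (- \<gamma> * (real T - real t + real s))"

definition solves_bvp ::
    "('a \<times> 'a \<Rightarrow> 'a) \<Rightarrow> ('a \<times> 'a \<Rightarrow> 'a) \<Rightarrow> nat \<Rightarrow> (nat \<Rightarrow> 'a) \<Rightarrow> 'a \<Rightarrow> (nat \<Rightarrow> 'a) \<Rightarrow> bool" where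
  "solves_bvp L B T f b h \<longleftrightarrow> (\<forall>t<T. L (h t, h (Suc t)) = f t) \<and> B (h 0, h T) = b"

definition uniform_green ::
    "('a::euclidean_space \<times> 'a \<Rightarrow> 'a) \<Rightarrow> ('a \<times> 'a \<Rightarrow> 'a) \<Rightarrow> real \<Rightarrow> real \<Rightarrow> nat \<Rightarrow> bool" where
  "uniform_green L B C \<gamma> T0 \<longleftrightarrow>
     linear L \<and> linear B \<and> C \<ge> 1 \<and> \<gamma> > 0 \<and> T0 \<ge> 1 \<and>
     (\<forall>T\<ge>T0. \<forall>f b.
        (\<exists>h. solves_bvp L B T f b h) \<and>
        (\<forall>h h'. solves_bvp L B T f b h \<and> solves_bvp L B T f b h' \<longrightarrow> (\<forall>t\<le>T. h t = h' t)) \<and>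
        (\<forall>h. solves_bvp L B T f b h \<longrightarrow>
           (\<forall>t\<le>T. norm (h t) \<le>
              C * ((exp (- \<gamma> * real t) + exp (- \<gamma> * (real T - real t))) * norm b
                   + (\<Sum>s<T. kappa \<gamma> T t s * norm (f s))))))"


subsection \<open>Local stationary Pontryagin branches\<close>

definition pontryagin_branch ::
    "(real^'m) set \<Rightarrow> real \<Rightarrow> (real^'d \<Rightarrow> real^'m \<Rightarrow> real) \<Rightarrow> (real^'d \<Rightarrow> real^'m \<Rightarrow> real^'d) \<Rightarrow>
     (real^'d \<Rightarrow> real^'q \<Rightarrow> real) \<Rightarrow> ((real^'d) \<times> (real^'d)) set \<Rightarrow>
     ((real^'d) \<times> (real^'d) \<Rightarrow> real^'m) \<Rightarrow> (real^'d) \<times> (real^'d) \<Rightarrow>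
     nat \<Rightarrow> real^'d \<Rightarrow> real^'q \<Rightarrow> (nat \<Rightarrow> (real^'d) \<times> (real^'d)) \<Rightarrow> (nat \<Rightarrow> real^'m) \<Rightarrow> bool" where
  "pontryagin_branch U lam l F r \<Omega> nu zinf T xin y z u \<longleftrightarrow>
     (let x = (\<lambda>t. fst zinf + fst (z t)); p = (\<lambda>t. snd zinf + snd (z t)) in
       (\<forall>t<T. (x t, p (Suc t)) \<in> \<Omega> \<and> u t = nu (x t, p (Suc t)) \<and> u t \<in> interior U \<and>
              x (Suc t) = F (x t) (u t) \<and>
              p t = ham_x lam l F (x t) (u t) (p (Suc t)) \<and>
              ham_u lam l F (x t) (u t) (p (Suc t)) = 0) \<and>
       x 0 = xin \<and> p T = r_x r (x T) y)"


subsection \<open>Matrices and spectral subspaces\<close>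

definition stack :: "(real^'d) \<times> (real^'d) \<Rightarrow> real^('d + 'd)" where
  "stack z = (\<chi> i. case i of Inl j \<Rightarrow> fst z $ j | Inr j \<Rightarrow> snd z $ j)"

definition unstack :: "real^('d + 'd) \<Rightarrow> (real^'d) \<times> (real^'d)" where
  "unstack v = (\<chi> j. v $ Inl j, \<chi> j. v $ Inr j)"

definition block_matrix ::
    "((real^'d) \<times> (real^'d) \<Rightarrow> (real^'d) \<times> (real^'d)) \<Rightarrow> real^('d + 'd)^('d + 'd)" where
  "block_matrix A = matrix (stack \<circ> A \<circ> unstack)"

definition mat_norm :: "real^'n^'k \<Rightarrow> real" where
  "mat_norm A = onorm ((*v) A)"

definition mat_pow :: "real^'n^'n \<Rightarrow> nat \<Rightarrow> real^'n^'n" where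
  "mat_pow A k = (((**) A) ^^ k) (mat 1)"

definition complexify :: "real^'n^'n \<Rightarrow> complex^'n^'n" where
  "complexify A = (\<chi> i j. complex_of_real (A $ i $ j))"

definition hyperbolic :: "real^'n^'n \<Rightarrow> bool" where
  "hyperbolic A \<longleftrightarrow> (\<forall>\<mu> v. v \<noteq> 0 \<and> complexify A *v v = \<mu> *s v \<longrightarrow> cmod \<mu> \<noteq> 1)"

definition gen_eigenspace :: "real^'n^'n \<Rightarrow> complex \<Rightarrow> (complex^'n) set" where
  "gen_eigenspace A \<mu> = {v. \<exists>k. ((\<lambda>w. complexify A *v w - \<mu> *s w) ^^ k) v = 0}"

text \<open>Real vectors in the sum of the complex generalized eigenspaces with eigenvalue in \<open>S\<close>.\<close>

definition spectral_subspace :: "real^'n^'n \<Rightarrow> complex set \<Rightarrow> (real^'n) set" where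
  "spectral_subspace A S =
     {x. (\<chi> i. complex_of_real (x $ i)) \<in> vec.span (\<Union>\<mu>\<in>S. gen_eigenspace A \<mu>)}"

definition stable_subspace :: "real^'n^'n \<Rightarrow> (real^'n) set" where
  "stable_subspace A = spectral_subspace A {\<mu>. cmod \<mu> < 1}"

definition unstable_subspace :: "real^'n^'n \<Rightarrow> (real^'n) set" where
  "unstable_subspace A = spectral_subspace A {\<mu>. cmod \<mu> > 1}"

definition columns_basis_of :: "real^'k^'n \<Rightarrow> (real^'n) set \<Rightarrow> bool" where
  "columns_basis_of V S \<longleftrightarrow>
     inj (\<lambda>j. column j V) \<and> independent (columns V) \<and> span (columns V) = S"

definition hcat :: "real^'k^'n \<Rightarrow> real^'j^'n \<Rightarrow> real^('k + 'j)^'n" where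
  "hcat A B = (\<chi> i c. case c of Inl a \<Rightarrow> A $ i $ a | Inr b \<Rightarrow> B $ i $ b)"

definition gamma_hat ::
    "real^'n^'n \<Rightarrow> real^'n^'n \<Rightarrow> real^'k^'n \<Rightarrow> real^'k^'k \<Rightarrow> real^'j^'n \<Rightarrow> real^'j^'j \<Rightarrow>
     nat \<Rightarrow> real^('k + 'j)^'n" where
  "gamma_hat B0 BT Vs Ds Vu Du T =
     hcat (B0 ** Vs + BT ** Vs ** mat_pow Ds T)
          (B0 ** Vu ** mat_pow (matrix_inv Du) T + BT ** Vu)"

end

(*
  Shifted to the stationary point, a branch is a solution of L[z_t, z_{t+1}] = -N(z_t, z_{t+1}) with
  endpoint condition DB_y[z_0, z_T] = Delta + Q_y(z_T), where N and Q_y vanish quadratically.  The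
  Green bound turns this into a fixed point equation; since the weight satisfies w^2 <= 2 w and the
  Green kernel maps w^2 into w^2, it is a contraction of the weighted ball of radius R with Lipschitz
  constant 2 a R < 1, uniformly in T.  Keeping w^2 instead of w in the same bound gives the quadratic
  expansion.  The Green property passes from y_inf to nearby y because a perturbed solution is an
  unperturbed one whose boundary datum is corrected by its own terminal value.  For the spectral
  criterion, stable solutions are summed forwards and unstable ones backwards, and the endpoint
  matrix corrects the boundary values; uniqueness follows from solvability by a dimension count.
*)
theory Submission
  imports Defs
begin

section \<open>Derivatives of class \<open>C\<^sup>k\<close>\<close>

text \<open>Three obstacles shape the development. Derivative norms are suprema of reals, which
  bound nothing unless the set is bounded, so boundedness of the iterated derivatives precedes any
  use of \<open>Mint\<close> and \<open>Mter\<close>. Sequences are functions on all of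
  \<open>nat\<close> with arbitrary values beyond \<open>T\<close>, and solutions are picked by
  choice, so equalities hold only up to \<open>T\<close> and the contraction is iterated by hand.
  Finally, the boundary rows depend on \<open>y\<close>, so branches for different \<open>y\<close>
  do not share one linear problem. The Lipschitz estimate therefore asks only that both sequences
  lie in the ball and allows arbitrary data: a branch for another parameter can then be read as a
  solution for \<open>y\<close> with a shifted datum, even if that datum leaves the radius of
  existence.

  In \<open>a\<close>, the factor \<open>(1 + exp \<alpha>)\<^sup>2\<close> pays for the pair of
  times t, t+1 in both factors of the Lipschitz estimate of N, the factor 2 for replacing w^2 by 2
  w, and the terminal term for w \<le> 2 at time T.\<close>

lemma iter_deriv_append:
  "iter_deriv f (hs @ [v]) = iter_deriv (\<lambda>x. frechet_derivative f (at x) v) hs"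
  by (induction hs) auto

lemma iter_deriv_cong:
  assumes "open S" "\<And>x. x \<in> S \<Longrightarrow> f x = g x" "x \<in> S"
  shows "iter_deriv f hs x = iter_deriv g hs x"
  using assms(3)
proof (induction hs arbitrary: x)
  case Nil
  then show ?case using assms by simp
next
  case (Cons h hs)
  \<comment> \<open>Agreement for every candidate D makes the choice inside
    \<open>frechet_derivative\<close> the same for both functions, whether or not they are
    differentiable.\<close>
  have "((iter_deriv f hs) has_derivative D) (at x) \<longleftrightarrow> ((iter_deriv g hs) has_derivative D) (at x)" for D
  proof
    assume "((iter_deriv f hs) has_derivative D) (at x)"
    then show "((iter_deriv g hs) has_derivative D) (at x)"
      by (rule has_derivative_transform_within_open[OF _ assms(1) Cons.prems Cons.IH])
  next
    assume "((iter_deriv g hs) has_derivative D) (at x)"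
    then show "((iter_deriv f hs) has_derivative D) (at x)"
      by (rule has_derivative_transform_within_open[OF _ assms(1) Cons.prems Cons.IH[symmetric]])
  qed
  then show ?case
    by (simp add: frechet_derivative_def)
qed

lemma iter_deriv_differentiable:
  assumes "Ck_on k f S" "length hs < k" "x \<in> S"
  shows "iter_deriv f hs differentiable (at x)"
  using assms(1,2)
proof (induction k arbitrary: f hs)
  case (Suc k)
  show ?case
  proof (cases hs rule: rev_cases)
    case Nil
    then show ?thesis using Suc.prems assms(3) by simp
  next
    case (snoc ys v)
    then show ?thesis using Suc by (simp add: iter_deriv_append)
  qed
qed simp

lemma iter_deriv_sum:
  fixes g :: "'i \<Rightarrow> 'a::euclidean_space \<Rightarrow> 'b::real_normed_vector"
  assumes "open S" "\<And>i. i \<in> I \<Longrightarrow> Ck_on k (g i) S" "length hs \<le> k" "x \<in> S"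
  shows "iter_deriv (\<lambda>x. \<Sum>i\<in>I. c i *\<^sub>R g i x) hs x = (\<Sum>i\<in>I. c i *\<^sub>R iter_deriv (g i) hs x)"
  using assms(3,4)
proof (induction hs arbitrary: x)
  case (Cons h hs)
  have "((\<lambda>x. \<Sum>i\<in>I. c i *\<^sub>R iter_deriv (g i) hs x) has_derivative
      (\<lambda>v. \<Sum>i\<in>I. c i *\<^sub>R frechet_derivative (iter_deriv (g i) hs) (at x) v)) (at x)"
    using iter_deriv_differentiable[OF assms(2)] Cons.prems
    by (intro has_derivative_sum has_derivative_scaleR_right) (auto simp: frechet_derivative_works)
  then have "((iter_deriv (\<lambda>x. \<Sum>i\<in>I. c i *\<^sub>R g i x) hs) has_derivative
      (\<lambda>v. \<Sum>i\<in>I. c i *\<^sub>R frechet_derivative (iter_deriv (g i) hs) (at x) v)) (at x)"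
    by (rule has_derivative_transform_within_open[OF _ assms(1) Cons.prems(2)])
      (use Cons in simp)
  from frechet_derivative_at[OF this, symmetric] show ?case
    by simp
qed simp

text \<open>Makes the supremum in \<open>deriv_norm\<close> a genuine upper bound.
  \<open>iter_deriv\<close> applies the last direction of the list first, as \<open>Ck_on\<close>
  does, so the list is peeled from the right. The first derivative is linear in that direction;
  expanding it in \<open>Basis\<close> leaves finitely many functions of one class lower, with
  coefficients of modulus at most 1.\<close>

lemma iter_deriv_bounded:
  fixes f :: "'a::euclidean_space \<Rightarrow> 'b::real_normed_vector"
  assumes "open S" "Ck_on k f S" "x \<in> S"
  shows "\<exists>C. \<forall>hs. length hs = k \<and> (\<forall>h\<in>set hs. norm h \<le> 1) \<longrightarrow> norm (iter_deriv f hs x) \<le> C"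
  using assms(2)
proof (induction k arbitrary: f)
  case (Suc k)
  define g where "g = (\<lambda>b x. frechet_derivative f (at x) b)"
  have "\<exists>C. \<forall>hs. length hs = k \<and> (\<forall>h\<in>set hs. norm h \<le> 1) \<longrightarrow> norm (iter_deriv (g b) hs x) \<le> C" for b
    using Suc by (simp add: g_def)
  then obtain C where C: "\<And>b hs. length hs = k \<Longrightarrow> (\<forall>h\<in>set hs. norm h \<le> 1) \<Longrightarrow>
      norm (iter_deriv (g b) hs x) \<le> C b"
    by metis
  have "norm (iter_deriv f hs x) \<le> (\<Sum>b\<in>Basis. C b)"
    if "length hs = Suc k" "\<forall>h\<in>set hs. norm h \<le> 1" for hs
  proof -
    obtain ys v where hs: "hs = ys @ [v]"
      using \<open>length hs = Suc k\<close> by (metis length_Suc_conv_rev)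
    have lin: "frechet_derivative f (at y) v = (\<Sum>b\<in>Basis. (v \<bullet> b) *\<^sub>R g b y)" if "y \<in> S" for y
    proof -
      have "linear (frechet_derivative f (at y))"
        using Suc.prems that by (simp add: linear_frechet_derivative)
      then have "frechet_derivative f (at y) (\<Sum>b\<in>Basis. (v \<bullet> b) *\<^sub>R b)
          = (\<Sum>b\<in>Basis. (v \<bullet> b) *\<^sub>R g b y)"
        unfolding g_def by (simp add: linear_sum linear_scale)
      then show ?thesis by (simp add: euclidean_representation)
    qed
    have "iter_deriv f hs x = iter_deriv (\<lambda>y. \<Sum>b\<in>Basis. (v \<bullet> b) *\<^sub>R g b y) ys x"
      unfolding hs iter_deriv_append
      by (rule iter_deriv_cong[OF assms(1)]) (use assms lin in auto)
    also have "\<dots> = (\<Sum>b\<in>Basis. (v \<bullet> b) *\<^sub>R iter_deriv (g b) ys x)"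
      using Suc.prems that hs by (intro iter_deriv_sum[OF assms(1), of _ k]) (auto simp: g_def assms)
    also have "norm \<dots> \<le> (\<Sum>b\<in>Basis. 1 * C b)"
    proof (rule sum_norm_le)
      fix b :: 'a assume "b \<in> Basis"
      then have "\<bar>v \<bullet> b\<bar> \<le> 1" using that hs Basis_le_norm[of b v] by auto
      then show "norm ((v \<bullet> b) *\<^sub>R iter_deriv (g b) ys x) \<le> 1 * C b"
        using C[of ys b] that hs by (simp only: norm_scaleR) (intro mult_mono, auto)
    qed
    finally show ?thesis by simp
  qed
  then show ?case by blast
qed auto

lemma norm_iter_deriv_le_deriv_norm:
  assumes "open S" "Ck_on k f S" "x \<in> S" "length hs = k" "\<forall>h\<in>set hs. norm h \<le> 1"
  shows "norm (iter_deriv f hs x) \<le> deriv_norm k f x"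
proof -
  obtain C where "\<forall>hs. length hs = k \<and> (\<forall>h\<in>set hs. norm h \<le> 1) \<longrightarrow> norm (iter_deriv f hs x) \<le> C"
    using iter_deriv_bounded[OF assms(1-3)] by blast
  then show ?thesis
    unfolding deriv_norm_def using assms by (intro cSup_upper bdd_aboveI[where M = C]) auto
qed

lemma deriv_norm_nonneg:
  fixes f :: "'a::euclidean_space \<Rightarrow> 'b::real_normed_vector"
  assumes "open S" "Ck_on k f S" "x \<in> S"
  shows "0 \<le> deriv_norm k f x"
  by (rule order_trans[OF norm_ge_zero norm_iter_deriv_le_deriv_norm[OF assms, of "replicate k 0"]]) auto

section \<open>Increment bounds from first and second derivatives\<close>

lemma norm_linear_le_of_unit_bound:
  assumes "linear f" "\<And>h. norm h \<le> 1 \<Longrightarrow> norm (f h) \<le> M"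
  shows "norm (f h) \<le> M * norm h"
proof (cases "h = 0")
  case False
  have "norm (f ((1 / norm h) *\<^sub>R h)) \<le> M"
    using False by (intro assms) simp
  then show ?thesis
    using False by (simp add: linear_scale[OF assms(1)] field_simps)
qed (use assms linear_0 in auto)

lemma norm_diff_le_of_derivative_bound:
  fixes f :: "'a::euclidean_space \<Rightarrow> 'b::real_normed_vector"
  assumes "convex K" "x \<in> K" "x' \<in> K" 
    and "\<And>z. z \<in> K \<Longrightarrow> f differentiable (at z)"
    and "\<And>z h. z \<in> K \<Longrightarrow> norm h \<le> 1 \<Longrightarrow> norm (frechet_derivative f (at z) h) \<le> M"
  shows "norm (f x - f x') \<le> M * norm (x - x')"
proof (rule differentiable_bound[OF assms(1)])
  show "(f has_derivative frechet_derivative f (at z)) (at z within K)" if "z \<in> K" for z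
    using assms(4)[OF that] by (simp add: frechet_derivative_works has_derivative_at_withinI)
  show "onorm (frechet_derivative f (at z)) \<le> M" if "z \<in> K" for z
  proof (rule onorm_bound)
    show "0 \<le> M" by (rule order_trans[OF norm_ge_zero assms(5)[OF that, of 0]]) simp
    show "norm (frechet_derivative f (at z) h) \<le> M * norm h" for h
      using assms(4,5) that by (intro norm_linear_le_of_unit_bound) (auto intro: linear_frechet_derivative)
  qed
qed (use assms in auto)

text \<open>Mean value theorem on the segment from x' to x for f minus its derivative at x0. The
  point x0 need not lie on that segment: the derivative there differs from the one at x0 by at most
  M times the distance to x0, and by convexity of balls this distance is largest at an end.\<close>

lemma second_order_increment_bound:
  fixes f :: "'a::euclidean_space \<Rightarrow> 'b::real_normed_vector"
  assumes K: "convex K" "x0 \<in> K" "x \<in> K" "x' \<in> K" "K \<subseteq> S" and f: "Ck_on 2 f S"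
    and M: "\<And>z h h'. z \<in> K \<Longrightarrow> norm h \<le> 1 \<Longrightarrow> norm h' \<le> 1 \<Longrightarrow> norm (iter_deriv f [h, h'] z) \<le> M"
  shows "norm (f x - f x' - frechet_derivative f (at x0) (x - x'))
     \<le> M * (norm (x - x0) + norm (x' - x0)) * norm (x - x')"
proof -
  let ?D = "\<lambda>z. frechet_derivative f (at z)"
  let ?r = "norm (x - x0) + norm (x' - x0)"
  define J where "J = closed_segment x x'"
  have JK: "J \<subseteq> K" unfolding J_def using K by (simp add: closed_segment_subset)
  have diff: "f differentiable (at z)" if "z \<in> K" for z
    using f K that by (auto simp: numeral_2_eq_2)
  have lin: "linear (?D z)" if "z \<in> K" for z
    using diff[OF that] by (rule linear_frechet_derivative)
  have M0: "0 \<le> M" by (rule order_trans[OF norm_ge_zero M[OF K(2), of 0 0]]) auto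
  have D: "norm (?D z h - ?D x0 h) \<le> M * ?r" if "z \<in> J" "norm h \<le> 1" for z h
  proof -
    have "norm (?D z h - ?D x0 h) \<le> M * norm (z - x0)"
    proof (rule norm_diff_le_of_derivative_bound[where f = "\<lambda>z. ?D z h", OF K(1)])
      show "(\<lambda>z. ?D z h) differentiable (at w)" if "w \<in> K" for w
        using f K that by (auto simp: numeral_2_eq_2)
      show "norm (frechet_derivative (\<lambda>z. ?D z h) (at w) k) \<le> M" if "w \<in> K" "norm k \<le> 1" for w k
        using M[OF that(1) that(2) \<open>norm h \<le> 1\<close>] by simp
    qed (use that JK K in auto)
    moreover have "norm (z - x0) \<le> max (norm (x - x0)) (norm (x' - x0))"
    proof -
      let ?B = "cball x0 (max (norm (x - x0)) (norm (x' - x0)))"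
      have "closed_segment x x' \<subseteq> ?B"
        by (intro closed_segment_subset convex_cball) (auto simp: dist_norm norm_minus_commute)
      then have "z \<in> ?B" using that by (auto simp: J_def)
      then show ?thesis by (simp add: dist_norm norm_minus_commute)
    qed
    moreover have "max (norm (x - x0)) (norm (x' - x0)) \<le> ?r" by simp
    ultimately have "norm (z - x0) \<le> ?r" "norm (?D z h - ?D x0 h) \<le> M * norm (z - x0)"
      by linarith+
    with mult_left_mono[OF this(1) M0] show ?thesis by linarith
  qed
  have "norm ((f x - ?D x0 x) - (f x' - ?D x0 x')) \<le> M * ?r * norm (x - x')"
  proof (rule differentiable_bound[where f = "\<lambda>z. f z - ?D x0 z" and f' = "\<lambda>z h. ?D z h - ?D x0 h"])
    show "convex J" by (simp add: J_def)
    show "((\<lambda>z. f z - ?D x0 z) has_derivative (\<lambda>h. ?D z h - ?D x0 h)) (at z within J)"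
      if "z \<in> J" for z
    proof -
      have "(f has_derivative ?D z) (at z)"
        using diff that JK by (auto simp: frechet_derivative_works)
      moreover have "(?D x0 has_derivative ?D x0) (at z)"
        using lin[OF K(2)] by (simp add: linear_imp_has_derivative)
      ultimately show ?thesis by (rule has_derivative_at_withinI[OF has_derivative_diff])
    qed
    show "onorm (\<lambda>h. ?D z h - ?D x0 h) \<le> M * ?r" if "z \<in> J" for z
    proof (rule onorm_bound)
      have "linear (\<lambda>h. ?D z h - ?D x0 h)"
        using that JK by (intro linear_compose_sub lin K(2)) auto
      then show "norm (?D z h - ?D x0 h) \<le> M * ?r * norm h" for h
        by (rule norm_linear_le_of_unit_bound[where f = "\<lambda>h. ?D z h - ?D x0 h"]) (rule D[OF that])
    qed (use M0 in simp)
  qed (auto simp: J_def)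
  moreover have "(f x - ?D x0 x) - (f x' - ?D x0 x') = f x - f x' - ?D x0 (x - x')"
    by (simp add: linear_diff[OF lin[OF K(2)]])
  ultimately show ?thesis by simp
qed

section \<open>Weights and the uniform Green property\<close>

lemma weight_pos: "0 < weight \<alpha> T t"
  unfolding weight_def by (simp add: add_pos_pos)

lemma weight_le_2: "0 \<le> \<alpha> \<Longrightarrow> t \<le> T \<Longrightarrow> weight \<alpha> T t \<le> 2"
  unfolding weight_def by (smt (verit) exp_le_one_iff mult_nonneg_nonneg mult_minus_left of_nat_0_le_iff of_nat_mono)

lemma weight_antimono: "\<alpha> \<le> \<gamma> \<Longrightarrow> t \<le> T \<Longrightarrow> weight \<gamma> T t \<le> weight \<alpha> T t"
  unfolding weight_def by (intro add_mono) (auto intro!: mult_right_mono)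

text \<open>The exponential counted from 0 only shrinks in one step, the one counted from T grows by
  exactly \<open>exp \<alpha>\<close>. All factors \<open>1 + exp \<alpha>\<close> arise from
  here.\<close>

lemma weight_Suc_le:
  assumes "0 \<le> \<alpha>"
  shows "weight \<alpha> T (Suc t) \<le> exp \<alpha> * weight \<alpha> T t"
proof -
  have "exp (- \<alpha> * real (Suc t)) \<le> exp \<alpha> * exp (- \<alpha> * real t)"
    using assms by (simp add: exp_add[symmetric] algebra_simps)
  moreover have "exp (- \<alpha> * (real T - real (Suc t))) = exp \<alpha> * exp (- \<alpha> * (real T - real t))"
    by (simp add: exp_add[symmetric] algebra_simps)
  ultimately show ?thesis by (simp add: weight_def distrib_left)
qed

lemma norm_le_wnorm:
  assumes "t \<le> T"
  shows "norm (z t) \<le> wnorm \<alpha> T z * weight \<alpha> T t"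
proof -
  have "norm (z t) / weight \<alpha> T t \<le> wnorm \<alpha> T z"
    unfolding wnorm_def using assms by (intro Max_ge) auto
  then show ?thesis using weight_pos[of \<alpha> T t] by (simp add: divide_le_eq)
qed

lemma wnorm_le_iff: "wnorm \<alpha> T z \<le> \<rho> \<longleftrightarrow> (\<forall>t\<le>T. norm (z t) \<le> \<rho> * weight \<alpha> T t)"
proof -
  have "wnorm \<alpha> T z \<le> \<rho> \<longleftrightarrow> (\<forall>t\<le>T. norm (z t) / weight \<alpha> T t \<le> \<rho>)"
    unfolding wnorm_def by (subst Max_le_iff) auto
  then show ?thesis using weight_pos[of \<alpha> T] by (simp add: divide_le_eq)
qed

lemma wnorm_nonneg: "0 \<le> wnorm \<alpha> T z"
  using order_trans[OF norm_ge_zero norm_le_wnorm[of 0 T z \<alpha>]] weight_pos[of \<alpha> T 0]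
  by (simp add: zero_le_mult_iff)

text \<open>Of the four products of exponentials, the two mixed ones are the reflected terms of
  \<open>kappa\<close>; the other two are each below its diagonal term, since t + s and (T - t) + (T
  - s) are both at least |t - s|. It absorbs into the kernel the part of the forcing that acts
  through the boundary.\<close>

lemma weight_mult_weight_le_kappa:
  assumes "0 \<le> \<gamma>" "t \<le> T" "s \<le> T"
  shows "weight \<gamma> T t * weight \<gamma> T s \<le> 2 * kappa \<gamma> T t s"
proof -
  have 1: "exp (- \<gamma> * real t) * exp (- \<gamma> * real s) \<le> exp (- \<gamma> * \<bar>real t - real s\<bar>)"
    unfolding exp_add[symmetric] exp_le_cancel_iff distrib_left[symmetric]
    by (intro mult_left_mono_neg) (use assms in auto)
  have 2: "exp (- \<gamma> * real t) * exp (- \<gamma> * (real T - real s)) = exp (- \<gamma> * (real t + real T - real s))"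
    by (simp add: exp_add[symmetric] algebra_simps)
  have 3: "exp (- \<gamma> * (real T - real t)) * exp (- \<gamma> * real s) = exp (- \<gamma> * (real T - real t + real s))"
    by (simp add: exp_add[symmetric] algebra_simps)
  have 4: "exp (- \<gamma> * (real T - real t)) * exp (- \<gamma> * (real T - real s)) \<le> exp (- \<gamma> * \<bar>real t - real s\<bar>)"
    unfolding exp_add[symmetric] exp_le_cancel_iff distrib_left[symmetric]
    by (intro mult_left_mono_neg) (use assms in auto)
  have "weight \<gamma> T t * weight \<gamma> T s
      = exp (- \<gamma> * real t) * exp (- \<gamma> * real s) + exp (- \<gamma> * real t) * exp (- \<gamma> * (real T - real s))
        + (exp (- \<gamma> * (real T - real t)) * exp (- \<gamma> * real s)
        + exp (- \<gamma> * (real T - real t)) * exp (- \<gamma> * (real T - real s)))"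
    unfolding weight_def by (simp add: algebra_simps)
  also have "\<dots> \<le> exp (- \<gamma> * \<bar>real t - real s\<bar>) + exp (- \<gamma> * (real t + real T - real s))
      + (exp (- \<gamma> * (real T - real t + real s)) + exp (- \<gamma> * \<bar>real t - real s\<bar>))"
    using 1 2 3 4 by (intro add_mono) auto
  also have "\<dots> \<le> 2 * kappa \<gamma> T t s"
    unfolding kappa_def by simp
  finally show ?thesis .
qed

lemma kappa_terminal_le:
  assumes "0 \<le> \<gamma>" "s \<le> T"
  shows "kappa \<gamma> T T s \<le> 2 * weight \<gamma> T s"
proof -
  have "exp (- \<gamma> * (real T + real T - real s)) \<le> exp (- \<gamma> * (real T - real s))"
    unfolding exp_le_cancel_iff by (intro mult_left_mono_neg) (use assms in auto)
  then have "kappa \<gamma> T T s \<le> exp (- \<gamma> * (real T - real s)) + exp (- \<gamma> * (real T - real s))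
      + exp (- \<gamma> * real s)"
    unfolding kappa_def using assms by (intro add_mono) auto
  also have "\<dots> \<le> 2 * weight \<gamma> T s"
    unfolding weight_def by simp
  finally show ?thesis .
qed

lemma kappa_nonneg: "0 \<le> kappa \<gamma> T t s"
  unfolding kappa_def by simp

lemma uniform_green_linear:
  assumes "uniform_green L B C \<gamma> T0"
  shows "linear L" "linear B" "1 \<le> C" "0 < \<gamma>" "1 \<le> T0"
  using assms unfolding uniform_green_def by auto

lemma uniform_green_ex:
  assumes "uniform_green L B C \<gamma> T0" "T0 \<le> T"
  shows "\<exists>h. solves_bvp L B T f b h"
  using assms unfolding uniform_green_def by blast

lemma uniform_green_bound:
  assumes "uniform_green L B C \<gamma> T0" "T0 \<le> T" "solves_bvp L B T f b h" "t \<le> T"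
  shows "norm (h t) \<le> C * (weight \<gamma> T t * norm b + (\<Sum>s<T. kappa \<gamma> T t s * norm (f s)))"
  using assms unfolding uniform_green_def weight_def by blast

lemma solves_bvp_diff:
  assumes "linear L" "linear B" "solves_bvp L B T f b h" "solves_bvp L B T f' b' h'"
  shows "solves_bvp L B T (\<lambda>t. f t - f' t) (b - b') (\<lambda>t. h t - h' t)"
  using assms(3,4) unfolding solves_bvp_def
  by (auto simp: linear_diff[OF assms(1), of "(_, _)" "(_, _)", simplified]
      linear_diff[OF assms(2), of "(_, _)" "(_, _)", simplified])

text \<open>Uniqueness comes from the bound, applied to the difference of two solutions, which has
  zero data.\<close>

lemma uniform_greenI:
  assumes "linear L" "linear B" "1 \<le> C" "0 < \<gamma>" "1 \<le> T0"
    and ex: "\<And>T f b. T0 \<le> T \<Longrightarrow> \<exists>h. solves_bvp L B T f b h"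
    and bound: "\<And>T f b h t. T0 \<le> T \<Longrightarrow> solves_bvp L B T f b h \<Longrightarrow> t \<le> T \<Longrightarrow>
      norm (h t) \<le> C * (weight \<gamma> T t * norm b + (\<Sum>s<T. kappa \<gamma> T t s * norm (f s)))"
  shows "uniform_green L B C \<gamma> T0"
proof -
  have "h t = h' t" if "T0 \<le> T" "solves_bvp L B T f b h" "solves_bvp L B T f b h'" "t \<le> T"
    for T f b h h' t
    using bound[OF that(1) solves_bvp_diff[OF assms(1,2) that(2,3)] that(4)] by simp
  then show ?thesis
    using assms unfolding uniform_green_def weight_def by blast
qed

text \<open>The perturbed problem is the unperturbed one with the boundary datum corrected by the
  terminal value, a correction of Lipschitz constant \<open>2 C \<epsilon> < 1\<close>.\<close>

lemma uniform_green_perturb: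
  fixes L B B' :: "'a::euclidean_space \<times> 'a \<Rightarrow> 'a" and E :: "'a \<Rightarrow> 'a"
  assumes green: "uniform_green L B C \<gamma> T0" and "linear B'"
    and B': "\<And>a b. B' (a, b) = B (a, b) + E b"
    and E: "linear E" "\<And>v. norm (E v) \<le> \<epsilon> * norm v" and "0 \<le> \<epsilon>"
    and \<theta>: "\<theta> = 2 * C * \<epsilon>" "\<theta> < 1"
  shows "uniform_green L B' (C * (1 + \<theta>) / (1 - \<theta>)) \<gamma> T0"
proof (rule uniform_greenI)
  note lin = uniform_green_linear[OF green]
  have \<theta>0: "0 \<le> \<theta>" using \<theta> \<open>0 \<le> \<epsilon>\<close> lin by simp
  show "linear L" "linear B'" "0 < \<gamma>" "1 \<le> T0" by fact+
  have "1 * 1 \<le> C * ((1 + \<theta>) / (1 - \<theta>))"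
    using lin \<theta>0 \<theta> by (intro mult_mono) auto
  then show "1 \<le> C * (1 + \<theta>) / (1 - \<theta>)" by simp
  show "\<exists>h. solves_bvp L B' T f b h" if T: "T0 \<le> T" for T f b
  proof -
    \<comment> \<open>Unperturbed solution with boundary datum \<beta>. It solves the perturbed
      problem exactly when \<beta> = b - E (h \<beta> T), a fixed point equation in the
      finite-dimensional space of data.\<close>
    define h where "h = (\<lambda>\<beta>. SOME h. solves_bvp L B T f \<beta> h)"
    have h: "solves_bvp L B T f \<beta> (h \<beta>)" for \<beta>
      unfolding h_def using uniform_green_ex[OF green T] by (rule someI_ex)
    have "\<exists>!\<beta>. b - E (h \<beta> T) = \<beta>"
    proof (rule banach_fix_type)
      show "\<forall>\<beta> \<beta>'. dist (b - E (h \<beta> T)) (b - E (h \<beta>' T)) \<le> \<theta> * dist \<beta> \<beta>'"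
      proof (intro allI)
        fix \<beta> \<beta>' :: 'a
        have "norm (h \<beta>' T - h \<beta> T) \<le> C * (weight \<gamma> T T * norm (\<beta>' - \<beta>))"
          using uniform_green_bound[OF green T solves_bvp_diff[OF lin(1,2) h h], of T \<beta>' \<beta>] by simp
        also have "\<dots> \<le> C * (2 * norm (\<beta>' - \<beta>))"
          using lin weight_le_2[of \<gamma> T T] by (intro mult_left_mono mult_right_mono) auto
        finally have "\<epsilon> * norm (h \<beta>' T - h \<beta> T) \<le> \<epsilon> * (C * (2 * norm (\<beta>' - \<beta>)))"
          using \<open>0 \<le> \<epsilon>\<close> by (rule mult_left_mono)
        then have "norm (E (h \<beta>' T - h \<beta> T)) \<le> \<theta> * norm (\<beta>' - \<beta>)"
          using E(2)[of "h \<beta>' T - h \<beta> T"] by (simp add: \<theta> algebra_simps)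
        then show "dist (b - E (h \<beta> T)) (b - E (h \<beta>' T)) \<le> \<theta> * dist \<beta> \<beta>'"
          by (simp add: dist_norm linear_diff[OF E(1)] norm_minus_commute)
      qed
    qed (use \<theta> \<theta>0 in auto)
    then obtain \<beta> where "b - E (h \<beta> T) = \<beta>" by blast
    then have "solves_bvp L B' T f b (h \<beta>)"
      using h[of \<beta>] by (auto simp: solves_bvp_def B' algebra_simps)
    then show ?thesis by blast
  qed
  show "norm (h t) \<le> C * (1 + \<theta>) / (1 - \<theta>) *
      (weight \<gamma> T t * norm b + (\<Sum>s<T. kappa \<gamma> T t s * norm (f s)))"
    if T: "T0 \<le> T" and h: "solves_bvp L B' T f b h" and t: "t \<le> T" for T f b h t
  proof -
    define \<beta> where "\<beta> = b - E (h T)"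
    define k where "k = (\<lambda>t. \<Sum>s<T. kappa \<gamma> T t s * norm (f s))"
    have \<beta>: "solves_bvp L B T f \<beta> h"
      using h by (auto simp: solves_bvp_def B' \<beta>_def)
    have bd: "norm (h t) \<le> C * (weight \<gamma> T t * norm \<beta> + k t)" if "t \<le> T" for t
      unfolding k_def by (rule uniform_green_bound[OF green T \<beta> that])
    have "norm (h T) \<le> C * (2 * norm \<beta> + k T)"
      by (rule order_trans[OF bd[OF order_refl]])
        (intro mult_left_mono add_right_mono mult_right_mono, use lin weight_le_2[of \<gamma> T T] in simp_all)
    then have "\<epsilon> * norm (h T) \<le> \<epsilon> * (C * (2 * norm \<beta> + k T))"
      using \<open>0 \<le> \<epsilon>\<close> by (rule mult_left_mono)
    moreover have "norm \<beta> \<le> norm b + \<epsilon> * norm (h T)"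
      using norm_triangle_ineq4[of b "E (h T)"] E(2)[of "h T"] by (simp add: \<beta>_def)
    ultimately have "(1 - \<theta>) * norm \<beta> \<le> norm b + \<theta> / 2 * k T"
      by (simp add: \<theta> algebra_simps)
    then have \<beta>_le: "norm \<beta> \<le> (norm b + \<theta> / 2 * k T) / (1 - \<theta>)"
      using \<theta> by (simp add: le_divide_eq mult.commute)
    \<comment> \<open>The forcing reaches the terminal time, changes the datum there and acts back
      at time t; this round trip costs a factor 4 but stays within the kernel at t.\<close>
    have kk: "weight \<gamma> T t * k T \<le> 4 * k t"
    proof -
      have "weight \<gamma> T t * kappa \<gamma> T T s \<le> 4 * kappa \<gamma> T t s" if "s < T" for s
      proof -
        have "weight \<gamma> T t * kappa \<gamma> T T s \<le> weight \<gamma> T t * (2 * weight \<gamma> T s)"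
          using kappa_terminal_le[of \<gamma> s T] lin that weight_pos[of \<gamma> T t]
          by (intro mult_left_mono) auto
        then show ?thesis using weight_mult_weight_le_kappa[of \<gamma> t T s] lin that t by linarith
      qed
      then have "weight \<gamma> T t * k T \<le> (\<Sum>s<T. 4 * kappa \<gamma> T t s * norm (f s))"
        unfolding k_def sum_distrib_left mult.assoc[symmetric]
        by (intro sum_mono mult_right_mono) auto
      then show ?thesis by (simp add: k_def sum_distrib_left mult.assoc)
    qed
    have "norm (h t) \<le> C * (weight \<gamma> T t * norm \<beta> + k t)" by (rule bd[OF t])
    also have "\<dots> \<le> C * (weight \<gamma> T t * ((norm b + \<theta> / 2 * k T) / (1 - \<theta>)) + k t)"
      by (intro mult_left_mono add_right_mono \<beta>_le) (use weight_pos[of \<gamma> T t] lin in simp_all)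
    also have "\<dots> = C / (1 - \<theta>) * (weight \<gamma> T t * norm b + \<theta> / 2 * (weight \<gamma> T t * k T) + (1 - \<theta>) * k t)"
    proof -
      have "C * (w * ((n + \<theta> / 2 * k') / u) + k'') = C / u * (w * n + \<theta> / 2 * (w * k') + u * k'')"
        if "u \<noteq> 0" for w n k' k'' u :: real
        using that by (simp add: add_divide_distrib algebra_simps)
      then show ?thesis using \<theta> by simp
    qed
    \<comment> \<open>Origin of the factor 1 + \<theta>: the round trip contributes 2 \<theta> k and
      the direct term (1 - \<theta>) k. The datum term is enlarged to match.\<close>
    also have "\<dots> \<le> C / (1 - \<theta>) * ((1 + \<theta>) * (weight \<gamma> T t * norm b) + \<theta> / 2 * (4 * k t) + (1 - \<theta>) * k t)"
    proof (intro mult_left_mono add_right_mono add_mono)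
      show "weight \<gamma> T t * norm b \<le> (1 + \<theta>) * (weight \<gamma> T t * norm b)"
        using weight_pos[of \<gamma> T t] \<theta>0 by (simp add: distrib_right)
    qed (use kk \<theta> \<theta>0 lin in auto)
    also have "\<dots> = C * (1 + \<theta>) / (1 - \<theta>) * (weight \<gamma> T t * norm b + k t)"
    proof -
      have "C / u * ((1 + \<theta>) * n + \<theta> / 2 * (4 * k') + (1 - \<theta>) * k') = C * (1 + \<theta>) / u * (n + k')"
        for n k' u :: real
        by (simp add: add_divide_distrib algebra_simps)
      then show ?thesis .
    qed
    finally show ?thesis unfolding k_def .
  qed
qed

text \<open>Picard iteration from the zero sequence, with limits taken separately at each time up to
  T. Contraction is required for every bound D on the weighted distance, so no metric on sequences
  has to be introduced.\<close>

lemma weighted_contraction_fixpoint: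
  fixes \<Phi> :: "(nat \<Rightarrow> 'a::banach) \<Rightarrow> nat \<Rightarrow> 'a" and w :: "nat \<Rightarrow> real"
    and q R :: real and T :: nat
  defines "in_ball \<equiv> \<lambda>z. \<forall>t\<le>T. norm (z t) \<le> R * w t"
  assumes w: "\<And>t. 0 < w t" and q: "0 \<le> q" "q < 1" and R: "0 \<le> R"
    and self: "\<And>z. in_ball z \<Longrightarrow> in_ball (\<Phi> z)"
    and contr: "\<And>z z' D t. in_ball z \<Longrightarrow> in_ball z' \<Longrightarrow> (\<forall>t\<le>T. norm (z t - z' t) \<le> D * w t) \<Longrightarrow> t \<le> T \<Longrightarrow>
      norm (\<Phi> z t - \<Phi> z' t) \<le> q * D * w t"
  obtains z where "in_ball z" "\<forall>t\<le>T. \<Phi> z t = z t"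
proof -
  define X where "X = (\<lambda>n. (\<Phi> ^^ n) (\<lambda>_. 0))"
  have XS: "X (Suc n) = \<Phi> (X n)" for n by (simp add: X_def)
  have "in_ball (\<lambda>_. 0)" using w R by (auto simp: in_ball_def less_imp_le)
  then have Xb: "in_ball (X n)" for n by (induction n) (auto simp: X_def self)
  have step: "\<forall>t\<le>T. norm (X (Suc n) t - X n t) \<le> q ^ n * R * w t" for n
  proof (induction n)
    case 0
    have "X 0 = (\<lambda>_. 0)" by (simp add: X_def)
    then show ?case using Xb[of 1] by (auto simp: in_ball_def)
  next
    case (Suc n)
    show ?case
      using contr[OF Xb Xb Suc] by (auto simp: XS mult.assoc)
  qed
  have "\<exists>l. (\<lambda>n. X n t) \<longlonglongrightarrow> l" if t: "t \<le> T" for t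
  proof -
    have "summable (\<lambda>n. X (Suc n) t - X n t)"
    proof (rule summable_comparison_test')
      show "summable (\<lambda>n. q ^ n * (R * w t))"
        using q by (intro summable_mult2 summable_geometric) simp
      show "norm (X (Suc n) t - X n t) \<le> q ^ n * (R * w t)" if "0 \<le> n" for n
        using step t by (simp add: mult.assoc)
    qed
    then have "convergent (\<lambda>n. X n t - X 0 t)"
      unfolding summable_iff_convergent sum_lessThan_telescope[of "\<lambda>n. X n t"] .
    then have "convergent (\<lambda>n. X n t)"
      by (simp add: X_def)
    then show ?thesis by (simp add: convergent_def)
  qed
  then obtain z where z: "\<And>t. t \<le> T \<Longrightarrow> (\<lambda>n. X n t) \<longlonglongrightarrow> z t" by metis
  have zb: "in_ball z"
    unfolding in_ball_def
  proof (intro allI impI)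
    fix t assume t: "t \<le> T"
    show "norm (z t) \<le> R * w t"
      by (rule LIMSEQ_le_const2[OF tendsto_norm[OF z[OF t]]]) (use Xb t in \<open>auto simp: in_ball_def\<close>)
  qed
  \<comment> \<open>A sum over the finitely many times dominates the weighted distance to the limit
    and tends to 0, which turns convergence at each time into a bound of the form required by
    \<open>contr\<close>.\<close>
  define D where "D = (\<lambda>n. \<Sum>t\<le>T. norm (X n t - z t) / w t)"
  have D0: "D \<longlonglongrightarrow> 0"
  proof -
    have "(\<lambda>n. \<Sum>t\<le>T. norm (X n t - z t) / w t) \<longlonglongrightarrow> (\<Sum>t\<le>T. norm (z t - z t) / w t)"
      by (intro tendsto_intros z) (use w in \<open>auto simp: less_imp_neq[symmetric]\<close>)
    then show ?thesis by (simp add: D_def)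
  qed
  have "\<forall>t\<le>T. norm (X n t - z t) \<le> D n * w t" for n
  proof (intro allI impI)
    fix t assume t: "t \<le> T"
    have "norm (X n t - z t) / w t \<le> D n"
      unfolding D_def using t w
      by (intro member_le_sum) (auto simp: less_imp_le)
    then show "norm (X n t - z t) \<le> D n * w t" using w[of t] by (simp add: divide_le_eq)
  qed
  note DX = contr[OF Xb zb this]
  have "\<Phi> z t = z t" if t: "t \<le> T" for t
  proof -
    have lim: "(\<lambda>n. q * D n * w t) \<longlonglongrightarrow> q * 0 * w t"
      by (intro tendsto_intros D0)
    have "(\<lambda>n. X (Suc n) t - \<Phi> z t) \<longlonglongrightarrow> 0"
      by (rule Lim_null_comparison[OF _ lim[simplified]]) (use DX t in \<open>simp add: XS\<close>)
    then have "(\<lambda>n. X (Suc n) t) \<longlonglongrightarrow> \<Phi> z t" by (simp add: LIM_zero_iff)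
    then show ?thesis using LIMSEQ_unique LIMSEQ_Suc[OF z[OF t]] by blast
  qed
  then show ?thesis using that zb by blast
qed

text \<open>The quadratic inequality alone would also admit values beyond the larger root; \<rho>
  \<le> R < 1/(2a) keeps \<rho> to the left of the vertex. Completing the square gives 1 - 4 a
  \<delta> \<le> (1 - 2 a \<rho>)^2 with a nonnegative base.\<close>

lemma smaller_root_bound:
  fixes a \<rho> R \<delta> :: real
  assumes "0 \<le> a" "2 * a * R < 1" "\<rho> \<le> R" "\<rho> \<le> \<delta> + a * \<rho>\<^sup>2"
  shows "\<rho> \<le> (if a = 0 then \<delta> else (1 - sqrt (1 - 4 * a * \<delta>)) / (2 * a))"
proof (cases "a = 0")
  case False
  have "2 * a * \<rho> \<le> 2 * a * R" using assms by (intro mult_left_mono) auto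
  then have "0 \<le> 1 - 2 * a * \<rho>" using assms by linarith
  moreover have "a * \<rho> \<le> a * (\<delta> + a * \<rho>\<^sup>2)" using assms by (intro mult_left_mono) auto
  then have "1 - 4 * a * \<delta> \<le> (1 - 2 * a * \<rho>)\<^sup>2"
    by (simp add: power2_eq_square algebra_simps)
  ultimately have "sqrt (1 - 4 * a * \<delta>) \<le> 1 - 2 * a * \<rho>"
    using real_le_lsqrt by blast
  then show ?thesis using False assms by (simp add: le_divide_eq algebra_simps)
qed (use assms in auto)

section \<open>The weighted nonlinear boundary value problem\<close>

text \<open>The branch problem at one fixed y: B stands for the linearised rows, N and Q for the
  remainders of step and endpoint condition, S for the tube. Only differences of N and Q are
  estimated; quadratic smallness follows by comparison with zero.\<close>

locale nonlinear_bvp =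
  fixes L B :: "'a::euclidean_space \<times> 'a \<Rightarrow> 'a" and c \<gamma> \<alpha> :: real and T0 :: nat
    and N :: "'a \<times> 'a \<Rightarrow> 'a" and Q :: "'a \<Rightarrow> 'a" and S :: "'a set"
    and CN Cconv CB R A :: real
  assumes green: "uniform_green L B c \<gamma> T0"
    and \<alpha>: "0 \<le> \<alpha>" "\<alpha> \<le> \<gamma>"
    and N: "\<And>a b a' b'. a \<in> S \<Longrightarrow> b \<in> S \<Longrightarrow> a' \<in> S \<Longrightarrow> b' \<in> S \<Longrightarrow> norm (N (a, b) - N (a', b')) \<le>
        CN * (norm a + norm b + norm a' + norm b') * (norm (a - a') + norm (b - b'))"
    and N0: "N (0, 0) = 0"
    and Q: "\<And>a a'. a \<in> S \<Longrightarrow> a' \<in> S \<Longrightarrow> norm (Q a - Q a') \<le> CB * (norm a + norm a') * norm (a - a')"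
    and Q0: "Q 0 = 0"
    and CN: "0 \<le> CN" and CB: "0 \<le> CB"
    and conv: "\<And>T t. T0 \<le> T \<Longrightarrow> t \<le> T \<Longrightarrow>
        (\<Sum>s<T. kappa \<gamma> T t s * (weight \<alpha> T s)\<^sup>2) \<le> Cconv * (weight \<alpha> T t)\<^sup>2"
      "\<And>T t. T0 \<le> T \<Longrightarrow> t \<le> T \<Longrightarrow> weight \<gamma> T t \<le> Cconv * (weight \<alpha> T t)\<^sup>2"
    and A: "A = 2 * c * Cconv * CN * (1 + exp \<alpha>)\<^sup>2 + 16 * c * CB"
    and R: "0 < R" "2 * A * R < 1"
    and tube: "\<And>T z t. T0 \<le> T \<Longrightarrow> (\<forall>t\<le>T. norm (z t) \<le> R * weight \<alpha> T t) \<Longrightarrow> t \<le> T \<Longrightarrow> z t \<in> S"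
begin

lemmas lin = uniform_green_linear[OF green]

lemma Cconv_pos: "0 < Cconv"
proof -
  have "0 < Cconv * (weight \<alpha> T0 0)\<^sup>2"
    using conv(2)[of T0 0] weight_pos[of \<gamma> T0 0] by linarith
  then show ?thesis by (simp add: zero_less_mult_iff)
qed

lemma A_nonneg: "0 \<le> A"
  unfolding A using lin Cconv_pos CN CB by simp

definition in_ball :: "nat \<Rightarrow> (nat \<Rightarrow> 'a) \<Rightarrow> bool" where
  "in_ball T z \<longleftrightarrow> (\<forall>t\<le>T. norm (z t) \<le> R * weight \<alpha> T t)"

definition nl_sol :: "nat \<Rightarrow> 'a \<Rightarrow> (nat \<Rightarrow> 'a) \<Rightarrow> bool" where
  "nl_sol T \<Delta> z \<longleftrightarrow> solves_bvp L B T (\<lambda>t. - N (z t, z (Suc t))) (\<Delta> + Q (z T)) z"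

text \<open>The boundary part, carrying the weight with exponent \<gamma>, is kept apart from the
  forcing part, carrying w^2. The Lipschitz estimate later weakens both to w, while the expansion
  brings both to w^2.\<close>

lemma linear_bound:
  assumes T: "T0 \<le> T" and h: "solves_bvp L B T f b h" and "t \<le> T"
    and b: "norm b \<le> \<beta>" and f: "\<And>s. s < T \<Longrightarrow> norm (f s) \<le> \<phi> * (weight \<alpha> T s)\<^sup>2" and "0 \<le> \<phi>"
  shows "norm (h t) \<le> c * (weight \<gamma> T t * \<beta> + \<phi> * Cconv * (weight \<alpha> T t)\<^sup>2)"
proof -
  have "(\<Sum>s<T. kappa \<gamma> T t s * norm (f s)) \<le> (\<Sum>s<T. kappa \<gamma> T t s * (\<phi> * (weight \<alpha> T s)\<^sup>2))"
    using f by (intro sum_mono mult_left_mono kappa_nonneg) auto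
  also have "\<dots> = \<phi> * (\<Sum>s<T. kappa \<gamma> T t s * (weight \<alpha> T s)\<^sup>2)"
    by (simp add: sum_distrib_left algebra_simps)
  also have "\<dots> \<le> \<phi> * (Cconv * (weight \<alpha> T t)\<^sup>2)"
    using conv(1)[OF T \<open>t \<le> T\<close>] \<open>0 \<le> \<phi>\<close> by (rule mult_left_mono)
  finally have "(\<Sum>s<T. kappa \<gamma> T t s * norm (f s)) \<le> \<phi> * Cconv * (weight \<alpha> T t)\<^sup>2"
    by (simp add: mult.assoc)
  moreover have "weight \<gamma> T t * norm b \<le> weight \<gamma> T t * \<beta>"
    using b weight_pos[of \<gamma> T t] by (intro mult_left_mono) auto
  ultimately have "weight \<gamma> T t * norm b + (\<Sum>s<T. kappa \<gamma> T t s * norm (f s))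
      \<le> weight \<gamma> T t * \<beta> + \<phi> * Cconv * (weight \<alpha> T t)\<^sup>2"
    by (rule add_mono[rotated])
  then have "c * (weight \<gamma> T t * norm b + (\<Sum>s<T. kappa \<gamma> T t s * norm (f s)))
      \<le> c * (weight \<gamma> T t * \<beta> + \<phi> * Cconv * (weight \<alpha> T t)\<^sup>2)"
    by (rule mult_left_mono) (use lin in simp)
  then show ?thesis
    using uniform_green_bound[OF green T h \<open>t \<le> T\<close>] by linarith
qed

lemma pair_le:
  assumes "\<forall>t\<le>T. norm (d t) \<le> \<rho> * weight \<alpha> T t" "0 \<le> \<rho>" "s < T"
  shows "norm (d s) + norm (d (Suc s)) \<le> (1 + exp \<alpha>) * \<rho> * weight \<alpha> T s"
proof -
  have "norm (d (Suc s)) \<le> \<rho> * weight \<alpha> T (Suc s)" using assms by auto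
  also have "\<dots> \<le> \<rho> * (exp \<alpha> * weight \<alpha> T s)"
    using weight_Suc_le[OF \<alpha>(1)] assms by (intro mult_left_mono) auto
  finally have "norm (d (Suc s)) \<le> \<rho> * (exp \<alpha> * weight \<alpha> T s)" .
  moreover have "norm (d s) \<le> \<rho> * weight \<alpha> T s" using assms by auto
  ultimately have "norm (d s) + norm (d (Suc s)) \<le> \<rho> * weight \<alpha> T s + \<rho> * (exp \<alpha> * weight \<alpha> T s)"
    by (rule add_mono[rotated])
  then show ?thesis by (simp add: algebra_simps)
qed

text \<open>The sizes \<rho>, \<rho>' and the distance D are independent of R, so that one estimate
  serves the contraction (both sizes R), the size bound (second sequence zero) and the expansion
  (size proportional to the datum).\<close>

context
  fixes T :: nat and z z' :: "nat \<Rightarrow> 'a" and \<rho> \<rho>' D :: real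
  assumes T: "T0 \<le> T" and zb: "in_ball T z" "in_ball T z'"
    and \<rho>: "\<forall>t\<le>T. norm (z t) \<le> \<rho> * weight \<alpha> T t" "0 \<le> \<rho>"
    and \<rho>': "\<forall>t\<le>T. norm (z' t) \<le> \<rho>' * weight \<alpha> T t" "0 \<le> \<rho>'"
    and D: "\<forall>t\<le>T. norm (z t - z' t) \<le> D * weight \<alpha> T t" "0 \<le> D"
begin

lemma step_N:
  assumes "s < T"
  shows "norm (N (z s, z (Suc s)) - N (z' s, z' (Suc s)))
    \<le> CN * (1 + exp \<alpha>)\<^sup>2 * (\<rho> + \<rho>') * D * (weight \<alpha> T s)\<^sup>2"
proof -
  have mem: "z t \<in> S" "z' t \<in> S" if "t \<le> T" for t
    using tube[OF T] zb that unfolding in_ball_def by auto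
  let ?e = "(1 + exp \<alpha>) * weight \<alpha> T s"
  have "norm (z s) + norm (z (Suc s)) \<le> (1 + exp \<alpha>) * \<rho> * weight \<alpha> T s"
    "norm (z' s) + norm (z' (Suc s)) \<le> (1 + exp \<alpha>) * \<rho>' * weight \<alpha> T s"
    by (rule pair_le[OF \<rho> assms], rule pair_le[OF \<rho>' assms])
  then have 1: "norm (z s) + norm (z (Suc s)) + norm (z' s) + norm (z' (Suc s)) \<le> ?e * (\<rho> + \<rho>')"
    by (simp add: algebra_simps)
  have 2: "norm (z s - z' s) + norm (z (Suc s) - z' (Suc s)) \<le> ?e * D"
    using pair_le[OF D assms] by (simp add: algebra_simps)
  have "norm (N (z s, z (Suc s)) - N (z' s, z' (Suc s))) \<le>
      CN * (norm (z s) + norm (z (Suc s)) + norm (z' s) + norm (z' (Suc s)))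
        * (norm (z s - z' s) + norm (z (Suc s) - z' (Suc s)))"
    using assms by (intro N mem) auto
  also have "\<dots> \<le> CN * (?e * (\<rho> + \<rho>')) * (?e * D)"
    using 1 2 CN \<rho> \<rho>' weight_pos[of \<alpha> T s]
    by (intro mult_mono mult_nonneg_nonneg add_nonneg_nonneg) auto
  also have "\<dots> = CN * (1 + exp \<alpha>)\<^sup>2 * (\<rho> + \<rho>') * D * (weight \<alpha> T s)\<^sup>2"
    by (simp add: power2_eq_square algebra_simps)
  finally show ?thesis .
qed

lemma step_Q: "norm (Q (z T) - Q (z' T)) \<le> 4 * CB * (\<rho> + \<rho>') * D"
proof -
  have mem: "z T \<in> S" "z' T \<in> S"
    using tube[OF T] zb unfolding in_ball_def by auto
  have le2: "norm (d T) \<le> r * 2" if "\<forall>t\<le>T. norm (d t) \<le> r * weight \<alpha> T t" "0 \<le> r"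
    for r and d :: "nat \<Rightarrow> 'a"
    using that weight_le_2[OF \<alpha>(1), of T T] by (meson order_refl order_trans mult_left_mono)
  have "norm (z T) + norm (z' T) \<le> (\<rho> + \<rho>') * 2"
    using le2[OF \<rho>] le2[OF \<rho>'] by (simp add: algebra_simps)
  moreover have "norm (z T - z' T) \<le> D * 2" by (rule le2[OF D])
  ultimately have "CB * (norm (z T) + norm (z' T)) * norm (z T - z' T) \<le> CB * ((\<rho> + \<rho>') * 2) * (D * 2)"
    using CB \<rho> \<rho>' by (intro mult_mono mult_nonneg_nonneg) auto
  then show ?thesis using Q[OF mem] by (simp add: algebra_simps)
qed

lemma step_bound:
  assumes h: "solves_bvp L B T (\<lambda>t. - N (z t, z (Suc t))) (\<Delta> + Q (z T)) h"
    and h': "solves_bvp L B T (\<lambda>t. - N (z' t, z' (Suc t))) (\<Delta>' + Q (z' T)) h'"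
    and t: "t \<le> T"
  shows "norm (h t - h' t) \<le> (c * norm (\<Delta> - \<Delta>') + A * (\<rho> + \<rho>') * D) * weight \<alpha> T t"
proof -
  let ?w = "weight \<alpha> T t" and ?\<phi> = "CN * (1 + exp \<alpha>)\<^sup>2 * (\<rho> + \<rho>') * D"
    and ?\<beta> = "norm (\<Delta> - \<Delta>') + 4 * CB * (\<rho> + \<rho>') * D"
  have \<phi>: "0 \<le> ?\<phi>" "0 \<le> ?\<beta>" using CN CB \<rho> \<rho>' D by auto
  have w: "0 < ?w" "?w \<le> 2" "weight \<gamma> T t \<le> ?w"
    using weight_pos weight_le_2 weight_antimono \<alpha> t by auto
  have "norm (h t - h' t) \<le> c * (weight \<gamma> T t * ?\<beta> + ?\<phi> * Cconv * ?w\<^sup>2)"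
  proof (rule linear_bound[OF T solves_bvp_diff[OF lin(1,2) h h'] t])
    have "norm ((\<Delta> - \<Delta>') + (Q (z T) - Q (z' T))) \<le> ?\<beta>"
      by (rule norm_triangle_le) (use step_Q in simp)
    then show "norm (\<Delta> + Q (z T) - (\<Delta>' + Q (z' T))) \<le> ?\<beta>"
      by (simp add: algebra_simps)
    show "norm (- N (z s, z (Suc s)) - - N (z' s, z' (Suc s))) \<le> ?\<phi> * (weight \<alpha> T s)\<^sup>2" if "s < T" for s
      using step_N[OF that] by (simp add: norm_minus_commute)
  qed fact
  also have "\<dots> \<le> c * (?w * ?\<beta> + ?\<phi> * Cconv * (2 * ?w))"
  proof (intro mult_left_mono add_mono mult_right_mono)
    show "?w\<^sup>2 \<le> 2 * ?w" using w by (simp add: power2_eq_square)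
  qed (use w \<phi> lin Cconv_pos in auto)
  \<comment> \<open>The terminal term arrives with factor 4, as w \<le> 2 at T is used twice;
    \<open>A\<close> allots 16, and the surplus 12 is the nonnegative quantity below.\<close>
  also have "\<dots> \<le> (c * norm (\<Delta> - \<Delta>') + A * (\<rho> + \<rho>') * D) * ?w"
  proof -
    have "0 \<le> 12 * (c * CB * ((\<rho> + \<rho>') * (D * ?w)))"
      using lin CB \<rho> \<rho>' D w by (intro mult_nonneg_nonneg) auto
    then show ?thesis unfolding A by (simp add: algebra_simps)
  qed
  finally show ?thesis .
qed

end

text \<open>Serves as the second solution in \<open>step_bound\<close>, which turns a bound on
  differences into a bound on size.\<close>

lemma zero_solves: "solves_bvp L B T (\<lambda>t. - N ((\<lambda>_. 0) t, (\<lambda>_. 0) (Suc t))) (0 + Q ((\<lambda>_. 0) T)) (\<lambda>_. 0)"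
  using lin linear_0[of L] linear_0[of B] by (simp add: solves_bvp_def N0 Q0 zero_prod_def)

lemma zero_in_ball: "in_ball T (\<lambda>_. 0)"
  unfolding in_ball_def using R weight_pos[of \<alpha> T] by (simp add: less_imp_le)

lemma step_self_bound:
  assumes "T0 \<le> T" "in_ball T z" "\<forall>t\<le>T. norm (z t) \<le> \<rho> * weight \<alpha> T t" "0 \<le> \<rho>"
    and "solves_bvp L B T (\<lambda>t. - N (z t, z (Suc t))) (\<Delta> + Q (z T)) h" "t \<le> T"
  shows "norm (h t) \<le> (c * norm \<Delta> + A * \<rho>\<^sup>2) * weight \<alpha> T t"
  using step_bound[OF assms(1,2) zero_in_ball assms(3,4) _ _ _ _ assms(5) zero_solves assms(6), of 0 \<rho>]
    assms by (simp add: power2_eq_square mult.assoc)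

theorem existence:
  assumes T: "T0 \<le> T" and \<Delta>: "c * norm \<Delta> + A * R\<^sup>2 \<le> R"
  shows "\<exists>z. nl_sol T \<Delta> z \<and> in_ball T z"
proof -
  \<comment> \<open>The chosen solution is arbitrary beyond T. Its fixed point is one only up to T,
    which is all that \<open>solves_bvp\<close> reads.\<close>
  define \<Phi> where "\<Phi> = (\<lambda>z. SOME h. solves_bvp L B T (\<lambda>t. - N (z t, z (Suc t))) (\<Delta> + Q (z T)) h)"
  have \<Phi>: "solves_bvp L B T (\<lambda>t. - N (z t, z (Suc t))) (\<Delta> + Q (z T)) (\<Phi> z)" for z
    unfolding \<Phi>_def by (rule someI_ex[OF uniform_green_ex[OF green T]])
  obtain z where z: "\<forall>t\<le>T. norm (z t) \<le> R * weight \<alpha> T t" and fp: "\<forall>t\<le>T. \<Phi> z t = z t"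
  proof (rule weighted_contraction_fixpoint[of "weight \<alpha> T" "2 * A * R" R T \<Phi>])
    show "\<forall>t\<le>T. norm (\<Phi> z t) \<le> R * weight \<alpha> T t"
      if "\<forall>t\<le>T. norm (z t) \<le> R * weight \<alpha> T t" for z
    proof (intro allI impI)
      fix t assume t: "t \<le> T"
      have "norm (\<Phi> z t) \<le> (c * norm \<Delta> + A * R\<^sup>2) * weight \<alpha> T t"
        by (rule step_self_bound[OF T _ that _ \<Phi> t]) (use that R in \<open>auto simp: in_ball_def\<close>)
      also have "\<dots> \<le> R * weight \<alpha> T t"
        using \<Delta> weight_pos[of \<alpha> T t] by (intro mult_right_mono) auto
      finally show "norm (\<Phi> z t) \<le> R * weight \<alpha> T t" .
    qed
    show "norm (\<Phi> z t - \<Phi> z' t) \<le> 2 * A * R * D * weight \<alpha> T t"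
      if "\<forall>t\<le>T. norm (z t) \<le> R * weight \<alpha> T t" "\<forall>t\<le>T. norm (z' t) \<le> R * weight \<alpha> T t"
        "\<forall>t\<le>T. norm (z t - z' t) \<le> D * weight \<alpha> T t" "t \<le> T" for z z' D t
    proof -
      \<comment> \<open>D comes without a sign; being an upper bound for a norm at one time forces
        it to be nonnegative.\<close>
      have "0 \<le> D * weight \<alpha> T t" using that(3,4) norm_ge_zero order_trans by blast
      then have "0 \<le> D" using weight_pos[of \<alpha> T t] by (simp add: zero_le_mult_iff)
      then show ?thesis
        using step_bound[OF T _ _ that(1) _ that(2) _ that(3) _ \<Phi> \<Phi> that(4)] that R
        by (simp add: in_ball_def algebra_simps)
    qed
  qed (use weight_pos A_nonneg R in auto)
  have "solves_bvp L B T (\<lambda>t. - N (z t, z (Suc t))) (\<Delta> + Q (z T)) z"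
    using \<Phi>[of z] fp by (simp add: solves_bvp_def)
  then show ?thesis using z by (auto simp: nl_sol_def in_ball_def)
qed

text \<open>The weighted distance D satisfies D \<le> c |\<Delta> - \<Delta>'| + 2 A R D, and the
  last term is absorbed because 2 A R < 1. The data may be of any size, as long as both sequences
  lie in the ball. Equal data give uniqueness.\<close>

theorem lipschitz:
  assumes T: "T0 \<le> T" and z: "nl_sol T \<Delta> z" "in_ball T z" and z': "nl_sol T \<Delta>' z'" "in_ball T z'"
    and t: "t \<le> T"
  shows "norm (z t - z' t) \<le> c / (1 - 2 * A * R) * norm (\<Delta> - \<Delta>') * weight \<alpha> T t"
proof -
  define D where "D = wnorm \<alpha> T (\<lambda>t. z t - z' t)"
  have D: "\<forall>t\<le>T. norm (z t - z' t) \<le> D * weight \<alpha> T t"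
    unfolding D_def by (intro allI impI norm_le_wnorm[of _ T "\<lambda>t. z t - z' t"])
  have D0: "0 \<le> D" unfolding D_def by (rule wnorm_nonneg)
  have "norm (z t - z' t) \<le> (c * norm (\<Delta> - \<Delta>') + A * (R + R) * D) * weight \<alpha> T t" if "t \<le> T" for t
    by (rule step_bound[OF T z(2) z'(2) _ _ _ _ D D0
          z(1)[unfolded nl_sol_def] z'(1)[unfolded nl_sol_def] that])
      (use z(2) z'(2) R in \<open>auto simp: in_ball_def\<close>)
  then have "wnorm \<alpha> T (\<lambda>t. z t - z' t) \<le> c * norm (\<Delta> - \<Delta>') + A * (R + R) * D"
    unfolding wnorm_le_iff by blast
  then have "D \<le> c * norm (\<Delta> - \<Delta>') + A * (R + R) * D"
    unfolding D_def[symmetric] .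
  then have "(1 - 2 * A * R) * D \<le> c * norm (\<Delta> - \<Delta>')" by (simp add: algebra_simps)
  then have "D \<le> c / (1 - 2 * A * R) * norm (\<Delta> - \<Delta>')"
    using R by (simp add: le_divide_eq mult.commute)
  then have "D * weight \<alpha> T t \<le> c / (1 - 2 * A * R) * norm (\<Delta> - \<Delta>') * weight \<alpha> T t"
    using weight_pos[of \<alpha> T t] by (intro mult_right_mono) auto
  then show ?thesis using D t by force
qed

lemma wnorm_step:
  assumes T: "T0 \<le> T" and z: "nl_sol T \<Delta> z" "in_ball T z"
  shows "wnorm \<alpha> T z \<le> c * norm \<Delta> + A * (wnorm \<alpha> T z)\<^sup>2"
proof -
  have "norm (z t) \<le> (c * norm \<Delta> + A * (wnorm \<alpha> T z)\<^sup>2) * weight \<alpha> T t" if "t \<le> T" for t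
    by (rule step_self_bound[OF T z(2) _ wnorm_nonneg z(1)[unfolded nl_sol_def] that])
      (intro allI impI norm_le_wnorm)
  then show ?thesis unfolding wnorm_le_iff by blast
qed

theorem size_bound:
  assumes T: "T0 \<le> T" and z: "nl_sol T \<Delta> z" "in_ball T z"
  shows "wnorm \<alpha> T z \<le> (if A = 0 then c * norm \<Delta>
    else (1 - sqrt (1 - 4 * A * c * norm \<Delta>)) / (2 * A))"
proof -
  have "wnorm \<alpha> T z \<le> R" using z(2) by (simp add: wnorm_le_iff in_ball_def)
  from smaller_root_bound[OF A_nonneg R(2) this wnorm_step[OF assms]] show ?thesis
    by (simp only: mult.assoc)
qed

text \<open>A linear bound that is easier to use than the root: A R < 1/2 lets the quadratic term be
  absorbed into half of the left-hand side.\<close>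

lemma wnorm_le_datum:
  assumes T: "T0 \<le> T" and z: "nl_sol T \<Delta> z" "in_ball T z"
  shows "wnorm \<alpha> T z \<le> 2 * c * norm \<Delta>"
proof -
  let ?\<rho> = "wnorm \<alpha> T z"
  have "?\<rho> \<le> R" using z by (simp add: wnorm_le_iff in_ball_def)
  then have "A * ?\<rho> * ?\<rho> \<le> A * R * ?\<rho>"
    using A_nonneg wnorm_nonneg by (intro mult_right_mono mult_left_mono) auto
  also have "\<dots> \<le> 1 / 2 * ?\<rho>"
    using R wnorm_nonneg by (intro mult_right_mono) auto
  finally show ?thesis using wnorm_step[OF assms] by (simp add: power2_eq_square)
qed

text \<open>The difference z - h solves the linear problem with forcing -N and datum Q (z T), both
  quadratic in \<rho> = 2 c |\<Delta>|; this square gives the factor 4 c^2.\<close>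

theorem expansion:
  assumes T: "T0 \<le> T" and z: "nl_sol T \<Delta> z" "in_ball T z"
    and h: "solves_bvp L B T (\<lambda>t. 0) \<Delta> h" and t: "t \<le> T"
  shows "norm (z t - h t) \<le> 4 * c\<^sup>2 * c * Cconv * (4 * CB + CN * (1 + exp \<alpha>)\<^sup>2)
     * (weight \<alpha> T t)\<^sup>2 * (norm \<Delta>)\<^sup>2"
proof -
  define \<rho> where "\<rho> = 2 * c * norm \<Delta>"
  have \<rho>0: "0 \<le> \<rho>" using lin by (simp add: \<rho>_def)
  have \<rho>: "\<forall>t\<le>T. norm (z t) \<le> \<rho> * weight \<alpha> T t"
    using wnorm_le_datum[OF T z] by (simp add: wnorm_le_iff \<rho>_def)
  then have \<rho>d: "\<forall>t\<le>T. norm (z t - (\<lambda>_. 0) t) \<le> \<rho> * weight \<alpha> T t" by simp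
  have z0: "\<forall>t\<le>T. norm ((\<lambda>_. 0 :: 'a) t) \<le> 0 * weight \<alpha> T t" by simp
  note step = T z(2) zero_in_ball \<rho> \<rho>0 z0 order_refl \<rho>d \<rho>0
  have "norm (z t - h t) \<le> c * (weight \<gamma> T t * (4 * CB * \<rho>\<^sup>2)
      + (CN * (1 + exp \<alpha>)\<^sup>2 * \<rho>\<^sup>2) * Cconv * (weight \<alpha> T t)\<^sup>2)"
  proof (rule linear_bound[OF T solves_bvp_diff[OF lin(1,2) z(1)[unfolded nl_sol_def] h] t])
    show "norm (\<Delta> + Q (z T) - \<Delta>) \<le> 4 * CB * \<rho>\<^sup>2"
      using step_Q[OF step] by (simp add: Q0 power2_eq_square mult.assoc)
    show "norm (- N (z s, z (Suc s)) - 0) \<le> CN * (1 + exp \<alpha>)\<^sup>2 * \<rho>\<^sup>2 * (weight \<alpha> T s)\<^sup>2" if "s < T" for s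
      using step_N[OF step that] by (simp add: N0 power2_eq_square mult.assoc)
    show "0 \<le> CN * (1 + exp \<alpha>)\<^sup>2 * \<rho>\<^sup>2" using CN by simp
  qed
  \<comment> \<open>The second convolution inequality,
    \<open>weight \<gamma> \<le> Cconv * w\<^sup>2\<close>, is what lets the terminal remainder
    decay like w^2 too.\<close>
  also have "\<dots> \<le> c * ((Cconv * (weight \<alpha> T t)\<^sup>2) * (4 * CB * \<rho>\<^sup>2)
      + (CN * (1 + exp \<alpha>)\<^sup>2 * \<rho>\<^sup>2) * Cconv * (weight \<alpha> T t)\<^sup>2)"
    using conv(2)[OF T t] lin CB by (intro mult_left_mono add_right_mono mult_right_mono) auto
  also have "\<dots> = 4 * c\<^sup>2 * c * Cconv * (4 * CB + CN * (1 + exp \<alpha>)\<^sup>2)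
     * (weight \<alpha> T t)\<^sup>2 * (norm \<Delta>)\<^sup>2"
    unfolding \<rho>_def power_mult_distrib by algebra
  finally show ?thesis .
qed

end

section \<open>Exponential dichotomies\<close>

text \<open>Without forcing a solution is the M-orbit of its initial value, so the boundary datum is
  a linear function of that value. Solvability for all data makes this endomorphism of a
  finite-dimensional space surjective, hence injective.\<close>

lemma homogeneous_solution_zero:
  fixes L B :: "'a::euclidean_space \<times> 'a \<Rightarrow> 'a"
  assumes "linear B" "linear M"
    and step: "\<And>a b. L (a, b) = 0 \<longleftrightarrow> b = M a"
    and ex: "\<And>b. \<exists>h. solves_bvp L B T (\<lambda>t. 0) b h"
    and h: "solves_bvp L B T (\<lambda>t. 0) 0 h" and "t \<le> T"
  shows "h t = 0"
proof -
  have pow: "linear (M ^^ n)" for n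
  proof (induction n)
    case 0 show ?case by (simp add: linear_id[unfolded id_def] id_def)
  next
    case (Suc n)
    then have "linear (M \<circ> (M ^^ n))" using \<open>linear M\<close> by (rule linear_compose)
    then show ?case by (simp only: funpow.simps)
  qed
  have orbit: "k t = (M ^^ t) (k 0)" if "solves_bvp L B T (\<lambda>t. 0) b k" "t \<le> T" for k b t
    using that(2)
  proof (induction t)
    case (Suc t)
    then have "k (Suc t) = M (k t)" using that(1) step by (auto simp: solves_bvp_def)
    then show ?case using Suc by simp
  qed simp
  define \<phi> where "\<phi> = (\<lambda>x. B (x, (M ^^ T) x))"
  have lin: "linear \<phi>"
    unfolding \<phi>_def
  proof (rule linearI)
    show "B (x + y, (M ^^ T) (x + y)) = B (x, (M ^^ T) x) + B (y, (M ^^ T) y)" for x y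
      using linear_add[OF \<open>linear B\<close>, of "(x, (M ^^ T) x)" "(y, (M ^^ T) y)"]
      by (simp add: linear_add[OF pow])
    show "B (c *\<^sub>R x, (M ^^ T) (c *\<^sub>R x)) = c *\<^sub>R B (x, (M ^^ T) x)" for c x
      using linear_scale[OF \<open>linear B\<close>, of c "(x, (M ^^ T) x)"]
      by (simp add: linear_scale[OF pow])
  qed
  have \<phi>: "\<phi> (k 0) = b" if "solves_bvp L B T (\<lambda>t. 0) b k" for k b
    using orbit[OF that, of T] that by (simp add: \<phi>_def solves_bvp_def)
  have "\<exists>x. b = \<phi> x" for b using ex[of b] \<phi> by blast
  then have "surj \<phi>" by (auto simp: surj_def)
  then have "inj \<phi>" using lin linear_surjective_imp_injective by blast
  moreover have "\<phi> (h 0) = \<phi> 0" using \<phi>[OF h] lin linear_0 by metis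
  ultimately have "h 0 = 0" by (rule injD)
  then show ?thesis using orbit[OF h \<open>t \<le> T\<close>] linear_0[OF pow] by simp
qed

lemma norm_linear_prod_le:
  fixes B :: "'a::euclidean_space \<times> 'a \<Rightarrow> 'a"
  assumes "linear B"
  obtains C where "0 \<le> C" "\<And>x y. norm (B (x, y)) \<le> C * (norm x + norm y)"
proof -
  obtain C where C: "0 < C" "\<And>z. norm (B z) \<le> C * norm z"
    using linear_bounded_pos[OF assms] by blast
  have "norm (B (x, y)) \<le> C * (norm x + norm y)" for x y
    using C(2)[of "(x, y)"] mult_left_mono[OF norm_Pair_le[of x y], of C] C(1) by linarith
  then show ?thesis using that[of C] C by auto
qed

text \<open>The two families carry the stable solutions forwards from \<open>0\<close> and the unstable ones backwards
  from \<open>T\<close>.\<close>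

lemma uniform_green_of_dichotomy:
  fixes L B :: "'a::euclidean_space \<times> 'a \<Rightarrow> 'a"
    and s :: "nat \<Rightarrow> 'p::real_normed_vector \<Rightarrow> 'a" and u :: "nat \<Rightarrow> 'q::real_normed_vector \<Rightarrow> 'a"
  assumes "linear L" "linear B" "linear M" "linear J"
    and step: "\<And>a b f. L (a, b) = f \<longleftrightarrow> b = M a + J f"
    and s_step: "\<And>k a. M (s k a) = s (Suc k) a"
    and u_step: "\<And>k b. M (u (Suc k) b) = u k b"
    and s_bound: "\<And>k a. norm (s k a) \<le> K * exp (- \<gamma> * real k) * norm a"
    and u_bound: "\<And>k b. norm (u k b) \<le> K * exp (- \<gamma> * real k) * norm b"
    and split: "\<And>v. \<exists>a b. v = s 0 a + u 0 b \<and> norm a \<le> Cs * norm v \<and> norm b \<le> Cs * norm v"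
    and Gam: "\<And>T v. T0 \<le> T \<Longrightarrow> \<exists>a b. B (s 0 a + u T b, s T a + u 0 b) = v \<and>
        norm a \<le> G * norm v \<and> norm b \<le> G * norm v"
    and nonneg: "0 \<le> K" "0 \<le> Cs" "0 \<le> G" and "0 < \<gamma>" "1 \<le> T0"
  shows "\<exists>C. uniform_green L B C \<gamma> T0"
proof -
  obtain CJ where CJ: "0 < CJ" "\<And>f. norm (J f) \<le> CJ * norm f"
    using linear_bounded_pos[OF \<open>linear J\<close>] by blast
  obtain CB where CB: "0 \<le> CB" "\<And>x y. norm (B (x, y)) \<le> CB * (norm x + norm y)"
    using norm_linear_prod_le[OF \<open>linear B\<close>] by blast
  \<comment> \<open>P bounds one summand of the particular solution; its \<open>exp \<gamma>\<close>
    compensates the delay t - 1 - i below. C collects the endpoint correction, the particular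
    solution and the effect of the forcing through the endpoint rows.\<close>
  define P where "P = K * (Cs * CJ) * exp \<gamma>"
  define C where "C = 1 + K * G + P + 2 * (K * G * CB * P)"
  have P0: "0 \<le> P" and C1: "1 \<le> C" using nonneg CJ CB by (auto simp: C_def P_def)
  have M0: "M 0 = 0" and J0: "J 0 = 0"
    using \<open>linear M\<close> \<open>linear J\<close> linear_0 by auto
  have main: "\<exists>h. solves_bvp L B T f b h \<and> (\<forall>t\<le>T. norm (h t) \<le>
      C * (weight \<gamma> T t * norm b + (\<Sum>i<T. kappa \<gamma> T t i * norm (f i))))"
    if T: "T0 \<le> T" for T f b
  proof -
    have "\<forall>i. \<exists>a b. J (f i) = s 0 a + u 0 b \<and> norm a \<le> Cs * norm (J (f i)) \<and> norm b \<le> Cs * norm (J (f i))"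
      using split by blast
    then obtain \<alpha> \<beta> where split_f: "\<And>i. J (f i) = s 0 (\<alpha> i) + u 0 (\<beta> i)"
      and le: "\<And>i. norm (\<alpha> i) \<le> Cs * norm (J (f i))" "\<And>i. norm (\<beta> i) \<le> Cs * norm (J (f i))"
      by metis
    have *: "Cs * norm (J (f i)) \<le> Cs * CJ * norm (f i)" for i
      using mult_left_mono[OF CJ(2)[of "f i"] nonneg(2)] by (simp add: mult.assoc)
    have coef: "norm (\<alpha> i) \<le> Cs * CJ * norm (f i)" "norm (\<beta> i) \<le> Cs * CJ * norm (f i)" for i
      using le[of i] *[of i] by linarith+
    \<comment> \<open>The Green kernel on the whole line. Forcing at time i enters at time i + 1:
      its stable part is then t - 1 - i steps old, while its unstable part is carried i + 1 - t
      steps backwards with a minus sign. Passing from t = i to t = i + 1 produces the jump s 0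
      (\<alpha> i) + u 0 (\<beta> i) = J (f i).\<close>
    define g where "g = (\<lambda>t i. if i < t then s (t - 1 - i) (\<alpha> i) else - u (i + 1 - t) (\<beta> i))"
    define p where "p = (\<lambda>t. \<Sum>i<T. g t i)"
    have g_step: "g (Suc t) i = M (g t i) + (if i = t then J (f t) else 0)" for t i
    proof -
      consider "i < t" | "i = t" | "t < i" by linarith
      then show ?thesis
      proof cases
        case 1
        then have "t - i = Suc (t - 1 - i)" by simp
        then show ?thesis using 1 s_step[of "t - 1 - i" "\<alpha> i"] by (simp add: g_def)
      next
        case 2
        then show ?thesis using u_step[of 0 "\<beta> i"]
          by (simp add: g_def linear_neg[OF \<open>linear M\<close>] split_f)
      next
        case 3
        then have "i + 1 - t = Suc (i - t)" "Suc i - Suc t = i - t" by simp_all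
        then show ?thesis using 3 u_step[of "i - t" "\<beta> i"]
          by (simp add: g_def linear_neg[OF \<open>linear M\<close>])
      qed
    qed
    have p_step: "p (Suc t) = M (p t) + J (f t)" if "t < T" for t
      using that by (simp add: p_def g_step sum.distrib linear_sum[OF \<open>linear M\<close>] sum.delta)
    have g_bound: "norm (g t i) \<le> P * exp (- \<gamma> * \<bar>real t - real i\<bar>) * norm (f i)" for t i
    proof (cases "i < t")
      case True
      have "norm (s (t - 1 - i) (\<alpha> i)) \<le> K * exp (- \<gamma> * real (t - 1 - i)) * norm (\<alpha> i)"
        by (rule s_bound)
      also have "\<dots> \<le> K * exp (- \<gamma> * real (t - 1 - i)) * (Cs * CJ * norm (f i))"
        using coef nonneg by (intro mult_left_mono) auto
      also have "exp (- \<gamma> * real (t - 1 - i)) = exp \<gamma> * exp (- \<gamma> * \<bar>real t - real i\<bar>)"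
        using True by (simp add: exp_add[symmetric] of_nat_diff algebra_simps)
      finally show ?thesis using True by (simp add: g_def P_def algebra_simps)
    next
      case False
      have "norm (u (i + 1 - t) (\<beta> i)) \<le> K * exp (- \<gamma> * real (i + 1 - t)) * norm (\<beta> i)"
        by (rule u_bound)
      also have "\<dots> \<le> K * exp (- \<gamma> * real (i + 1 - t)) * (Cs * CJ * norm (f i))"
        using coef nonneg by (intro mult_left_mono) auto
      also have "\<dots> \<le> K * (exp \<gamma> * exp (- \<gamma> * \<bar>real t - real i\<bar>)) * (Cs * CJ * norm (f i))"
      proof (intro mult_right_mono mult_left_mono)
        have "- \<gamma> * real (i + 1 - t) \<le> \<gamma> + - \<gamma> * \<bar>real t - real i\<bar>"
          using False \<open>0 < \<gamma>\<close> by (simp add: of_nat_diff algebra_simps)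
        then show "exp (- \<gamma> * real (i + 1 - t)) \<le> exp \<gamma> * exp (- \<gamma> * \<bar>real t - real i\<bar>)"
          by (simp only: exp_add[symmetric] exp_le_cancel_iff)
      qed (use nonneg CJ in auto)
      finally show ?thesis using False by (simp add: g_def P_def algebra_simps)
    qed
    have p_bound: "norm (p t) \<le> P * (\<Sum>i<T. exp (- \<gamma> * \<bar>real t - real i\<bar>) * norm (f i))" for t
      unfolding p_def sum_distrib_left mult.assoc[symmetric]
      by (rule sum_norm_le) (rule g_bound)
    \<comment> \<open>The endpoint rows see only the times 0 and T, where the two decay factors in i
      add up to the weight.\<close>
    have "norm (p 0) + norm (p T) \<le> P * (\<Sum>i<T. exp (- \<gamma> * \<bar>real 0 - real i\<bar>) * norm (f i))
        + P * (\<Sum>i<T. exp (- \<gamma> * \<bar>real T - real i\<bar>) * norm (f i))"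
      by (intro add_mono p_bound)
    also have "\<dots> = P * (\<Sum>i<T. weight \<gamma> T i * norm (f i))"
      unfolding distrib_left[symmetric] sum.distrib[symmetric]
      by (intro arg_cong[where f = "(*) P"] sum.cong) (auto simp: weight_def algebra_simps)
    finally have p_ends: "norm (p 0) + norm (p T) \<le> P * (\<Sum>i<T. weight \<gamma> T i * norm (f i))" .
    obtain a b' where ab: "B (s 0 a + u T b', s T a + u 0 b') = b - B (p 0, p T)"
      and ab_le: "norm a \<le> G * norm (b - B (p 0, p T))" "norm b' \<le> G * norm (b - B (p 0, p T))"
      using Gam[OF T, of "b - B (p 0, p T)"] by blast
    define h where "h = (\<lambda>t. p t + (s t a + u (T - t) b'))"
    have "h (Suc t) = M (h t) + J (f t)" if "t < T" for t
    proof -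
      have "T - t = Suc (T - Suc t)" using that by simp
      then have "M (u (T - t) b') = u (T - Suc t) b'" using u_step[of "T - Suc t" b'] by simp
      then show ?thesis
        by (simp add: h_def p_step[OF that] linear_add[OF \<open>linear M\<close>] s_step)
    qed
    moreover have "B (h 0, h T) = B (p 0, p T) + B (s 0 a + u T b', s T a + u 0 b')"
      using linear_add[OF \<open>linear B\<close>, of "(p 0, p T)" "(s 0 a + u T b', s T a + u 0 b')"]
      by (simp add: h_def)
    ultimately have "solves_bvp L B T f b h"
      using ab by (simp add: solves_bvp_def step)
    moreover have "norm (h t) \<le> C * (weight \<gamma> T t * norm b + (\<Sum>i<T. kappa \<gamma> T t i * norm (f i)))"
      if t: "t \<le> T" for t
    proof -
      define k where "k = (\<Sum>i<T. kappa \<gamma> T t i * norm (f i))"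
      have k0: "0 \<le> k" unfolding k_def by (intro sum_nonneg mult_nonneg_nonneg kappa_nonneg) auto
      have w0: "0 < weight \<gamma> T t" by (rule weight_pos)
      have 1: "norm (p t) \<le> P * k"
      proof -
        have "(\<Sum>i<T. exp (- \<gamma> * \<bar>real t - real i\<bar>) * norm (f i)) \<le> k"
          unfolding k_def kappa_def by (intro sum_mono mult_right_mono) auto
        then show ?thesis using p_bound[of t] mult_left_mono[OF _ P0] order_trans by blast
      qed
      have nb: "norm (b - B (p 0, p T)) \<le> norm b + CB * (P * (\<Sum>i<T. weight \<gamma> T i * norm (f i)))"
        using norm_triangle_ineq4[of b "B (p 0, p T)"] CB(2)[of "p 0" "p T"]
          mult_left_mono[OF p_ends CB(1)] by linarith
      \<comment> \<open>The endpoint correction contains the forcing with weight at i and is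
        transported with weight at t; the product of the weights falls under the kernel.\<close>
      have wk: "weight \<gamma> T t * (\<Sum>i<T. weight \<gamma> T i * norm (f i)) \<le> 2 * k"
        unfolding k_def sum_distrib_left mult.assoc[symmetric]
        using weight_mult_weight_le_kappa[of \<gamma> t T] t \<open>0 < \<gamma>\<close>
        by (intro sum_mono mult_right_mono) auto
      have "norm (s t a) \<le> K * exp (- \<gamma> * real t) * (G * norm (b - B (p 0, p T)))"
        by (rule order_trans[OF s_bound]) (intro mult_left_mono ab_le, use nonneg in auto)
      moreover have "norm (u (T - t) b') \<le> K * exp (- \<gamma> * (real T - real t)) * (G * norm (b - B (p 0, p T)))"
        unfolding of_nat_diff[OF t, symmetric]
        by (rule order_trans[OF u_bound]) (intro mult_left_mono ab_le, use nonneg in auto)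
      ultimately have "norm (s t a + u (T - t) b') \<le> K * G * (weight \<gamma> T t * norm (b - B (p 0, p T)))"
        using norm_triangle_ineq[of "s t a" "u (T - t) b'"] unfolding weight_def
        by (simp add: algebra_simps)
      also have "\<dots> \<le> K * G * (weight \<gamma> T t * (norm b + CB * (P * (\<Sum>i<T. weight \<gamma> T i * norm (f i)))))"
        by (intro mult_left_mono nb) (use w0 nonneg in auto)
      also have "\<dots> = K * G * (weight \<gamma> T t * norm b) + K * G * CB * P * (weight \<gamma> T t * (\<Sum>i<T. weight \<gamma> T i * norm (f i)))"
        by algebra
      also have "\<dots> \<le> K * G * (weight \<gamma> T t * norm b) + K * G * CB * P * (2 * k)"
        by (intro add_left_mono mult_left_mono wk) (use nonneg CB P0 in auto)
      finally have 2: "norm (s t a + u (T - t) b') \<le> K * G * (weight \<gamma> T t * norm b) + K * G * CB * P * (2 * k)" .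
      have nn: "0 \<le> weight \<gamma> T t * norm b" "0 \<le> P * (weight \<gamma> T t * norm b)"
          "0 \<le> K * G * CB * P * (weight \<gamma> T t * norm b)" "0 \<le> K * G * k"
        using w0 nonneg CB P0 k0 by auto
      have "norm (h t) \<le> P * k + (K * G * (weight \<gamma> T t * norm b) + K * G * CB * P * (2 * k))"
        unfolding h_def by (rule norm_triangle_le) (use 1 2 in simp)
      also have "\<dots> \<le> C * (weight \<gamma> T t * norm b + k)"
        using nn k0 unfolding C_def by (simp add: algebra_simps)
      finally show ?thesis unfolding k_def .
    qed
    ultimately show ?thesis by blast
  qed
  have "uniform_green L B C \<gamma> T0"
  proof (rule uniform_greenI)
    show "\<exists>h. solves_bvp L B T f b h" if "T0 \<le> T" for T f b
      using main[OF that, of f b] by blast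
    show "norm (h t) \<le> C * (weight \<gamma> T t * norm b + (\<Sum>i<T. kappa \<gamma> T t i * norm (f i)))"
      if T: "T0 \<le> T" and h: "solves_bvp L B T f b h" and t: "t \<le> T" for T f b h t
    proof -
      obtain h' where h': "solves_bvp L B T f b h'"
        and bd: "\<forall>t\<le>T. norm (h' t) \<le> C * (weight \<gamma> T t * norm b + (\<Sum>i<T. kappa \<gamma> T t i * norm (f i)))"
        using main[OF T, of f b] by blast
      \<comment> \<open>The bound is known for the constructed solution only; uniqueness transfers
        it to every other one.\<close>
      have "h t - h' t = 0"
      proof (rule homogeneous_solution_zero[OF \<open>linear B\<close> \<open>linear M\<close>, where L = L])
        show "L (a, b) = 0 \<longleftrightarrow> b = M a" for a b by (simp add: step J0)
        show "\<exists>h. solves_bvp L B T (\<lambda>t. 0) b h" for b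
          using main[OF T, of "\<lambda>t. 0" b] by (elim exE conjE) (rule exI)
        show "solves_bvp L B T (\<lambda>t. 0) 0 (\<lambda>t. h t - h' t)"
          using solves_bvp_diff[OF \<open>linear L\<close> \<open>linear B\<close> h h'] by simp
      qed fact
      then show ?thesis using bd t by simp
    qed
  qed fact+
  then show ?thesis by blast
qed

section \<open>Matrix powers, stacked coordinates and the endpoint matrix\<close>

lemma mat_pow_Suc: "mat_pow A (Suc k) = A ** mat_pow A k"
  by (simp add: mat_pow_def)

lemma mat_pow_0 [simp]: "mat_pow A 0 = mat 1"
  by (simp add: mat_pow_def)

lemma mat_pow_commute: "A ** mat_pow A k = mat_pow A k ** A"
proof (induction k)
  case (Suc k)
  have "A ** mat_pow A (Suc k) = A ** (mat_pow A k ** A)" using Suc by (simp add: mat_pow_Suc)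
  then show ?case by (simp add: mat_pow_Suc matrix_mul_assoc)
qed simp

lemma mat_pow_left_inverse:
  assumes "B ** A = mat 1"
  shows "mat_pow B k ** mat_pow A k = mat 1"
proof (induction k)
  case (Suc k)
  have "mat_pow B (Suc k) ** mat_pow A (Suc k) = mat_pow B k ** (B ** A) ** mat_pow A k"
    by (simp only: mat_pow_Suc mat_pow_commute[of B] matrix_mul_assoc)
  then show ?case using Suc assms by simp
qed simp

text \<open>The endpoint matrix has rows indexed by 'd + 'd and columns by 's + 'u, which are
  different types even when their sizes agree.\<close>

lemma matrix_inv_rectangular:
  assumes "invertible A"
  shows "A ** matrix_inv A = mat 1" "matrix_inv A ** A = mat 1"
  using someI_ex[OF assms[unfolded invertible_def]] unfolding matrix_inv_def by auto

lemma norm_mat_vec_le: "norm (A *v x) \<le> mat_norm A * norm x"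
  unfolding mat_norm_def by (rule onorm[OF matrix_vector_mul_bounded_linear])

lemma mat_norm_nonneg: "0 \<le> mat_norm A"
  unfolding mat_norm_def by (rule onorm_pos_le[OF matrix_vector_mul_bounded_linear])

lemma sum_UNIV_Plus:
  "(\<Sum>i\<in>(UNIV :: ('a::finite + 'b::finite) set). f i) = (\<Sum>i\<in>UNIV. f (Inl i)) + (\<Sum>i\<in>UNIV. f (Inr i))"
  by (simp add: UNIV_Plus_UNIV[symmetric] sum.Plus del: UNIV_Plus_UNIV)

lemma hcat_mult_vec:
  "hcat A B *v c = A *v (\<chi> i. c $ Inl i) + B *v (\<chi> i. c $ Inr i)"
  by (simp add: vec_eq_iff matrix_vector_mult_def hcat_def sum_UNIV_Plus)

lemma norm_vec_power2_Plus:
  fixes c :: "real^('a::finite + 'b::finite)"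
  shows "(norm c)\<^sup>2 = (norm (\<chi> i. c $ Inl i))\<^sup>2 + (norm (\<chi> i. c $ Inr i))\<^sup>2"
  by (simp add: norm_vec_def L2_set_def sum_nonneg sum_UNIV_Plus)

lemma norm_vec_part_le:
  fixes c :: "real^('a::finite + 'b::finite)"
  shows "norm (\<chi> i. c $ Inl i) \<le> norm c" "norm (\<chi> i. c $ Inr i) \<le> norm c"
  by (rule power2_le_imp_le; simp add: norm_vec_power2_Plus)+

lemma stack_unstack [simp]: "stack (unstack v) = v"
  by (simp add: stack_def unstack_def vec_eq_iff split: sum.split)

lemma unstack_stack [simp]: "unstack (stack z) = z"
  by (simp add: stack_def unstack_def vec_eq_iff prod_eq_iff)

lemma linear_stack: "linear stack"
  by (rule linearI) (auto simp: stack_def vec_eq_iff split: sum.split)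

lemma linear_unstack: "linear unstack"
  by (rule linearI) (auto simp: unstack_def vec_eq_iff prod_eq_iff)

lemma norm_stack [simp]: "norm (stack z) = norm z"
proof -
  have "(norm (stack z))\<^sup>2 = (norm z)\<^sup>2"
    unfolding norm_vec_power2_Plus by (cases z) (simp add: stack_def norm_Pair sum_nonneg vec_lambda_eta)
  then show ?thesis by (simp add: power2_eq_iff_nonneg)
qed

lemma norm_unstack [simp]: "norm (unstack v) = norm v"
  using norm_stack[of "unstack v"] by simp

lemma block_matrix_mult_stack: "linear A \<Longrightarrow> block_matrix A *v stack z = stack (A z)"
  unfolding block_matrix_def
  using fun_cong[OF matrix_vector_mul(2)[of "stack \<circ> A \<circ> unstack"], of "stack z"]
  by (simp add: linear_compose linear_stack linear_unstack)

lemma linear_Pair_left: "linear L \<Longrightarrow> linear (\<lambda>h. L (h, 0))"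
  and linear_Pair_right: "linear L \<Longrightarrow> linear (\<lambda>h. L (0, h))"
proof -
  have "linear (\<lambda>h :: 'a. (h, 0 :: 'b))" "linear (\<lambda>h :: 'b. (0 :: 'a, h))"
    by (auto intro: linearI)
  from this[THEN linear_compose] show "linear L \<Longrightarrow> linear (\<lambda>h. L (h, 0))"
    "linear L \<Longrightarrow> linear (\<lambda>h. L (0, h))"
    by (auto simp: o_def)
qed

text \<open>Independence is a statement about the set of columns. Since the columns are pairwise
  distinct, the coefficients x $ j can be read as a function on that set.\<close>

lemma columns_basis_of_inj:
  fixes V :: "real^'k^'n"
  assumes "columns_basis_of V S" "V *v x = 0"
  shows "x = 0"
proof -
  have inj: "inj (\<lambda>j. column j V)" and ind: "independent (columns V)"
    using assms unfolding columns_basis_of_def by auto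
  have cols: "columns V = range (\<lambda>j. column j V)" by (auto simp: columns_def)
  define c where "c = (\<lambda>v. x $ the_inv (\<lambda>j. column j V) v)"
  have "(\<Sum>v\<in>columns V. c v *\<^sub>R v) = (\<Sum>j\<in>UNIV. x $ j *\<^sub>R column j V)"
    unfolding cols by (subst sum.reindex[OF inj]) (simp add: c_def the_inv_f_f[OF inj])
  also have "\<dots> = 0" using assms(2) by (simp add: matrix_mult_sum scalar_mult_eq_scaleR)
  finally have sum0: "(\<Sum>v\<in>columns V. c v *\<^sub>R v) = 0" .
  have "finite (columns V)" by (simp add: cols)
  then have "c (column j V) = 0" for j
    using independentD[OF ind _ order_refl sum0] cols by blast
  then show ?thesis by (simp add: c_def the_inv_f_f[OF inj] vec_eq_iff)
qed

text \<open>Decay forces the stable and unstable spaces to meet only in \<open>0\<close>, and invertibility of one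
  endpoint matrix forces their dimensions to add up; hence they span without any appeal to the
  spectral decomposition.\<close>

lemma hcat_inj_of_decay:
  fixes Vs :: "real^'s^'n" and Vu :: "real^'u^'n"
  assumes MVs: "M ** Vs = Vs ** Ds" and MVu: "M ** Vu = Vu ** Du" and Du: "invertible Du"
    and injs: "\<And>x. Vs *v x = 0 \<Longrightarrow> x = 0" and inju: "\<And>x. Vu *v x = 0 \<Longrightarrow> x = 0"
    and s_bound: "\<And>k. mat_norm (Vs ** mat_pow Ds k) \<le> K * exp (- \<gamma> * real k)"
    and u_bound: "\<And>k. mat_norm (Vu ** mat_pow (matrix_inv Du) k) \<le> K * exp (- \<gamma> * real k)"
    and "0 < \<gamma>" "1 \<le> K" and eq: "Vs *v a + Vu *v b = 0"
  shows "a = 0" "b = 0"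
proof -
  have "inj ((*v) Vu)" using inju by (simp add: linear_injective_0)
  then obtain C where C: "0 < C" "\<And>x. norm x \<le> C * norm (Vu *v x)"
    using linear_inj_bounded_below_pos[of "(*v) Vu"]
    by (metis matrix_vector_mul_linear mult.commute pos_le_divide_eq divide_inverse inverse_eq_divide
        pos_divide_le_eq zero_less_divide_1_iff)
  have pow_s: "mat_pow M k ** Vs = Vs ** mat_pow Ds k" for k
  proof (induction k)
    case (Suc k)
    have "mat_pow M (Suc k) ** Vs = M ** (mat_pow M k ** Vs)"
      by (simp add: mat_pow_Suc matrix_mul_assoc)
    also have "\<dots> = M ** Vs ** mat_pow Ds k" by (simp add: Suc matrix_mul_assoc)
    finally show ?case by (simp add: MVs mat_pow_Suc matrix_mul_assoc)
  qed simp
  have pow_u: "mat_pow M k ** Vu = Vu ** mat_pow Du k" for k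
  proof (induction k)
    case (Suc k)
    have "mat_pow M (Suc k) ** Vu = M ** (mat_pow M k ** Vu)"
      by (simp add: mat_pow_Suc matrix_mul_assoc)
    also have "\<dots> = M ** Vu ** mat_pow Du k" by (simp add: Suc matrix_mul_assoc)
    finally show ?case by (simp add: MVu mat_pow_Suc matrix_mul_assoc)
  qed simp
  have inv: "matrix_inv Du ** Du = mat 1" using Du by (rule matrix_inv_rectangular)
  have K: "0 \<le> K * exp (- \<gamma> * real k)" for k using \<open>1 \<le> K\<close> by simp
  \<comment> \<open>The vector Vu b is reached from Vu Du^k b by k backward steps, which contract.
    Moving forward instead, M^k (Vu b) = - M^k (Vs a) decays, so Du^k b is small as well. Both
    effects give \<open>exp (- 2 * \<gamma> * k)\<close>; one factor is enough for the
    limit.\<close>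
  have "norm (Vu *v b) \<le> K * K * C * norm a * exp (- \<gamma>) ^ k" for k
  proof -
    let ?y = "mat_pow Du k *v b" and ?e = "exp (- \<gamma> * real k)"
    have "Vu *v b = (Vu ** mat_pow (matrix_inv Du) k) *v ?y"
      by (simp add: matrix_vector_mul_assoc matrix_mul_assoc[symmetric] mat_pow_left_inverse[OF inv])
    then have vb: "norm (Vu *v b) \<le> K * ?e * norm ?y"
      using order_trans[OF norm_mat_vec_le mult_right_mono[OF u_bound]] by simp
    have "Vu *v ?y = - (Vs ** mat_pow Ds k *v a)"
    proof -
      have "Vu *v ?y = mat_pow M k *v (Vu *v b)"
        by (simp add: matrix_vector_mul_assoc pow_u)
      moreover have "Vu *v b = - (Vs *v a)" using eq by (simp add: eq_neg_iff_add_eq_0 add.commute)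
      ultimately show ?thesis
        by (simp add: matrix_vector_mul_assoc pow_s linear_neg[OF matrix_vector_mul_linear])
    qed
    then have "norm ?y \<le> C * norm (Vs ** mat_pow Ds k *v a)"
      using C(2)[of ?y] by simp
    also have "\<dots> \<le> C * (K * ?e * norm a)"
      using C by (intro mult_left_mono order_trans[OF norm_mat_vec_le mult_right_mono[OF s_bound]]) auto
    finally have "norm (Vu *v b) \<le> K * ?e * (C * (K * ?e * norm a))"
      by (rule order_trans[OF vb mult_left_mono[OF _ K]])
    also have "\<dots> = K * K * C * norm a * ?e * ?e" by simp
    also have "\<dots> \<le> K * K * C * norm a * ?e * 1"
      using C \<open>0 < \<gamma>\<close> \<open>1 \<le> K\<close> by (intro mult_left_mono) auto
    also have "?e = exp (- \<gamma>) ^ k" by (simp add: exp_of_nat_mult[symmetric] mult.commute)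
    finally show ?thesis by simp
  qed
  note decay = this
  have "(\<lambda>k. K * K * C * norm a * exp (- \<gamma>) ^ k) \<longlonglongrightarrow> K * K * C * norm a * 0"
    using \<open>0 < \<gamma>\<close> by (intro tendsto_mult_left LIMSEQ_power_zero) simp
  from LIMSEQ_le_const[OF this, of "norm (Vu *v b)"] decay have "norm (Vu *v b) \<le> 0"
    by simp
  then have "Vu *v b = 0" by simp
  then show "b = 0" "a = 0" using inju injs eq by auto
qed

text \<open>Invertibility of L1 turns the equation into the recursion b = M a + J f, and the columns
  of Vs and Vu generate the two families of the dichotomy. The bounded inverses of \<Gamma> T serve
  as the solution operator for the endpoint equation; the one at T0 also provides the splitting of
  the space.\<close>

lemma spectral_green:
  fixes L B :: "((real^'d) \<times> (real^'d)) \<times> ((real^'d) \<times> (real^'d)) \<Rightarrow> (real^'d) \<times> (real^'d)"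
    and Vs :: "real^'s^('d + 'd)" and Vu :: "real^'u^('d + 'd)"
    and Ds :: "real^'s^'s" and Du :: "real^'u^'u"
  defines "L0 \<equiv> block_matrix (\<lambda>h. L (h, 0))" and "L1 \<equiv> block_matrix (\<lambda>h. L (0, h))"
    and "B0 \<equiv> block_matrix (\<lambda>h. B (h, 0))" and "BT \<equiv> block_matrix (\<lambda>h. B (0, h))"
  defines "M \<equiv> - (matrix_inv L1 ** L0)" and "\<Gamma> \<equiv> gamma_hat B0 BT Vs Ds Vu Du"
  assumes "linear L" "linear B" "0 < \<gamma>" "1 \<le> T0" "1 \<le> K" and L1: "det L1 \<noteq> 0"
    and cols: "columns_basis_of Vs Ss" "columns_basis_of Vu Su"
    and MVs: "M ** Vs = Vs ** Ds" and MVu: "M ** Vu = Vu ** Du" and Du: "invertible Du"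
    and s_bound: "\<And>k. mat_norm (Vs ** mat_pow Ds k) \<le> K * exp (- \<gamma> * real k)"
    and u_bound: "\<And>k. mat_norm (Vu ** mat_pow (matrix_inv Du) k) \<le> K * exp (- \<gamma> * real k)"
    and \<Gamma>: "\<And>T. T0 \<le> T \<Longrightarrow> invertible (\<Gamma> T)"
    and bdd: "bdd_above ((\<lambda>T. mat_norm (matrix_inv (\<Gamma> T))) ` {T0..})"
  shows "\<exists>C. uniform_green L B C \<gamma> T0"
proof -
  let ?Du' = "matrix_inv Du"
  have stack_pair: "stack (A (x, y)) = block_matrix (\<lambda>h. A (h, 0)) *v stack x + block_matrix (\<lambda>h. A (0, h)) *v stack y"
    if "linear A" for A :: "((real^'d) \<times> (real^'d)) \<times> ((real^'d) \<times> (real^'d)) \<Rightarrow> (real^'d) \<times> (real^'d)" and x y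
  proof -
    have "A (x, y) = A (x, 0) + A (0, y)" using linear_add[OF that, of "(x, 0)" "(0, y)"] by simp
    then show ?thesis
      by (simp add: block_matrix_mult_stack linear_Pair_left linear_Pair_right that linear_add[OF linear_stack])
  qed
  define s where "s = (\<lambda>k a. unstack ((Vs ** mat_pow Ds k) *v a))"
  define u where "u = (\<lambda>k b. unstack ((Vu ** mat_pow ?Du' k) *v b))"
  define M' where "M' = (\<lambda>z. unstack (M *v stack z))"
  define J where "J = (\<lambda>f. unstack (matrix_inv L1 *v stack f))"
  have lin: "linear (\<lambda>z. unstack (A *v stack z))" for A :: "real^('d + 'd)^('d + 'd)"
    using linear_compose[OF linear_compose[OF linear_stack matrix_vector_mul_linear[of A]] linear_unstack]
    by (simp add: o_def)
  have inv: "L1 ** matrix_inv L1 = mat 1" "matrix_inv L1 ** L1 = mat 1"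
    using matrix_inv_rectangular[of L1] L1 by (auto simp: invertible_det_nz)
  have M_mult: "M *v x = - (matrix_inv L1 *v (L0 *v x))" for x
    unfolding M_def matrix_vector_mul_assoc by (simp add: matrix_vector_mult_def vec_eq_iff sum_negf)
  have step: "L (a, b) = f \<longleftrightarrow> b = M' a + J f" for a b f
  proof
    assume "L (a, b) = f"
    then have "stack f = L0 *v stack a + L1 *v stack b"
      unfolding L0_def L1_def using stack_pair[OF \<open>linear L\<close>, of a b] by simp
    then have "stack b = M *v stack a + matrix_inv L1 *v stack f"
      by (simp add: M_mult matrix_vector_right_distrib matrix_vector_mul_assoc inv)
    then have "unstack (stack b) = M' a + J f"
      unfolding M'_def J_def by (simp only: linear_add[OF linear_unstack])
    then show "b = M' a + J f" by simp
  next
    assume b: "b = M' a + J f"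
    have "stack b = M *v stack a + matrix_inv L1 *v stack f"
      unfolding b M'_def J_def by (simp add: linear_add[OF linear_stack])
    then have "L0 *v stack a + L1 *v stack b = stack f"
      by (simp add: M_mult matrix_vector_right_distrib matrix_vector_mult_diff_distrib
          matrix_vector_mul_assoc matrix_mul_assoc inv)
    then have "stack (L (a, b)) = stack f"
      unfolding L0_def L1_def using stack_pair[OF \<open>linear L\<close>, of a b] by simp
    from arg_cong[OF this, of unstack] show "L (a, b) = f" by simp
  qed
  have injs: "Vs *v x = 0 \<Longrightarrow> x = 0" and inju: "Vu *v y = 0 \<Longrightarrow> y = 0" for x y
    using columns_basis_of_inj cols by blast+
  \<comment> \<open>Composing with this inverse makes \<open>X\<close> an endomorphism of real^('d +
    'd). It is injective because stable and unstable solutions meet only in 0, hence surjective; so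
    the sizes of 's and 'u never have to be compared with 2 d.\<close>
  define A' where "A' = matrix_inv (\<Gamma> T0)"
  define X where "X = hcat Vs Vu ** A'"
  have "x = 0" if "X *v x = 0" for x
  proof -
    let ?c = "A' *v x"
    have "Vs *v (\<chi> i. ?c $ Inl i) + Vu *v (\<chi> i. ?c $ Inr i) = 0"
      using that by (simp add: X_def matrix_vector_mul_assoc[symmetric] hcat_mult_vec)
    note hcat_inj_of_decay[OF MVs MVu Du injs inju s_bound u_bound \<open>0 < \<gamma>\<close> \<open>1 \<le> K\<close> this]
    then have "?c = 0"
      by (simp add: vec_eq_iff split_sum_all)
    then have "\<Gamma> T0 *v ?c = 0" by simp
    then show ?thesis
      using matrix_inv_rectangular(1)[OF \<Gamma>[OF order_refl]] by (simp add: A'_def matrix_vector_mul_assoc)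
  qed
  then have "inj ((*v) X)" by (simp add: linear_injective_0)
  then obtain X' where X': "linear X'" "\<And>x. X *v (X' x) = x"
    using linear_injective_isomorphism[OF matrix_vector_mul_linear[of X]] by blast
  obtain CX where CX: "0 < CX" "\<And>x. norm (X' x) \<le> CX * norm x"
    using linear_bounded_pos[OF X'(1)] by blast
  obtain G where G: "\<And>T. T0 \<le> T \<Longrightarrow> mat_norm (matrix_inv (\<Gamma> T)) \<le> G"
    using bdd unfolding bdd_above_def by auto
  have G0: "0 \<le> G" using order_trans[OF mat_norm_nonneg G[OF order_refl]] .
  show ?thesis
  proof (rule uniform_green_of_dichotomy[where M = M' and J = J and s = s and u = u and K = K
        and Cs = "G * CX" and G = G])
    show "linear M'" "linear J" unfolding M'_def J_def by (rule lin)+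
    show "L (a, b) = f \<longleftrightarrow> b = M' a + J f" for a b f by (rule step)
    show "M' (s k a) = s (Suc k) a" for k a
      by (simp add: M'_def s_def matrix_vector_mul_assoc matrix_mul_assoc MVs mat_pow_Suc)
    show "M' (u (Suc k) b) = u k b" for k b
    proof -
      have "M ** (Vu ** mat_pow ?Du' (Suc k)) = Vu ** (Du ** ?Du') ** mat_pow ?Du' k"
        by (simp add: mat_pow_Suc matrix_mul_assoc MVu)
      then show ?thesis
        by (simp add: M'_def u_def matrix_vector_mul_assoc matrix_inv_rectangular[OF Du])
    qed
    show "norm (s k a) \<le> K * exp (- \<gamma> * real k) * norm a" for k a
      unfolding s_def norm_unstack by (rule order_trans[OF norm_mat_vec_le mult_right_mono[OF s_bound]]) simp
    show "norm (u k b) \<le> K * exp (- \<gamma> * real k) * norm b" for k b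
      unfolding u_def norm_unstack by (rule order_trans[OF norm_mat_vec_le mult_right_mono[OF u_bound]]) simp
    show "\<exists>a b. v = s 0 a + u 0 b \<and> norm a \<le> G * CX * norm v \<and> norm b \<le> G * CX * norm v" for v
    proof (intro exI conjI)
      let ?c = "A' *v X' (stack v)"
      have "hcat Vs Vu *v ?c = stack v"
        using X'(2)[of "stack v"] by (simp add: X_def matrix_vector_mul_assoc[symmetric])
      then have "unstack (Vs *v (\<chi> i. ?c $ Inl i) + Vu *v (\<chi> i. ?c $ Inr i)) = v"
        unfolding hcat_mult_vec by simp
      then show "v = s 0 (\<chi> i. ?c $ Inl i) + u 0 (\<chi> i. ?c $ Inr i)"
        by (simp add: s_def u_def linear_add[OF linear_unstack])
      have "norm ?c \<le> G * (CX * norm (stack v))"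
        by (rule order_trans[OF norm_mat_vec_le]) (intro mult_mono, use G[OF order_refl] G0 CX(2)[of "stack v"] in \<open>auto simp: A'_def\<close>)
      then show "norm (\<chi> i. ?c $ Inl i) \<le> G * CX * norm v" "norm (\<chi> i. ?c $ Inr i) \<le> G * CX * norm v"
        using norm_vec_part_le[of ?c] by (auto simp: mult.assoc)
    qed
    show "\<exists>a b. B (s 0 a + u T b, s T a + u 0 b) = v \<and> norm a \<le> G * norm v \<and> norm b \<le> G * norm v"
      if T: "T0 \<le> T" for T v
    proof (intro exI conjI)
      let ?c = "matrix_inv (\<Gamma> T) *v stack v"
      let ?a = "\<chi> i. ?c $ Inl i" and ?b = "\<chi> i. ?c $ Inr i"
      have "stack (B (s 0 ?a + u T ?b, s T ?a + u 0 ?b)) = \<Gamma> T *v ?c"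
        unfolding stack_pair[OF \<open>linear B\<close>] B0_def[symmetric] BT_def[symmetric] \<Gamma>_def gamma_hat_def hcat_mult_vec
        by (simp add: s_def u_def linear_add[OF linear_stack] matrix_vector_right_distrib
            matrix_vector_mult_add_rdistrib matrix_vector_mul_assoc matrix_mul_assoc)
      also have "\<dots> = stack v"
        by (simp add: matrix_vector_mul_assoc matrix_inv_rectangular[OF \<Gamma>[OF T]])
      finally have "unstack (stack (B (s 0 ?a + u T ?b, s T ?a + u 0 ?b))) = unstack (stack v)"
        by (rule arg_cong)
      then show "B (s 0 ?a + u T ?b, s T ?a + u 0 ?b) = v" by (simp only: unstack_stack)
      have "norm ?c \<le> G * norm (stack v)"
        by (rule order_trans[OF norm_mat_vec_le mult_right_mono[OF G[OF T]]]) simp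
      then show "norm ?a \<le> G * norm v" "norm ?b \<le> G * norm v"
        using norm_vec_part_le[of ?c] by auto
    qed
  qed (use assms G0 CX in auto)
qed

section \<open>The reduced control problem\<close>

lemma Ck_on_Suc_imp: "Ck_on (Suc k) f S \<Longrightarrow> Ck_on k f S"
proof (induction k arbitrary: f)
  case 0
  then show ?case
    by (auto intro!: continuous_at_imp_continuous_on differentiable_imp_continuous_within)
next
  case (Suc k)
  have "Ck_on k (\<lambda>x. frechet_derivative f (at x) v) S" for v
    using Suc.prems by (intro Suc.IH) simp
  then show ?case using Suc.prems by simp
qed

lemma Ck_on_3D:
  assumes "Ck_on 3 f S"
  shows "Ck_on 2 f S" "Ck_on 2 (\<lambda>x. frechet_derivative f (at x) v) S" "x \<in> S \<Longrightarrow> f differentiable (at x)"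
proof -
  have "(3 :: nat) = Suc 2" by simp
  then have f: "Ck_on (Suc 2) f S" using assms by (simp only:)
  show "Ck_on 2 f S" using f by (rule Ck_on_Suc_imp)
  show "Ck_on 2 (\<lambda>x. frechet_derivative f (at x) v) S" "x \<in> S \<Longrightarrow> f differentiable (at x)"
    using f unfolding Ck_on.simps by blast+
qed

lemma Ck_on_2D:
  assumes "Ck_on 2 f S"
  shows "Ck_on 1 f S" "x \<in> S \<Longrightarrow> (\<lambda>x. frechet_derivative f (at x) v) differentiable (at x)"
    "x \<in> S \<Longrightarrow> f differentiable (at x)"
  using assms Ck_on_Suc_imp[of 1 f S] by (simp_all add: numeral_2_eq_2)

section \<open>Gradients and Hessians of scalar functions\<close>

lemma norm_le_of_inner_le:
  fixes v :: "'a::real_inner"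
  assumes "\<And>k. norm k \<le> 1 \<Longrightarrow> v \<bullet> k \<le> C"
  shows "norm v \<le> C"
proof -
  have "v \<bullet> sgn v \<le> C" by (rule assms) (simp add: norm_sgn)
  moreover have "v \<bullet> sgn v = norm v"
    by (cases "v = 0") (simp_all add: sgn_div_norm power2_norm_eq_inner[symmetric] power2_eq_square)
  ultimately show ?thesis by simp
qed

lemma norm_fst_snd_le: "norm (fst z) \<le> norm z" "norm (snd z) \<le> norm z"
  using norm_fst_le[of "fst z" "snd z"] norm_snd_le[of "snd z" "fst z"] by simp_all

lemma grad_inner:
  assumes "f differentiable (at x)"
  shows "grad f x \<bullet> k = frechet_derivative f (at x) k"
proof -
  have "linear (frechet_derivative f (at x))" using assms by (rule linear_frechet_derivative)
  then have "frechet_derivative f (at x) (\<Sum>b\<in>Basis. (k \<bullet> b) *\<^sub>R b)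
      = (\<Sum>b\<in>Basis. (k \<bullet> b) * frechet_derivative f (at x) b)"
    by (simp add: linear_sum linear_scale)
  moreover have "grad f x \<bullet> k = (\<Sum>b\<in>Basis. (k \<bullet> b) * frechet_derivative f (at x) b)"
    unfolding grad_def inner_sum_left by (intro sum.cong) (auto simp: inner_commute mult.commute)
  ultimately show ?thesis by (simp add: euclidean_representation)
qed

lemma grad_differentiable:
  fixes f :: "'a::euclidean_space \<Rightarrow> real"
  assumes "\<And>v. (\<lambda>x. frechet_derivative f (at x) v) differentiable (at x)"
  shows "grad f differentiable (at x)"
proof -
  have "(\<lambda>x. \<Sum>b\<in>Basis. frechet_derivative f (at x) b *\<^sub>R b) differentiable (at x)"
    by (intro differentiable_sum ballI differentiable_scaleR assms differentiable_const) simp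
  moreover have "grad f = (\<lambda>x. \<Sum>b\<in>Basis. frechet_derivative f (at x) b *\<^sub>R b)"
    by (simp add: fun_eq_iff grad_def)
  ultimately show ?thesis by simp
qed

lemma Ck_on_2_grad:
  fixes f :: "'a::euclidean_space \<Rightarrow> real"
  assumes "Ck_on 2 f UNIV"
  shows "grad f differentiable (at x)"
    and "frechet_derivative (grad f) (at x) h \<bullet> k = iter_deriv f [h, k] x"
proof -
  show *: "grad f differentiable (at x)"
    using assms by (intro grad_differentiable) (simp add: numeral_2_eq_2)
  have "(\<lambda>x. grad f x \<bullet> k) = (\<lambda>x. frechet_derivative f (at x) k)"
    using assms by (auto simp: fun_eq_iff numeral_2_eq_2 intro!: grad_inner)
  moreover have "((\<lambda>x. grad f x \<bullet> k) has_derivative (\<lambda>h. frechet_derivative (grad f) (at x) h \<bullet> k)) (at x)"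
    by (rule has_derivative_inner_left) (use * in \<open>simp add: frechet_derivative_works\<close>)
  ultimately show "frechet_derivative (grad f) (at x) h \<bullet> k = iter_deriv f [h, k] x"
    using frechet_derivative_at[of "\<lambda>x. grad f x \<bullet> k" "\<lambda>h. frechet_derivative (grad f) (at x) h \<bullet> k" x]
    by (simp add: fun_eq_iff)
qed

lemma norm_hessian_le:
  fixes f :: "'a::euclidean_space \<Rightarrow> real"
  assumes "Ck_on 2 f UNIV"
  shows "norm (frechet_derivative (grad f) (at x) h) \<le> deriv_norm 2 f x * norm h"
proof (rule norm_linear_le_of_unit_bound)
  show "linear (frechet_derivative (grad f) (at x))"
    using Ck_on_2_grad(1)[OF assms] by (rule linear_frechet_derivative)
  show "norm (frechet_derivative (grad f) (at x) h) \<le> deriv_norm 2 f x" if "norm h \<le> 1" for h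
  proof (rule norm_le_of_inner_le)
    fix k :: 'a assume "norm k \<le> 1"
    then have "norm (iter_deriv f [h, k] x) \<le> deriv_norm 2 f x"
      using that by (intro norm_iter_deriv_le_deriv_norm[OF open_UNIV assms]) auto
    then show "frechet_derivative (grad f) (at x) h \<bullet> k \<le> deriv_norm 2 f x"
      unfolding Ck_on_2_grad(2)[OF assms] by (simp only: real_norm_def abs_le_iff)
  qed
qed

text \<open>Tested against a unit vector k, the gradient becomes the directional derivative along k,
  whose second derivatives are third derivatives of f. The scalar increment bound is uniform in k
  and so bounds the norm. This is where C_B = \<open>Mter\<close> originates.\<close>

lemma grad_increment_bound:
  fixes f :: "'a::euclidean_space \<Rightarrow> real"
  assumes f: "Ck_on 3 f UNIV" and K: "convex K" "x0 \<in> K" "x \<in> K" "x' \<in> K"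
    and M: "\<And>z. z \<in> K \<Longrightarrow> deriv_norm 3 f z \<le> M"
  shows "norm (grad f x - grad f x' - frechet_derivative (grad f) (at x0) (x - x'))
    \<le> M * (norm (x - x0) + norm (x' - x0)) * norm (x - x')"
proof (rule norm_le_of_inner_le)
  fix k :: 'a assume k: "norm k \<le> 1"
  note f2 = Ck_on_3D(1)[OF f]
  have g: "Ck_on 2 (\<lambda>x. frechet_derivative f (at x) k) UNIV"
    using f by (rule Ck_on_3D)
  have d: "f differentiable (at x)" for x using Ck_on_3D(3)[OF f] by simp
  have "norm (frechet_derivative f (at x) k - frechet_derivative f (at x') k
      - frechet_derivative (\<lambda>x. frechet_derivative f (at x) k) (at x0) (x - x'))
    \<le> M * (norm (x - x0) + norm (x' - x0)) * norm (x - x')"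
  proof (rule second_order_increment_bound[OF K subset_UNIV g])
    fix z h h' :: 'a assume "z \<in> K" "norm h \<le> 1" "norm h' \<le> 1"
    then have "norm (iter_deriv f [h, h', k] z) \<le> M"
      using k by (intro order_trans[OF norm_iter_deriv_le_deriv_norm[OF open_UNIV f] M]) auto
    then show "norm (iter_deriv (\<lambda>x. frechet_derivative f (at x) k) [h, h'] z) \<le> M" by simp
  qed
  then have "norm ((grad f x - grad f x' - frechet_derivative (grad f) (at x0) (x - x')) \<bullet> k)
    \<le> M * (norm (x - x0) + norm (x' - x0)) * norm (x - x')"
    by (simp add: inner_diff_left grad_inner[OF d] Ck_on_2_grad(2)[OF f2])
  then show "(grad f x - grad f x' - frechet_derivative (grad f) (at x0) (x - x')) \<bullet> k
    \<le> M * (norm (x - x0) + norm (x' - x0)) * norm (x - x')"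
    by (simp only: real_norm_def abs_le_iff)
qed

text \<open>The partial gradient in the state is expressed through the joint derivatives of the running
  data, which makes it differentiable in all its arguments.\<close>

lemma ham_x_eq:
  fixes F :: "real^'d \<Rightarrow> real^'m \<Rightarrow> real^'d"
  assumes "(\<lambda>(x, u). F x u) differentiable (at (x, u))" "(\<lambda>(x, u). l x u) differentiable (at (x, u))"
  shows "ham_x lam l F x u p = (\<Sum>b\<in>Basis. (- lam * frechet_derivative (\<lambda>(x, u). l x u) (at (x, u)) (b, 0)
    + p \<bullet> frechet_derivative (\<lambda>(x, u). F x u) (at (x, u)) (b, 0)) *\<^sub>R b)"
proof -
  have pair: "((\<lambda>x. (x, u)) has_derivative (\<lambda>h. (h, 0))) (at x)"
    by (intro derivative_intros)
  have F: "((\<lambda>x. F x u) has_derivative (\<lambda>h. frechet_derivative (\<lambda>(x, u). F x u) (at (x, u)) (h, 0))) (at x)"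
    using has_derivative_compose[OF pair, of "\<lambda>(x, u). F x u"] assms(1)
    by (simp add: frechet_derivative_works)
  have l: "((\<lambda>x. l x u) has_derivative (\<lambda>h. frechet_derivative (\<lambda>(x, u). l x u) (at (x, u)) (h, 0))) (at x)"
    using has_derivative_compose[OF pair, of "\<lambda>(x, u). l x u"] assms(2)
    by (simp add: frechet_derivative_works)
  have "((\<lambda>x. ham lam l F x u p) has_derivative
      (\<lambda>h. - lam * frechet_derivative (\<lambda>(x, u). l x u) (at (x, u)) (h, 0)
        + p \<bullet> frechet_derivative (\<lambda>(x, u). F x u) (at (x, u)) (h, 0))) (at x)"
    unfolding ham_def
    by (intro has_derivative_add has_derivative_mult_right has_derivative_inner_right F l)
  then show ?thesis
    unfolding ham_x_def grad_def by (simp only: frechet_derivative_at[symmetric])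
qed

text \<open>The Green property is left out on purpose: the spectral criterion, which establishes it,
  and the linearity of L and of the endpoint rows are proved in this setting.\<close>

locale control_setting =
  fixes F :: "real^'d \<Rightarrow> real^'m \<Rightarrow> real^'d"
    and l :: "real^'d \<Rightarrow> real^'m \<Rightarrow> real"
    and r :: "real^'d \<Rightarrow> real^'q \<Rightarrow> real"
    and lam Mint Mter \<rho>x \<rho>p :: real
    and U V :: "(real^'m) set" and Y Y0 :: "(real^'q) set"
    and W :: "((real^'d) \<times> (real^'m)) set"
    and \<Omega> :: "((real^'d) \<times> (real^'d)) set"
    and Zx Zp Bx Bp :: "(real^'d) set"
    and xinf pinf :: "real^'d" and uinf :: "real^'m" and yinf :: "real^'q"
    and nu :: "(real^'d) \<times> (real^'d) \<Rightarrow> real^'m"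
    and Ftil L :: "((real^'d) \<times> (real^'d)) \<times> ((real^'d) \<times> (real^'d)) \<Rightarrow> (real^'d) \<times> (real^'d)"
  assumes F3: "Ck_on 3 (\<lambda>(x, u). F x u) W" and l3: "Ck_on 3 (\<lambda>(x, u). l x u) W"
    and r3: "y \<in> Y \<Longrightarrow> Ck_on 3 (\<lambda>x. r x y) UNIV"
    and \<Omega>: "open \<Omega>" "(xinf, pinf) \<in> \<Omega>"
    and VU: "closure V \<subseteq> interior U" and \<Omega>V: "\<omega> \<in> \<Omega> \<Longrightarrow> v \<in> V \<Longrightarrow> (fst \<omega>, v) \<in> W"
    and nu2: "Ck_on 2 nu \<Omega>" and nuV: "nu ` \<Omega> \<subseteq> V"
    and nu_stat: "\<omega> \<in> \<Omega> \<Longrightarrow> ham_u lam l F (fst \<omega>) (nu \<omega>) (snd \<omega>) = 0"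
    and nu_inf: "nu (xinf, pinf) = uinf"
    and Ftil: "Ftil = shifted_step lam l F nu (xinf, pinf)"
    and L: "L = frechet_derivative Ftil (at (0, 0))"
    and Z\<Omega>: "\<xi> \<in> Zx \<Longrightarrow> \<pi> \<in> Zp \<Longrightarrow> (xinf + \<xi>, pinf + \<pi>) \<in> \<Omega>"
    and Bx: "\<rho>x > 0" "Bx = cball 0 \<rho>x" "Bx \<subseteq> Zx"
    and Bp: "\<rho>p > 0" "Bp = cball 0 \<rho>p" "Bp \<subseteq> Zp"
    and Y0: "yinf \<in> interior Y0" "closure Y0 \<subseteq> Y"
    and bdd1: "bdd_above ((\<lambda>\<zeta>. deriv_norm 1 nu ((xinf, pinf) + \<zeta>)) ` (Zx \<times> Zp))"
    and bdd2: "bdd_above ((\<lambda>\<zeta>. deriv_norm 2 nu ((xinf, pinf) + \<zeta>)) ` (Zx \<times> Zp))"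
    and Mint: "(SUP \<zeta>\<in>Zx \<times> Zp. deriv_norm 1 nu ((xinf, pinf) + \<zeta>))
           + (SUP \<zeta>\<in>Zx \<times> Zp. deriv_norm 2 nu ((xinf, pinf) + \<zeta>)) \<le> Mint"
    and Mter: "\<xi> \<in> Bx \<Longrightarrow> y \<in> Y0 \<Longrightarrow> j \<in> {1, 2, 3} \<Longrightarrow> deriv_norm j (\<lambda>x. r x y) (xinf + \<xi>) \<le> Mter"
    and cont: "y \<in> Y0 \<Longrightarrow> \<epsilon> > 0 \<Longrightarrow> \<exists>\<delta>>0. \<forall>y'\<in>Y0. dist y' y < \<delta> \<longrightarrow>
           (\<forall>\<xi>\<in>Bx. norm (r_x r (xinf + \<xi>) y' - r_x r (xinf + \<xi>) y) < \<epsilon> \<and>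
              onorm (\<lambda>h. r_xx r (xinf + \<xi>) y' h - r_xx r (xinf + \<xi>) y h) < \<epsilon>)"
begin

lemma Y0_Y: "y \<in> Y0 \<Longrightarrow> y \<in> Y"
  using Y0 closure_subset by blast

lemma zero_B: "0 \<in> Bx" "0 \<in> Bp"
  using Bx Bp by auto

lemma yinf_Y0: "yinf \<in> Y0"
  using Y0 interior_subset by blast

lemma Mter_nonneg: "0 \<le> Mter"
proof -
  have "0 \<le> deriv_norm 3 (\<lambda>x. r x yinf) (xinf + 0)"
    by (rule deriv_norm_nonneg[OF open_UNIV r3[OF Y0_Y[OF yinf_Y0]]]) simp
  also have "\<dots> \<le> Mter" by (rule Mter) (use zero_B yinf_Y0 in auto)
  finally show ?thesis .
qed

lemma r_x_eq_grad: "r_x r x y = grad (\<lambda>x. r x y) x"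
  by (simp add: r_x_def)

lemma r_xx_eq: "r_xx r x y = frechet_derivative (grad (\<lambda>x. r x y)) (at x)"
  unfolding r_xx_def r_x_def ..

lemma r_x_has_derivative:
  assumes "y \<in> Y"
  shows "((\<lambda>x. r_x r x y) has_derivative r_xx r x y) (at x)"
proof -
  have "grad (\<lambda>x. r x y) differentiable (at x)"
    by (rule Ck_on_2_grad(1)[OF Ck_on_3D(1)[OF r3[OF assms]]])
  then show ?thesis
    unfolding r_xx_eq r_x_eq_grad by (simp add: frechet_derivative_works)
qed

lemma r_xx_linear: "y \<in> Y \<Longrightarrow> linear (r_xx r x y)"
  using r_x_has_derivative has_derivative_linear by blast

lemma r_xx_le:
  assumes "y \<in> Y0"
  shows "norm (r_xx r xinf y h) \<le> Mter * norm h"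
proof -
  have "deriv_norm 2 (\<lambda>x. r x y) (xinf + 0) \<le> Mter"
    by (rule Mter) (use zero_B assms in auto)
  then have "deriv_norm 2 (\<lambda>x. r x y) xinf * norm h \<le> Mter * norm h"
    by (intro mult_right_mono) auto
  then show ?thesis
    using norm_hessian_le[OF Ck_on_3D(1)[OF r3[OF Y0_Y[OF assms]]], of xinf h] r_xx_eq[of xinf y]
    by simp
qed

text \<open>Equals the linearised minus the full endpoint map at a pair ending in z. With this sign
  it stands next to the datum on the right-hand side of the linear boundary condition.\<close>

definition terminal_remainder :: "real^'q \<Rightarrow> (real^'d) \<times> (real^'d) \<Rightarrow> (real^'d) \<times> (real^'d)" where
  "terminal_remainder y z = (0, r_x r (xinf + fst z) y - r_x r xinf y - r_xx r xinf y (fst z))"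

lemma terminal_remainder_le:
  assumes "y \<in> Y0" "a \<in> Bx \<times> Bp" "a' \<in> Bx \<times> Bp"
  shows "norm (terminal_remainder y a - terminal_remainder y a')
    \<le> Mter * (norm a + norm a') * norm (a - a')"
proof -
  let ?D = "r_xx r xinf y" and ?x = "xinf + fst a" and ?x' = "xinf + fst a'"
  have lin: "linear ?D" using assms Y0_Y by (intro r_xx_linear) auto
  have "norm (grad (\<lambda>x. r x y) ?x - grad (\<lambda>x. r x y) ?x'
      - frechet_derivative (grad (\<lambda>x. r x y)) (at xinf) (?x - ?x'))
    \<le> Mter * (norm (?x - xinf) + norm (?x' - xinf)) * norm (?x - ?x')"
  proof (rule grad_increment_bound[OF r3[OF Y0_Y[OF assms(1)]], of "cball xinf \<rho>x"])
    show "deriv_norm 3 (\<lambda>x. r x y) z \<le> Mter" if "z \<in> cball xinf \<rho>x" for z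
      using Mter[of "z - xinf" y 3] that assms Bx by (simp add: dist_norm norm_minus_commute)
  qed (use assms Bx in \<open>auto simp: dist_norm mem_Times_iff\<close>)
  then have "norm (r_x r ?x y - r_x r ?x' y - ?D (fst a - fst a'))
      \<le> Mter * (norm (fst a) + norm (fst a')) * norm (fst a - fst a')"
    by (simp add: r_x_eq_grad r_xx_eq)
  also have "\<dots> \<le> Mter * (norm a + norm a') * norm (a - a')"
    using norm_fst_snd_le(1)[of a] norm_fst_snd_le(1)[of a'] norm_fst_snd_le(1)[of "a - a'"] Mter_nonneg
    by (intro mult_mono add_mono) auto
  finally have "norm (r_x r ?x y - r_x r ?x' y - ?D (fst a - fst a'))
      \<le> Mter * (norm a + norm a') * norm (a - a')" .
  moreover have "terminal_remainder y a - terminal_remainder y a'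
      = (0, r_x r ?x y - r_x r ?x' y - ?D (fst a - fst a'))"
    by (simp add: terminal_remainder_def linear_diff[OF lin])
  ultimately show ?thesis by (simp add: norm_Pair)
qed

section \<open>Endpoint rows and their dependence on the terminal parameter\<close>

lemma endpoint_map_eq:
  "endpoint_map r xinf y (a, b) = (fst a, snd b - (r_x r (xinf + fst b) y - r_x r xinf y))"
  by (simp add: endpoint_map_def split_beta)

lemma endpoint_lin_eq:
  assumes "y \<in> Y"
  shows "endpoint_lin r xinf y = (\<lambda>(a, b). (fst a, snd b - r_xx r xinf y (fst b)))"
    and "linear (endpoint_lin r xinf y)"
proof -
  have 1: "endpoint_map r xinf y = (\<lambda>w. (fst (fst w), snd (snd w) - (r_x r (xinf + fst (snd w)) y - r_x r xinf y)))"
    by (simp add: fun_eq_iff endpoint_map_eq)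
  have inner: "((\<lambda>w. xinf + fst (snd w)) has_derivative (\<lambda>w. fst (snd w))) (at (0 :: ((real^'d) \<times> (real^'d)) \<times> ((real^'d) \<times> (real^'d))))"
    by (auto intro!: derivative_eq_intros)
  have "((\<lambda>x. r_x r x y) has_derivative r_xx r xinf y) (at (xinf + fst (snd (0 :: ((real^'d) \<times> (real^'d)) \<times> ((real^'d) \<times> (real^'d))))))"
    using r_x_has_derivative[OF assms, of xinf] by simp
  from has_derivative_compose[OF inner this]
  have rd: "((\<lambda>w. r_x r (xinf + fst (snd w)) y) has_derivative (\<lambda>w. r_xx r xinf y (fst (snd w))))
      (at (0 :: ((real^'d) \<times> (real^'d)) \<times> ((real^'d) \<times> (real^'d))))" .
  have "(endpoint_map r xinf y has_derivative
      (\<lambda>w. (fst (fst w), snd (snd w) - (r_xx r xinf y (fst (snd w)) - 0)))) (at 0)"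
    unfolding 1
    by (intro has_derivative_Pair has_derivative_diff rd has_derivative_const has_derivative_fst has_derivative_snd has_derivative_ident)
  then have 2: "(endpoint_map r xinf y has_derivative
      (\<lambda>(a, b). (fst a, snd b - r_xx r xinf y (fst b)))) (at (0, 0))"
    by (simp add: case_prod_unfold zero_prod_def)
  show eq: "endpoint_lin r xinf y = (\<lambda>(a, b). (fst a, snd b - r_xx r xinf y (fst b)))"
    unfolding endpoint_lin_def using frechet_derivative_at[OF 2] by simp
  show "linear (endpoint_lin r xinf y)"
    unfolding eq using has_derivative_linear[OF 2] .
qed

lemma endpoint_lin_apply:
  "y \<in> Y \<Longrightarrow> endpoint_lin r xinf y (a, b) = (fst a, snd b - r_xx r xinf y (fst b))"
  by (simp add: endpoint_lin_eq)

lemma endpoint_perturbation_eq: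
  "endpoint_perturbation r xinf yinf y v = (0, - (r_xx r xinf y (fst v) - r_xx r xinf yinf (fst v)))"
  by (simp add: endpoint_perturbation_def split_beta)

lemma endpoint_perturbation_linear:
  assumes "y \<in> Y0"
  shows "linear (endpoint_perturbation r xinf yinf y)"
proof -
  have "linear (r_xx r xinf y)" "linear (r_xx r xinf yinf)"
    using assms Y0_Y yinf_Y0 by (auto intro: r_xx_linear)
  then show ?thesis
    by (intro linearI) (simp_all add: endpoint_perturbation_eq linear_add linear_scale algebra_simps)
qed

text \<open>The first bound, uniform in y, makes the supremum over a neighbourhood a finite one; the
  second makes it small near \<open>yinf\<close> by continuity of the Hessian.\<close>

lemma onorm_endpoint_perturbation:
  assumes "y \<in> Y0"
  shows "onorm (endpoint_perturbation r xinf yinf y) \<le> 2 * Mter"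
    and "onorm (endpoint_perturbation r xinf yinf y) \<le> onorm (\<lambda>h. r_xx r xinf y h - r_xx r xinf yinf h)"
proof -
  let ?D = "\<lambda>h. r_xx r xinf y h - r_xx r xinf yinf h"
  have eq: "norm (endpoint_perturbation r xinf yinf y v) = norm (?D (fst v))" for v
    unfolding endpoint_perturbation_eq by (simp add: norm_Pair norm_minus_commute)
  show "onorm (endpoint_perturbation r xinf yinf y) \<le> 2 * Mter"
  proof (rule onorm_bound)
    fix v :: "(real^'d) \<times> (real^'d)"
    have "norm (?D (fst v)) \<le> Mter * norm (fst v) + Mter * norm (fst v)"
      by (rule norm_triangle_le_diff) (intro add_mono r_xx_le assms yinf_Y0)
    also have "\<dots> \<le> 2 * Mter * norm v"
      using norm_fst_snd_le(1)[of v] mult_left_mono[OF _ Mter_nonneg, of "norm (fst v)" "norm v"] by simp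
    finally show "norm (endpoint_perturbation r xinf yinf y v) \<le> 2 * Mter * norm v" unfolding eq .
  qed (use Mter_nonneg in simp)
  have "linear ?D"
    by (intro linear_compose_sub r_xx_linear Y0_Y assms yinf_Y0)
  then have bl: "bounded_linear ?D" by (simp add: linear_conv_bounded_linear)
  show "onorm (endpoint_perturbation r xinf yinf y) \<le> onorm ?D"
  proof (rule onorm_bound)
    fix v :: "(real^'d) \<times> (real^'d)"
    have "norm (?D (fst v)) \<le> onorm ?D * norm (fst v)" by (rule onorm[OF bl])
    also have "\<dots> \<le> onorm ?D * norm v"
      by (intro mult_left_mono norm_fst_snd_le onorm_pos_le bl)
    finally show "norm (endpoint_perturbation r xinf yinf y v) \<le> onorm ?D * norm v" unfolding eq .
  qed (rule onorm_pos_le[OF bl])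
qed

lemma norm_endpoint_perturbation_le:
  assumes "Y1 \<subseteq> Y0" "y \<in> Y1"
  shows "norm (endpoint_perturbation r xinf yinf y v)
    \<le> (SUP y\<in>Y1. onorm (endpoint_perturbation r xinf yinf y)) * norm v"
proof -
  have "bounded_linear (endpoint_perturbation r xinf yinf y)"
    using endpoint_perturbation_linear assms by (auto simp: linear_conv_bounded_linear)
  from onorm[OF this, of v]
  have "norm (endpoint_perturbation r xinf yinf y v) \<le> onorm (endpoint_perturbation r xinf yinf y) * norm v" .
  moreover have "onorm (endpoint_perturbation r xinf yinf y)
      \<le> (SUP y\<in>Y1. onorm (endpoint_perturbation r xinf yinf y))"
    using assms onorm_endpoint_perturbation(1)
    by (intro cSUP_upper bdd_aboveI2[where M = "2 * Mter"]) auto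
  ultimately show ?thesis
    using mult_right_mono[OF _ norm_ge_zero] order_trans by blast
qed

lemma sup_endpoint_perturbation_nonneg:
  assumes "Y1 \<subseteq> Y0" "y \<in> Y1"
  shows "0 \<le> (SUP y\<in>Y1. onorm (endpoint_perturbation r xinf yinf y))"
proof -
  have "bounded_linear (endpoint_perturbation r xinf yinf y)"
    using endpoint_perturbation_linear assms by (auto simp: linear_conv_bounded_linear)
  then have "0 \<le> onorm (endpoint_perturbation r xinf yinf y)" by (rule onorm_pos_le)
  also have "\<dots> \<le> (SUP y\<in>Y1. onorm (endpoint_perturbation r xinf yinf y))"
    using assms onorm_endpoint_perturbation(1)
    by (intro cSUP_upper bdd_aboveI2[where M = "2 * Mter"]) auto
  finally show ?thesis .
qed

lemma terminal_neighbourhood_exists: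
  assumes "1 \<le> C"
  shows "\<exists>Y1. yinf \<in> interior Y1 \<and> rel_compact_in Y1 Y0 \<and>
    2 * C * (SUP y\<in>Y1. onorm (endpoint_perturbation r xinf yinf y)) < 1"
proof -
  \<comment> \<open>The threshold 1/(4C) leaves 2 C times the supremum at most 1/2. The radius e
    below is for relative compactness, \<delta> for smallness.\<close>
  obtain \<delta> where \<delta>: "0 < \<delta>" "\<forall>y'\<in>Y0. dist y' yinf < \<delta> \<longrightarrow>
      onorm (\<lambda>h. r_xx r (xinf + 0) y' h - r_xx r (xinf + 0) yinf h) < 1 / (4 * C)"
    using cont[OF yinf_Y0, of "1 / (4 * C)"] zero_B(1) assms by fastforce
  obtain e where e: "0 < e" "cball yinf e \<subseteq> interior Y0"
    using Y0(1) open_contains_cball open_interior by metis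
  define Y1 where "Y1 = ball yinf (min e \<delta>)"
  have cl: "closure Y1 \<subseteq> cball yinf e" "compact (closure Y1)"
    unfolding Y1_def using e \<delta> by (auto simp: closure_ball)
  have eY: "cball yinf e \<subseteq> Y0" using e(2) interior_subset by (rule subset_trans)
  then have Y1: "Y1 \<subseteq> Y0" by (auto simp: Y1_def subset_iff)
  have "(SUP y\<in>Y1. onorm (endpoint_perturbation r xinf yinf y)) \<le> 1 / (4 * C)"
  proof (rule cSUP_least)
    show "Y1 \<noteq> {}" using e \<delta> by (auto simp: Y1_def)
    fix y assume "y \<in> Y1"
    then have "y \<in> Y0" "dist y yinf < \<delta>" using Y1 by (auto simp: Y1_def dist_commute)
    then have "onorm (\<lambda>h. r_xx r (xinf + 0) y h - r_xx r (xinf + 0) yinf h) < 1 / (4 * C)"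
      using \<delta>(2) by blast
    then show "onorm (endpoint_perturbation r xinf yinf y) \<le> 1 / (4 * C)"
      using onorm_endpoint_perturbation(2)[OF \<open>y \<in> Y0\<close>] by simp
  qed
  then have "2 * C * (SUP y\<in>Y1. onorm (endpoint_perturbation r xinf yinf y)) \<le> 2 * C * (1 / (4 * C))"
    using assms by (intro mult_left_mono) auto
  also have "\<dots> < 1" using assms by simp
  finally have "2 * C * (SUP y\<in>Y1. onorm (endpoint_perturbation r xinf yinf y)) < 1" .
  moreover have "yinf \<in> interior Y1" using e \<delta> by (simp add: Y1_def interior_open)
  moreover have "rel_compact_in Y1 Y0" using cl eY by (auto simp: rel_compact_in_def)
  ultimately show ?thesis by blast
qed

lemma uniform_green_nearby:
  assumes green: "uniform_green L (endpoint_lin r xinf yinf) C \<gamma> T0"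
    and Y1: "Y1 \<subseteq> Y0" "y \<in> Y1"
    and \<theta>: "\<theta> = 2 * C * (SUP y\<in>Y1. onorm (endpoint_perturbation r xinf yinf y))" "\<theta> < 1"
  shows "uniform_green L (endpoint_lin r xinf y) (C * (1 + \<theta>) / (1 - \<theta>)) \<gamma> T0"
proof (rule uniform_green_perturb[OF green _ _ _ _ _ \<theta>])
  have y: "y \<in> Y" "yinf \<in> Y" "y \<in> Y0" using Y1 Y0_Y yinf_Y0 by auto
  show "linear (endpoint_lin r xinf y)" by (rule endpoint_lin_eq(2)[OF y(1)])
  show "endpoint_lin r xinf y (a, b) = endpoint_lin r xinf yinf (a, b) + endpoint_perturbation r xinf yinf y b" for a b
    by (simp add: endpoint_lin_apply y endpoint_perturbation_eq)
  show "linear (endpoint_perturbation r xinf yinf y)" by (rule endpoint_perturbation_linear[OF y(3)])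
  show "norm (endpoint_perturbation r xinf yinf y v)
    \<le> (SUP y\<in>Y1. onorm (endpoint_perturbation r xinf yinf y)) * norm v" for v
    by (rule norm_endpoint_perturbation_le[OF Y1])
  show "0 \<le> (SUP y\<in>Y1. onorm (endpoint_perturbation r xinf yinf y))"
    by (rule sup_endpoint_perturbation_nonneg[OF Y1])
qed

end

section \<open>The eliminated control and the reduced step\<close>

lemma norm_cross_pair_le: "norm (fst a, snd b) \<le> norm a + norm b"
  by (rule order_trans[OF norm_Pair_le]) (intro add_mono norm_fst_snd_le)

text \<open>\<open>Mint\<close> bounds only the sum of the two suprema; each derivative norm is
  bounded by it separately because the other supremum is nonnegative.\<close>

lemma deriv_norm_sup_le:
  assumes "open S" "Ck_on i f S" "Ck_on j f S" "\<And>z. z \<in> K \<Longrightarrow> g z \<in> S" "z \<in> K"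
    and "bdd_above ((\<lambda>z. deriv_norm i f (g z)) ` K)" "bdd_above ((\<lambda>z. deriv_norm j f (g z)) ` K)"
  shows "deriv_norm i f (g z) \<le> (SUP z\<in>K. deriv_norm i f (g z)) + (SUP z\<in>K. deriv_norm j f (g z))"
proof -
  have "deriv_norm i f (g z) \<le> (SUP z\<in>K. deriv_norm i f (g z))"
    by (intro cSUP_upper assms)
  moreover have "0 \<le> deriv_norm j f (g z)"
    using assms by (intro deriv_norm_nonneg[of S]) auto
  moreover have "deriv_norm j f (g z) \<le> (SUP z\<in>K. deriv_norm j f (g z))"
    by (intro cSUP_upper assms)
  ultimately show ?thesis by linarith
qed

context control_setting
begin

abbreviation Dnu where "Dnu \<equiv> frechet_derivative nu (at (xinf, pinf))"

lemma deriv_norm_nu_le: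
  assumes "\<zeta> \<in> Bx \<times> Bp"
  shows "deriv_norm 1 nu ((xinf, pinf) + \<zeta>) \<le> Mint" "deriv_norm 2 nu ((xinf, pinf) + \<zeta>) \<le> Mint"
proof -
  have in\<Omega>: "(xinf, pinf) + \<zeta> \<in> \<Omega>" if "\<zeta> \<in> Zx \<times> Zp" for \<zeta>
    using that Z\<Omega> by (cases \<zeta>) auto
  have \<zeta>: "\<zeta> \<in> Zx \<times> Zp" using assms Bx Bp by blast
  show "deriv_norm 1 nu ((xinf, pinf) + \<zeta>) \<le> Mint"
    using deriv_norm_sup_le[OF \<Omega>(1) Ck_on_2D(1)[OF nu2] nu2 in\<Omega> \<zeta> bdd1 bdd2] Mint by linarith
  show "deriv_norm 2 nu ((xinf, pinf) + \<zeta>) \<le> Mint"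
    using deriv_norm_sup_le[OF \<Omega>(1) nu2 Ck_on_2D(1)[OF nu2] in\<Omega> \<zeta> bdd2 bdd1] Mint by linarith
qed

lemma box:
  shows "convex ((+) (xinf, pinf) ` (Bx \<times> Bp))" "(+) (xinf, pinf) ` (Bx \<times> Bp) \<subseteq> \<Omega>"
    "(xinf, pinf) \<in> (+) (xinf, pinf) ` (Bx \<times> Bp)"
proof -
  show "convex ((+) (xinf, pinf) ` (Bx \<times> Bp))"
    using Bx Bp by (intro convex_translation convex_Times) auto
  show "(+) (xinf, pinf) ` (Bx \<times> Bp) \<subseteq> \<Omega>"
    using Z\<Omega> Bx Bp by force
  show "(xinf, pinf) \<in> (+) (xinf, pinf) ` (Bx \<times> Bp)"
    using zero_B by (intro image_eqI[of _ _ "(0, 0)"]) auto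
qed

lemma Dnu_unit_le:
  assumes "z \<in> (+) (xinf, pinf) ` (Bx \<times> Bp)" "norm h \<le> 1"
  shows "norm (frechet_derivative nu (at z) h) \<le> Mint"
proof -
  have "norm (iter_deriv nu [h] z) \<le> deriv_norm 1 nu z"
    using assms box by (intro norm_iter_deriv_le_deriv_norm[OF \<Omega>(1) Ck_on_2D(1)[OF nu2]]) auto
  also have "\<dots> \<le> Mint" using assms deriv_norm_nu_le by auto
  finally show ?thesis by simp
qed

lemma Mint_nonneg: "0 \<le> Mint"
  by (rule order_trans[OF norm_ge_zero Dnu_unit_le[OF box(3), of 0]]) simp

lemma nu_lipschitz:
  assumes "\<zeta> \<in> Bx \<times> Bp" "\<zeta>' \<in> Bx \<times> Bp"
  shows "norm (nu ((xinf, pinf) + \<zeta>) - nu ((xinf, pinf) + \<zeta>')) \<le> Mint * norm (\<zeta> - \<zeta>')"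
proof -
  have "norm (nu ((xinf, pinf) + \<zeta>) - nu ((xinf, pinf) + \<zeta>'))
      \<le> Mint * norm ((xinf, pinf) + \<zeta> - ((xinf, pinf) + \<zeta>'))"
  proof (rule norm_diff_le_of_derivative_bound[OF box(1)])
    show "nu differentiable (at z)" if "z \<in> (+) (xinf, pinf) ` (Bx \<times> Bp)" for z
      using that box(2) Ck_on_2D(3)[OF nu2] by blast
  qed (use assms Dnu_unit_le in auto)
  then show ?thesis by simp
qed

lemma Dnu_linear: "linear Dnu"
  using Ck_on_2D(3)[OF nu2 \<Omega>(2)] by (rule linear_frechet_derivative)

lemma Dnu_le: "norm (Dnu h) \<le> Mint * norm h"
  by (rule norm_linear_le_of_unit_bound[OF Dnu_linear Dnu_unit_le[OF box(3)]])

lemma nu_expansion: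
  assumes "\<zeta> \<in> Bx \<times> Bp"
  shows "norm (nu ((xinf, pinf) + \<zeta>) - uinf - Dnu \<zeta>) \<le> Mint * (norm \<zeta>)\<^sup>2"
proof -
  have "norm (nu ((xinf, pinf) + \<zeta>) - nu (xinf, pinf) - Dnu ((xinf, pinf) + \<zeta> - (xinf, pinf)))
    \<le> Mint * (norm ((xinf, pinf) + \<zeta> - (xinf, pinf)) + norm ((xinf, pinf) - (xinf, pinf)))
      * norm ((xinf, pinf) + \<zeta> - (xinf, pinf))"
  proof (rule second_order_increment_bound[OF box(1,3) _ box(3,2) nu2])
    show "(xinf, pinf) + \<zeta> \<in> (+) (xinf, pinf) ` (Bx \<times> Bp)" using assms by blast
    fix z h h' :: "(real^'d) \<times> (real^'d)"
    assume "z \<in> (+) (xinf, pinf) ` (Bx \<times> Bp)" "norm h \<le> 1" "norm h' \<le> 1"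
    then have "z \<in> \<Omega>" "\<forall>k\<in>set [h, h']. norm k \<le> 1" "deriv_norm 2 nu z \<le> Mint"
      using deriv_norm_nu_le(2) box(2) by auto
    then have "norm (iter_deriv nu [h, h'] z) \<le> deriv_norm 2 nu z" "deriv_norm 2 nu z \<le> Mint"
      using norm_iter_deriv_le_deriv_norm[OF \<Omega>(1) nu2, of z "[h, h']"] by simp_all
    then show "norm (iter_deriv nu [h, h'] z) \<le> Mint" by linarith
  qed
  then show ?thesis by (simp add: nu_inf power2_eq_square mult.assoc)
qed

text \<open>L is given by \<open>frechet_derivative\<close>, so its linearity rests on
  differentiability of \<open>Ftil\<close> at the origin. On the open set where the mixed arguments
  lie in \<Omega>, \<open>Ftil\<close> is assembled from F, from first joint derivatives of F and l,
  and from \<open>nu\<close>, all differentiable there.\<close>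

lemma L_linear: "linear L"
proof -
  define f where "f = (\<lambda>(x, u). F x u)"
  define k where "k = (\<lambda>(x, u). l x u)"
  define \<omega> where "\<omega> = (\<lambda>w :: ((real^'d) \<times> (real^'d)) \<times> ((real^'d) \<times> (real^'d)). (xinf + fst (fst w), pinf + snd (snd w)))"
  define g where "g = (\<lambda>w. (fst (\<omega> w), nu (\<omega> w)))"
  define dom0 where "dom0 = \<omega> -` \<Omega>"
  have d\<omega>: "(\<omega> has_derivative (\<lambda>w. (fst (fst w), snd (snd w)))) (at w)" for w
    unfolding \<omega>_def by (auto intro!: derivative_eq_intros)
  have "open dom0"
    unfolding dom0_def \<omega>_def by (intro open_vimage \<Omega>(1) continuous_intros)
  have gW: "g w \<in> W" if "w \<in> dom0" for w
    using that \<Omega>V[of "\<omega> w" "nu (\<omega> w)"] nuV by (auto simp: dom0_def g_def)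
  have 0: "(0, 0) \<in> dom0" using \<Omega> by (simp add: dom0_def \<omega>_def)
  have dg: "g differentiable (at (0, 0))"
  proof -
    have "(nu has_derivative Dnu) (at (\<omega> (0, 0)))"
      using Ck_on_2D(3)[OF nu2 \<Omega>(2)] by (simp add: \<omega>_def frechet_derivative_works)
    from has_derivative_Pair[OF has_derivative_fst[OF d\<omega>] has_derivative_compose[OF d\<omega> this]]
    show ?thesis unfolding g_def differentiable_def by blast
  qed
  have f3: "Ck_on 3 f W" and k3: "Ck_on 3 k W" unfolding f_def k_def by (rule F3 l3)+
  have df: "(\<lambda>w. f (g w)) differentiable (at (0, 0))"
    "(\<lambda>w. frechet_derivative f (at (g w)) v) differentiable (at (0, 0))"
    "(\<lambda>w. frechet_derivative k (at (g w)) v) differentiable (at (0, 0))" for v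
    by (rule differentiable_compose[OF Ck_on_3D(3)[OF f3 gW[OF 0]] dg]
        differentiable_compose[OF Ck_on_2D(3)[OF Ck_on_3D(2)[OF f3] gW[OF 0]] dg]
        differentiable_compose[OF Ck_on_2D(3)[OF Ck_on_3D(2)[OF k3] gW[OF 0]] dg])+
  have dp: "(\<lambda>w. snd (\<omega> w)) differentiable (at (0, 0))"
    using has_derivative_snd[OF d\<omega>, of "(0, 0)"] unfolding differentiable_def by blast
  define H where "H = (\<lambda>w. \<Sum>b\<in>Basis. (- lam * frechet_derivative k (at (g w)) (b, 0)
      + snd (\<omega> w) \<bullet> frechet_derivative f (at (g w)) (b, 0)) *\<^sub>R b)"
  have dH: "H differentiable (at (0, 0))"
    unfolding H_def
    by (intro differentiable_sum ballI differentiable_scaleR differentiable_add differentiable_mult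
        differentiable_inner differentiable_const df dp) simp
  have eq: "Ftil w = (xinf + fst (snd w) - f (g w), pinf + snd (fst w) - H w)" if "w \<in> dom0" for w
  proof -
    have "(\<lambda>(x, u). F x u) differentiable (at (fst (g w), snd (g w)))"
      "(\<lambda>(x, u). l x u) differentiable (at (fst (g w), snd (g w)))"
      using Ck_on_3D(3)[OF F3 gW[OF that]] Ck_on_3D(3)[OF l3 gW[OF that]] by auto
    from ham_x_eq[OF this] show ?thesis
      by (simp add: Ftil shifted_step_def reduced_step_def split_beta f_def k_def H_def g_def \<omega>_def)
  qed
  obtain D1 D2 where D: "((\<lambda>w. f (g w)) has_derivative D1) (at (0, 0))" "(H has_derivative D2) (at (0, 0))"
    using df(1) dH unfolding differentiable_def by blast
  have "((\<lambda>w. (xinf + fst (snd w) - f (g w), pinf + snd (fst w) - H w)) has_derivative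
      (\<lambda>w. (0 + fst (snd w) - D1 w, 0 + snd (fst w) - D2 w))) (at (0, 0))"
    by (intro has_derivative_Pair has_derivative_diff has_derivative_add has_derivative_const
        has_derivative_fst has_derivative_snd has_derivative_ident D)
  then have "(Ftil has_derivative (\<lambda>w. (0 + fst (snd w) - D1 w, 0 + snd (fst w) - D2 w))) (at (0, 0))"
    by (rule has_derivative_transform_within_open[OF _ \<open>open dom0\<close> 0]) (simp add: eq)
  then have "Ftil differentiable (at (0, 0))" unfolding differentiable_def by blast
  then show ?thesis unfolding L by (rule linear_frechet_derivative)
qed

lemma Ftil_eq_0_iff:
  "Ftil (z, z') = 0 \<longleftrightarrow> xinf + fst z' = F (xinf + fst z) (nu (xinf + fst z, pinf + snd z'))
    \<and> pinf + snd z = ham_x lam l F (xinf + fst z) (nu (xinf + fst z, pinf + snd z')) (pinf + snd z')"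
  by (simp add: Ftil shifted_step_def reduced_step_def split_beta zero_prod_def)

lemma endpoint_eq_iff:
  "endpoint_map r xinf y (z0, zT) = oc_datum r xinf pinf xin y \<longleftrightarrow>
    xinf + fst z0 = xin \<and> pinf + snd zT = r_x r (xinf + fst zT) y"
  by (auto simp: endpoint_map_eq oc_datum_def algebra_simps)

definition control :: "(nat \<Rightarrow> (real^'d) \<times> (real^'d)) \<Rightarrow> nat \<Rightarrow> real^'m" where
  "control z t = nu ((xinf, pinf) + (fst (z t), snd (z (Suc t))))"

text \<open>The datum is a free argument, not tied to an initial state and y, so that a solution can
  be reread for another terminal parameter.\<close>

definition critical :: "real^'q \<Rightarrow> nat \<Rightarrow> (real^'d) \<times> (real^'d) \<Rightarrow> (nat \<Rightarrow> (real^'d) \<times> (real^'d)) \<Rightarrow> bool" where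
  "critical y T \<Delta> z \<longleftrightarrow> (\<forall>t<T. Ftil (z t, z (Suc t)) = 0) \<and> endpoint_map r xinf y (z 0, z T) = \<Delta>"

text \<open>Inside the tube every mixed argument lies in \<Omega>, where \<open>nu\<close> is
  stationary with values in the interior of U; only dynamics, adjoint equation and endpoint
  condition remain to be solved.\<close>

lemma pontryagin_branch_iff:
  assumes "\<And>t. t \<le> T \<Longrightarrow> z t \<in> Bx \<times> Bp"
  shows "pontryagin_branch U lam l F r \<Omega> nu (xinf, pinf) T xin y z u \<longleftrightarrow>
    critical y T (oc_datum r xinf pinf xin y) z \<and> (\<forall>t<T. u t = control z t)"
proof -
  have mem: "(xinf + fst (z t), pinf + snd (z (Suc t))) \<in> \<Omega>" if "t < T" for t
    using assms[of t] assms[of "Suc t"] that Bx(3) Bp(3) by (intro Z\<Omega>) (auto simp: mem_Times_iff)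
  have nuU: "nu \<omega> \<in> interior U" if "\<omega> \<in> \<Omega>" for \<omega>
  proof -
    have "nu \<omega> \<in> V" using nuV that by blast
    then show ?thesis using VU closure_subset[of V] by blast
  qed
  define P where "P = (\<lambda>t. (xinf + fst (z t), pinf + snd (z (Suc t))) \<in> \<Omega> \<and>
      u t = nu (xinf + fst (z t), pinf + snd (z (Suc t))) \<and> u t \<in> interior U \<and>
      xinf + fst (z (Suc t)) = F (xinf + fst (z t)) (u t) \<and>
      pinf + snd (z t) = ham_x lam l F (xinf + fst (z t)) (u t) (pinf + snd (z (Suc t))) \<and>
      ham_u lam l F (xinf + fst (z t)) (u t) (pinf + snd (z (Suc t))) = 0)"
  have "P t \<longleftrightarrow> Ftil (z t, z (Suc t)) = 0 \<and> u t = control z t" if "t < T" for t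
  proof -
    let ?\<omega> = "(xinf + fst (z t), pinf + snd (z (Suc t)))"
    have "?\<omega> \<in> \<Omega>" "nu ?\<omega> \<in> interior U" "ham_u lam l F (fst ?\<omega>) (nu ?\<omega>) (snd ?\<omega>) = 0"
      using mem[OF that] nuU nu_stat by blast+
    moreover have "control z t = nu ?\<omega>" by (simp add: control_def)
    ultimately show ?thesis
      unfolding P_def Ftil_eq_0_iff by auto
  qed
  then have "(\<forall>t<T. P t) \<longleftrightarrow> (\<forall>t<T. Ftil (z t, z (Suc t)) = 0 \<and> u t = control z t)"
    by blast
  moreover have "pontryagin_branch U lam l F r \<Omega> nu (xinf, pinf) T xin y z u \<longleftrightarrow>
      (\<forall>t<T. P t) \<and> xinf + fst (z 0) = xin \<and> pinf + snd (z T) = r_x r (xinf + fst (z T)) y"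
    unfolding pontryagin_branch_def P_def Let_def by simp
  ultimately show ?thesis
    unfolding critical_def endpoint_eq_iff by blast
qed

lemma control_diff_le:
  assumes "\<And>t. t \<le> T \<Longrightarrow> z t \<in> Bx \<times> Bp" "\<And>t. t \<le> T \<Longrightarrow> z' t \<in> Bx \<times> Bp" "t < T"
  shows "norm (control z t - control z' t) \<le> Mint * (norm (z t - z' t) + norm (z (Suc t) - z' (Suc t)))"
proof -
  have "norm (control z t - control z' t)
      \<le> Mint * norm ((fst (z t), snd (z (Suc t))) - (fst (z' t), snd (z' (Suc t))))"
    unfolding control_def using assms(1,2)[of t] assms(1,2)[of "Suc t"] assms(3)
    by (intro nu_lipschitz) (auto simp: mem_Times_iff)
  also have "\<dots> \<le> Mint * (norm (z t - z' t) + norm (z (Suc t) - z' (Suc t)))"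
    using norm_cross_pair_le[of "z t - z' t" "z (Suc t) - z' (Suc t)"] Mint_nonneg
    by (intro mult_left_mono) auto
  finally show ?thesis .
qed

text \<open>Two errors add up: the second-order remainder of \<open>nu\<close> at the branch itself,
  and the derivative of \<open>nu\<close> applied to the difference between branch and linear
  branch.\<close>

lemma control_expansion_le:
  assumes "\<And>t. t \<le> T \<Longrightarrow> z t \<in> Bx \<times> Bp" "t < T"
  shows "norm (control z t - uinf - Dnu (fst (h t), snd (h (Suc t)))) \<le>
    Mint * (norm (z t) + norm (z (Suc t)))\<^sup>2 + Mint * (norm (z t - h t) + norm (z (Suc t) - h (Suc t)))"
proof -
  let ?\<zeta> = "(fst (z t), snd (z (Suc t)))" and ?\<eta> = "(fst (h t), snd (h (Suc t)))"
  have "norm (control z t - uinf - Dnu ?\<zeta>) \<le> Mint * (norm ?\<zeta>)\<^sup>2"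
    unfolding control_def using assms(1)[of t] assms(1)[of "Suc t"] assms(2)
    by (intro nu_expansion) (auto simp: mem_Times_iff)
  also have "\<dots> \<le> Mint * (norm (z t) + norm (z (Suc t)))\<^sup>2"
    using norm_cross_pair_le[of "z t" "z (Suc t)"] Mint_nonneg
    by (intro mult_left_mono power_mono) auto
  finally have 1: "norm (control z t - uinf - Dnu ?\<zeta>) \<le> Mint * (norm (z t) + norm (z (Suc t)))\<^sup>2" .
  have "norm (Dnu (?\<zeta> - ?\<eta>)) \<le> Mint * norm (?\<zeta> - ?\<eta>)" by (rule Dnu_le)
  also have "\<dots> \<le> Mint * (norm (z t - h t) + norm (z (Suc t) - h (Suc t)))"
    using norm_cross_pair_le[of "z t - h t" "z (Suc t) - h (Suc t)"] Mint_nonneg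
    by (intro mult_left_mono) auto
  finally have 2: "norm (Dnu (?\<zeta> - ?\<eta>)) \<le> Mint * (norm (z t - h t) + norm (z (Suc t) - h (Suc t)))" .
  have "control z t - uinf - Dnu ?\<eta> = (control z t - uinf - Dnu ?\<zeta>) + Dnu (?\<zeta> - ?\<eta>)"
    unfolding linear_diff[OF Dnu_linear] by simp
  then have "norm (control z t - uinf - Dnu ?\<eta>)
      \<le> norm (control z t - uinf - Dnu ?\<zeta>) + norm (Dnu (?\<zeta> - ?\<eta>))"
    by (simp only: norm_triangle_ineq)
  then show ?thesis using 1 2 by linarith
qed

end

section \<open>Branches\<close>

text \<open>The constant c is common to all y in \<open>Y1\<close>, which makes every bound derived
  here uniform in y as well as in T.\<close>

locale branch_setting =
  control_setting F l r lam Mint Mter \<rho>x \<rho>p U V Y Y0 W \<Omega> Zx Zp Bx Bp xinf pinf uinf yinf nu Ftil L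
  for F :: "real^'d \<Rightarrow> real^'m \<Rightarrow> real^'d" and l and r :: "real^'d \<Rightarrow> real^'q \<Rightarrow> real"
    and lam Mint Mter \<rho>x \<rho>p U V Y Y0 W \<Omega> Zx Zp Bx Bp xinf pinf uinf yinf nu Ftil L +
  fixes Y1 :: "(real^'q) set" and c \<gamma> \<alpha> CN Cconv a R :: real and T0 :: nat
  assumes Y1: "Y1 \<subseteq> Y0" "Y1 \<noteq> {}"
    and green: "y \<in> Y1 \<Longrightarrow> uniform_green L (endpoint_lin r xinf y) c \<gamma> T0"
    and \<alpha>: "0 < \<alpha>" "\<alpha> < \<gamma> / 2"
    and N_le: "p \<in> Bx \<times> Bp \<Longrightarrow> p' \<in> Bx \<times> Bp \<Longrightarrow>
        norm (Ftil (p, p') - L (p, p')) \<le> CN * (norm p + norm p')\<^sup>2"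
    and N_lip: "p \<in> Bx \<times> Bp \<Longrightarrow> p' \<in> Bx \<times> Bp \<Longrightarrow> q \<in> Bx \<times> Bp \<Longrightarrow> q' \<in> Bx \<times> Bp \<Longrightarrow>
        norm ((Ftil (p, p') - L (p, p')) - (Ftil (q, q') - L (q, q')))
          \<le> CN * (norm p + norm p' + norm q + norm q') * (norm (p - q) + norm (p' - q'))"
    and conv: "T0 \<le> T \<Longrightarrow> t \<le> T \<Longrightarrow>
        (\<Sum>s<T. kappa \<gamma> T t s * (weight \<alpha> T s)\<^sup>2) \<le> Cconv * (weight \<alpha> T t)\<^sup>2"
      "T0 \<le> T \<Longrightarrow> t \<le> T \<Longrightarrow> weight \<gamma> T t \<le> Cconv * (weight \<alpha> T t)\<^sup>2"
    and a: "a = 2 * c * Cconv * CN * (1 + exp \<alpha>)\<^sup>2 + 16 * c * Mter"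
    and R: "0 < R" "2 * a * R < 1"
    and tube: "T0 \<le> T \<Longrightarrow> wnorm \<alpha> T z \<le> R \<Longrightarrow> t \<le> T \<Longrightarrow> z t \<in> Bx \<times> Bp"
begin

text \<open>No sign of \<open>CN\<close> is assumed; the growth bound at a nonzero point of the tube
  forces it.\<close>

lemma CN_nonneg: "0 \<le> CN"
proof -
  obtain b :: "real^'d" where b: "b \<in> Basis" using nonempty_Basis by blast
  let ?p = "(\<rho>x *\<^sub>R b, 0 :: real^'d)"
  have "norm (Ftil (?p, (0, 0)) - L (?p, (0, 0))) \<le> CN * (norm ?p + norm ((0, 0) :: (real^'d) \<times> (real^'d)))\<^sup>2"
    using b Bx Bp by (intro N_le) auto
  then have "0 \<le> CN * (norm ?p + norm ((0, 0) :: (real^'d) \<times> (real^'d)))\<^sup>2"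
    by (rule order_trans[OF norm_ge_zero])
  then show ?thesis using b Bx by (simp add: zero_le_mult_iff norm_Pair)
qed

lemma nonlinear_bvp:
  assumes "y \<in> Y1"
  shows "nonlinear_bvp L (endpoint_lin r xinf y) c \<gamma> \<alpha> T0 (\<lambda>w. Ftil w - L w) (terminal_remainder y)
    (Bx \<times> Bp) CN Cconv Mter R a"
proof
  have y: "y \<in> Y0" using assms Y1 by blast
  show "uniform_green L (endpoint_lin r xinf y) c \<gamma> T0" by (rule green[OF assms])
  show "0 \<le> \<alpha>" "\<alpha> \<le> \<gamma>" using \<alpha> by auto
  have "norm (Ftil (0, 0) - L (0, 0)) \<le> CN * (norm (0 :: (real^'d) \<times> (real^'d)) + norm (0 :: (real^'d) \<times> (real^'d)))\<^sup>2"
    using zero_B by (intro N_le) (auto simp: zero_prod_def)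
  then show "Ftil (0, 0) - L (0, 0) = 0" by simp
  show "terminal_remainder y 0 = 0"
    using linear_0[OF r_xx_linear[OF Y0_Y[OF y]]] by (simp add: terminal_remainder_def zero_prod_def)
  show "z t \<in> Bx \<times> Bp" if "T0 \<le> T" "\<forall>t\<le>T. norm (z t) \<le> R * weight \<alpha> T t" "t \<le> T" for T z t
    using tube[OF that(1) _ that(3)] that(2) by (simp add: wnorm_le_iff)
qed (use N_lip terminal_remainder_le CN_nonneg Mter_nonneg conv a R assms Y1 in auto)

lemma nl_sol_iff:
  assumes "y \<in> Y1"
  shows "nonlinear_bvp.nl_sol L (endpoint_lin r xinf y) (\<lambda>w. Ftil w - L w) (terminal_remainder y) T \<Delta> z
    \<longleftrightarrow> critical y T \<Delta> z"
proof -
  have "y \<in> Y" using assms Y1 Y0_Y by blast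
  then have "endpoint_lin r xinf y (p, p') = \<Delta> + terminal_remainder y p' \<longleftrightarrow> endpoint_map r xinf y (p, p') = \<Delta>"
    for p p'
    by (cases \<Delta>) (auto simp: endpoint_lin_apply endpoint_map_eq terminal_remainder_def algebra_simps)
  then show ?thesis
    unfolding nonlinear_bvp.nl_sol_def[OF nonlinear_bvp[OF assms]] critical_def solves_bvp_def
    by (auto simp: algebra_simps)
qed

lemma in_ball_iff:
  fixes z :: "nat \<Rightarrow> (real^'d) \<times> (real^'d)"
  assumes "y \<in> Y1"
  shows "nonlinear_bvp.in_ball \<alpha> R T z \<longleftrightarrow> wnorm \<alpha> T z \<le> R"
  unfolding nonlinear_bvp.in_ball_def[OF nonlinear_bvp[OF assms]] wnorm_le_iff ..

definition datum_radius :: real where "datum_radius = (R - a * R\<^sup>2) / c"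

lemma c_ge_1: "1 \<le> c"
  using green Y1 uniform_green_linear(3) by blast

lemma critical_exists:
  assumes "T0 \<le> T" "y \<in> Y1" "norm \<Delta> < datum_radius"
  shows "\<exists>z. critical y T \<Delta> z \<and> wnorm \<alpha> T z \<le> R"
proof -
  have "c * norm \<Delta> + a * R\<^sup>2 \<le> R"
    using assms(3) c_ge_1 by (simp add: datum_radius_def less_divide_eq algebra_simps)
  from nonlinear_bvp.existence[OF nonlinear_bvp[OF assms(2)] assms(1) this]
  show ?thesis
    by (simp add: nl_sol_iff[OF assms(2)] in_ball_iff[OF assms(2)])
qed

lemma critical_lipschitz:
  assumes "T0 \<le> T" "y \<in> Y1" "critical y T \<Delta> z" "wnorm \<alpha> T z \<le> R"
    "critical y T \<Delta>' z'" "wnorm \<alpha> T z' \<le> R" "t \<le> T"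
  shows "norm (z t - z' t) \<le> c / (1 - 2 * a * R) * norm (\<Delta> - \<Delta>') * weight \<alpha> T t"
  using nonlinear_bvp.lipschitz[OF nonlinear_bvp[OF assms(2)] assms(1)]
    assms(3-7) by (simp add: nl_sol_iff[OF assms(2)] in_ball_iff[OF assms(2)])

lemma critical_size:
  assumes "T0 \<le> T" "y \<in> Y1" "critical y T \<Delta> z" "wnorm \<alpha> T z \<le> R"
  shows "wnorm \<alpha> T z \<le> (if a = 0 then c * norm \<Delta>
    else (1 - sqrt (1 - 4 * a * c * norm \<Delta>)) / (2 * a))"
  using nonlinear_bvp.size_bound[OF nonlinear_bvp[OF assms(2)] assms(1),
      unfolded nl_sol_iff[OF assms(2)] in_ball_iff[OF assms(2)], OF assms(3,4)] .

lemma critical_le_datum: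
  assumes "T0 \<le> T" "y \<in> Y1" "critical y T \<Delta> z" "wnorm \<alpha> T z \<le> R" "t \<le> T"
  shows "norm (z t) \<le> 2 * c * norm \<Delta> * weight \<alpha> T t"
  using nonlinear_bvp.wnorm_le_datum[OF nonlinear_bvp[OF assms(2)] assms(1),
      unfolded nl_sol_iff[OF assms(2)] in_ball_iff[OF assms(2)], OF assms(3,4)] assms(5)
  unfolding wnorm_le_iff by blast

definition Cexp :: real where
  "Cexp = 4 * c\<^sup>2 * c * Cconv * (4 * Mter + CN * (1 + exp \<alpha>)\<^sup>2)"

lemma critical_expansion:
  assumes "T0 \<le> T" "y \<in> Y1" "critical y T \<Delta> z" "wnorm \<alpha> T z \<le> R"
    "solves_bvp L (endpoint_lin r xinf y) T (\<lambda>t. 0) \<Delta> h" "t \<le> T"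
  shows "norm (z t - h t) \<le> Cexp * (weight \<alpha> T t)\<^sup>2 * (norm \<Delta>)\<^sup>2"
  unfolding Cexp_def
  using nonlinear_bvp.expansion[OF nonlinear_bvp[OF assms(2)] assms(1),
      unfolded nl_sol_iff[OF assms(2)] in_ball_iff[OF assms(2)], OF assms(3-6)] .

lemma Cexp_nonneg: "0 \<le> Cexp"
proof -
  obtain y where "y \<in> Y1" using Y1 by blast
  from nonlinear_bvp.Cconv_pos[OF nonlinear_bvp[OF this]]
  show ?thesis unfolding Cexp_def using c_ge_1 CN_nonneg Mter_nonneg by simp
qed

lemma pair_weight_le:
  assumes "\<And>t. t \<le> T \<Longrightarrow> d t \<le> E * weight \<alpha> T t" "0 \<le> E" "t < T"
  shows "d t + d (Suc t) \<le> (1 + exp \<alpha>) * E * weight \<alpha> T t"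
proof -
  have "d (Suc t) \<le> E * weight \<alpha> T (Suc t)" using assms by auto
  also have "\<dots> \<le> E * (exp \<alpha> * weight \<alpha> T t)"
    using weight_Suc_le[of \<alpha> T t] \<alpha> assms by (intro mult_left_mono) auto
  finally show ?thesis using assms(1)[of t] assms(3) by (simp add: algebra_simps)
qed

lemma control_le:
  assumes "\<And>t. t \<le> T \<Longrightarrow> norm (d t) \<le> E * weight \<alpha> T t" "0 \<le> E" "t < T"
    and "x \<le> Mint * (norm (d t) + norm (d (Suc t)))"
  shows "norm (d t) + x \<le> (1 + Mint * (1 + exp \<alpha>)) * E * weight \<alpha> T t"
proof -
  have "Mint * (norm (d t) + norm (d (Suc t))) \<le> Mint * ((1 + exp \<alpha>) * E * weight \<alpha> T t)"
    using pair_weight_le[of T "\<lambda>t. norm (d t)" E t] assms Mint_nonneg by (intro mult_left_mono) auto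
  moreover have "norm (d t) \<le> E * weight \<alpha> T t" using assms by auto
  ultimately show ?thesis using assms(4) by (simp add: algebra_simps)
qed

definition branch where
  "branch T xin y z u \<longleftrightarrow>
    pontryagin_branch U lam l F r \<Omega> nu (xinf, pinf) T xin y z u \<and> wnorm \<alpha> T z \<le> R"

abbreviation "datum \<equiv> oc_datum r xinf pinf"

lemma branch_iff:
  assumes "T0 \<le> T"
  shows "branch T xin y z u \<longleftrightarrow>
    critical y T (datum xin y) z \<and> wnorm \<alpha> T z \<le> R \<and> (\<forall>t<T. u t = control z t)"
  unfolding branch_def using pontryagin_branch_iff[of T z] tube[OF assms] by blast

lemma branch_exists_unique_size:
  assumes "T0 \<le> T" "y \<in> Y1" "norm (datum xin y) < datum_radius"
  shows "\<exists>z u. branch T xin y z u"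
    and "branch T xin y z u \<Longrightarrow> branch T xin y z' u' \<Longrightarrow> (\<forall>t\<le>T. z t = z' t) \<and> (\<forall>t<T. u t = u' t)"
    and "branch T xin y z u \<Longrightarrow> wnorm \<alpha> T z \<le> (if a = 0 then c * norm (datum xin y)
      else (1 - sqrt (1 - 4 * a * c * norm (datum xin y))) / (2 * a))"
proof -
  show "\<exists>z u. branch T xin y z u"
    using critical_exists[OF assms] unfolding branch_iff[OF assms(1)] by blast
  show "wnorm \<alpha> T z \<le> (if a = 0 then c * norm (datum xin y)
      else (1 - sqrt (1 - 4 * a * c * norm (datum xin y))) / (2 * a))" if "branch T xin y z u"
    using that critical_size[OF assms(1,2)] unfolding branch_iff[OF assms(1)] by blast
  show "(\<forall>t\<le>T. z t = z' t) \<and> (\<forall>t<T. u t = u' t)"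
    if "branch T xin y z u" "branch T xin y z' u'"
  proof -
    have "z t = z' t" if t: "t \<le> T" for t
    proof -
      have "norm (z t - z' t) \<le> c / (1 - 2 * a * R) * norm (datum xin y - datum xin y) * weight \<alpha> T t"
        using \<open>branch T xin y z u\<close> \<open>branch T xin y z' u'\<close> unfolding branch_iff[OF assms(1)]
        by (intro critical_lipschitz[OF assms(1,2)] t) auto
      then show ?thesis by simp
    qed
    then show ?thesis
      using that unfolding branch_iff[OF assms(1)] control_def by simp
  qed
qed

text \<open>Cost of adding the control to a weighted bound on the state: 1 for the state itself,
  \<open>Mint\<close> for the Lipschitz constant of \<open>nu\<close>, and
  \<open>1 + exp \<alpha>\<close> because the control sees the times t and t + 1.\<close>

definition Cctl :: real where "Cctl = 1 + Mint * (1 + exp \<alpha>)"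

lemma Cctl_ge_1: "1 \<le> Cctl"
  using Mint_nonneg by (simp add: Cctl_def)

lemma branch_decay:
  assumes T: "T0 \<le> T" and y: "y \<in> Y1" and b: "branch T xin y z u"
  shows "t < T \<Longrightarrow> norm (z t) + norm (u t - uinf) \<le> Cctl * (2 * c) * weight \<alpha> T t * norm (datum xin y)"
    and "norm (z T) \<le> Cctl * (2 * c) * weight \<alpha> T T * norm (datum xin y)"
proof -
  note b' = b[unfolded branch_iff[OF T]]
  let ?E = "2 * c * norm (datum xin y)"
  have E0: "0 \<le> ?E" using c_ge_1 by simp
  have z: "norm (z t) \<le> ?E * weight \<alpha> T t" if "t \<le> T" for t
    using b' that by (intro critical_le_datum[OF T y]) auto
  have mem: "z t \<in> Bx \<times> Bp" "(\<lambda>_. (0, 0)) t \<in> Bx \<times> Bp" if "t \<le> T" for t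
    using b' tube[OF T _ that] zero_B by auto
  have "?E * weight \<alpha> T T \<le> Cctl * (?E * weight \<alpha> T T)"
    using mult_right_mono[OF Cctl_ge_1, of "?E * weight \<alpha> T T"] E0 weight_pos[of \<alpha> T T] by simp
  then show "norm (z T) \<le> Cctl * (2 * c) * weight \<alpha> T T * norm (datum xin y)"
    using z[of T] by (simp add: algebra_simps)
  show "norm (z t) + norm (u t - uinf) \<le> Cctl * (2 * c) * weight \<alpha> T t * norm (datum xin y)" if t: "t < T"
  proof -
    \<comment> \<open>The stationary reference is the zero sequence, so decay of the control is the
      Lipschitz bound against its control.\<close>
    have "control (\<lambda>_. (0, 0)) t = uinf" by (simp add: control_def nu_inf)
    then have "norm (u t - uinf) \<le> Mint * (norm (z t) + norm (z (Suc t)))"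
      using control_diff_le[of T z "\<lambda>_. (0, 0)", OF mem(1) mem(2) t] b' t
      by (simp add: zero_prod_def[symmetric])
    from control_le[OF z E0 t this] show ?thesis by (simp add: Cctl_def algebra_simps)
  qed
qed

lemma branch_lipschitz:
  assumes T: "T0 \<le> T" and y: "y \<in> Y1"
    and z: "critical y T \<Delta> z" "wnorm \<alpha> T z \<le> R" and z': "critical y T \<Delta>' z'" "wnorm \<alpha> T z' \<le> R"
  shows "t < T \<Longrightarrow> norm (z t - z' t) + norm (control z t - control z' t)
      \<le> Cctl * (c / (1 - 2 * a * R)) * weight \<alpha> T t * norm (\<Delta> - \<Delta>')"
    and "norm (z T - z' T) \<le> Cctl * (c / (1 - 2 * a * R)) * weight \<alpha> T T * norm (\<Delta> - \<Delta>')"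
proof -
  let ?E = "c / (1 - 2 * a * R) * norm (\<Delta> - \<Delta>')"
  have E0: "0 \<le> ?E" using c_ge_1 R by simp
  have d: "norm (z t - z' t) \<le> ?E * weight \<alpha> T t" if "t \<le> T" for t
    by (rule critical_lipschitz[OF T y z z' that])
  have mem: "z t \<in> Bx \<times> Bp" "z' t \<in> Bx \<times> Bp" if "t \<le> T" for t
    using z z' tube[OF T _ that] by auto
  have "0 \<le> ?E * weight \<alpha> T T"
    by (rule mult_nonneg_nonneg[OF E0 less_imp_le[OF weight_pos]])
  from mult_right_mono[OF Cctl_ge_1 this] have "?E * weight \<alpha> T T \<le> Cctl * (?E * weight \<alpha> T T)"
    by simp
  then show "norm (z T - z' T) \<le> Cctl * (c / (1 - 2 * a * R)) * weight \<alpha> T T * norm (\<Delta> - \<Delta>')"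
    using d[of T] by (simp add: algebra_simps)
  show "norm (z t - z' t) + norm (control z t - control z' t)
      \<le> Cctl * (c / (1 - 2 * a * R)) * weight \<alpha> T t * norm (\<Delta> - \<Delta>')" if t: "t < T"
    using control_le[of T "\<lambda>t. z t - z' t", OF d E0 t control_diff_le[of T z z', OF mem t]]
    by (simp add: Cctl_def algebra_simps)
qed

text \<open>The summands are the state error, the quadratic remainder of \<open>nu\<close>, and the
  derivative of \<open>nu\<close> applied to the state errors at t and t + 1; the square of
  \<open>exp \<alpha>\<close> moves w^2 from t + 1 back to t.\<close>

definition Cexp_ctl :: real where
  "Cexp_ctl = Cexp + Mint * ((1 + exp \<alpha>) * (2 * c))\<^sup>2 + Mint * (Cexp + (exp \<alpha>)\<^sup>2 * Cexp)"

lemma Cexp_ctl_ge: "Cexp \<le> Cexp_ctl"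
  using Cexp_nonneg Mint_nonneg by (simp add: Cexp_ctl_def)

lemma branch_expansion:
  assumes T: "T0 \<le> T" and y: "y \<in> Y1" and b: "branch T xin y z u"
    and h: "solves_bvp L (endpoint_lin r xinf y) T (\<lambda>t. 0) (datum xin y) h"
  shows "t < T \<Longrightarrow> norm (z t - h t) + norm ((u t - uinf) - Dnu (fst (h t), snd (h (Suc t))))
      \<le> Cexp_ctl * (weight \<alpha> T t)\<^sup>2 * (norm (datum xin y))\<^sup>2"
    and "norm (z T - h T) \<le> Cexp_ctl * (weight \<alpha> T T)\<^sup>2 * (norm (datum xin y))\<^sup>2"
proof -
  note b' = b[unfolded branch_iff[OF T]]
  let ?d = "norm (datum xin y)"
  have ex: "norm (z t - h t) \<le> Cexp * (weight \<alpha> T t)\<^sup>2 * ?d\<^sup>2" if "t \<le> T" for t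
    using b' that by (intro critical_expansion[OF T y] h) auto
  also have "Cexp * (weight \<alpha> T T)\<^sup>2 * ?d\<^sup>2 \<le> Cexp_ctl * (weight \<alpha> T T)\<^sup>2 * ?d\<^sup>2"
    using Cexp_ctl_ge by (intro mult_right_mono) auto
  finally show "norm (z T - h T) \<le> Cexp_ctl * (weight \<alpha> T T)\<^sup>2 * ?d\<^sup>2" by simp
  show "norm (z t - h t) + norm ((u t - uinf) - Dnu (fst (h t), snd (h (Suc t))))
      \<le> Cexp_ctl * (weight \<alpha> T t)\<^sup>2 * ?d\<^sup>2" if t: "t < T"
  proof -
    let ?w = "weight \<alpha> T t"
    have mem: "z t \<in> Bx \<times> Bp" if "t \<le> T" for t using b' tube[OF T _ that] by auto
    have "norm (z t) + norm (z (Suc t)) \<le> (1 + exp \<alpha>) * (2 * c * ?d) * ?w"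
      using b' c_ge_1 by (intro pair_weight_le[where T = T] critical_le_datum[OF T y] t) auto
    then have "(norm (z t) + norm (z (Suc t)))\<^sup>2 \<le> ((1 + exp \<alpha>) * (2 * c * ?d) * ?w)\<^sup>2"
      by (intro power_mono) auto
    also have "\<dots> = ((1 + exp \<alpha>) * (2 * c))\<^sup>2 * ?w\<^sup>2 * ?d\<^sup>2"
      by (simp add: power2_eq_square algebra_simps)
    finally have 1: "Mint * (norm (z t) + norm (z (Suc t)))\<^sup>2
        \<le> Mint * (((1 + exp \<alpha>) * (2 * c))\<^sup>2 * ?w\<^sup>2 * ?d\<^sup>2)"
      using Mint_nonneg by (rule mult_left_mono)
    have "(weight \<alpha> T (Suc t))\<^sup>2 \<le> (exp \<alpha> * ?w)\<^sup>2"
      using weight_Suc_le[of \<alpha> T t] \<alpha> weight_pos[of \<alpha> T "Suc t"] by (intro power_mono) auto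
    then have "Cexp * (weight \<alpha> T (Suc t))\<^sup>2 * ?d\<^sup>2 \<le> Cexp * (exp \<alpha> * ?w)\<^sup>2 * ?d\<^sup>2"
      using Cexp_nonneg by (intro mult_right_mono mult_left_mono) auto
    then have "norm (z t - h t) + norm (z (Suc t) - h (Suc t))
        \<le> Cexp * ?w\<^sup>2 * ?d\<^sup>2 + Cexp * (exp \<alpha> * ?w)\<^sup>2 * ?d\<^sup>2"
      using ex[of t] ex[of "Suc t"] t by linarith
    then have 2: "Mint * (norm (z t - h t) + norm (z (Suc t) - h (Suc t)))
        \<le> Mint * (Cexp * ?w\<^sup>2 * ?d\<^sup>2 + Cexp * (exp \<alpha> * ?w)\<^sup>2 * ?d\<^sup>2)"
      using Mint_nonneg by (rule mult_left_mono)
    have "norm ((u t - uinf) - Dnu (fst (h t), snd (h (Suc t)))) \<le>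
        Mint * (norm (z t) + norm (z (Suc t)))\<^sup>2 + Mint * (norm (z t - h t) + norm (z (Suc t) - h (Suc t)))"
      using control_expansion_le[of T z t h, OF mem t] b' t by simp
    then have "norm (z t - h t) + norm ((u t - uinf) - Dnu (fst (h t), snd (h (Suc t))))
      \<le> Cexp * ?w\<^sup>2 * ?d\<^sup>2 + Mint * (((1 + exp \<alpha>) * (2 * c))\<^sup>2 * ?w\<^sup>2 * ?d\<^sup>2)
        + Mint * (Cexp * ?w\<^sup>2 * ?d\<^sup>2 + Cexp * (exp \<alpha> * ?w)\<^sup>2 * ?d\<^sup>2)"
      using 1 2 ex[of t] t by linarith
    also have "\<dots> = Cexp_ctl * ?w\<^sup>2 * ?d\<^sup>2"
      unfolding Cexp_ctl_def power_mult_distrib by algebra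
    finally show ?thesis .
  qed
qed

text \<open>A branch for the parameter \<open>y'\<close> is a branch for \<open>y\<close> with a datum shifted by the change of the
  terminal gradient at its own endpoint.\<close>

lemma critical_change_parameter:
  assumes "critical y' T (datum xin y') z"
  shows "critical y T (datum xin y' + (endpoint_map r xinf y (z 0, z T) - endpoint_map r xinf y' (z 0, z T))) z"
  using assms by (simp add: critical_def)

text \<open>The reference gradients r_x (xinf, y) and r_x (xinf, y') cancel between datum and
  endpoint map. What is left is the change of the terminal gradient at the endpoint of the one
  branch z, which stays in the tube. The absolute value appears because K carries no sign.\<close>

lemma datum_change_le:
  assumes z: "critical y' T (datum x' y') z" and "z T \<in> Bx \<times> Bp"
    and K: "\<And>\<xi>. \<xi> \<in> Bx \<Longrightarrow> norm (r_x r (xinf + \<xi>) y - r_x r (xinf + \<xi>) y') \<le> K * dist y y'"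
  shows "norm (datum x y - (datum x' y' + (endpoint_map r xinf y (z 0, z T) - endpoint_map r xinf y' (z 0, z T))))
    \<le> (1 + \<bar>K\<bar>) * dist (x, y) (x', y')"
proof -
  have "datum x y - (datum x' y' + (endpoint_map r xinf y (z 0, z T) - endpoint_map r xinf y' (z 0, z T)))
      = (x - x', r_x r (xinf + fst (z T)) y - r_x r (xinf + fst (z T)) y')"
    by (simp add: oc_datum_def endpoint_map_eq)
  also have "norm \<dots> \<le> norm (x - x') + norm (r_x r (xinf + fst (z T)) y - r_x r (xinf + fst (z T)) y')"
    by (rule norm_Pair_le)
  also have "\<dots> \<le> dist (x, y) (x', y') + \<bar>K\<bar> * dist (x, y) (x', y')"
  proof (rule add_mono)
    show "norm (x - x') \<le> dist (x, y) (x', y')"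
      using dist_fst_le[of "(x, y)" "(x', y')"] by (simp add: dist_norm)
    have "norm (r_x r (xinf + fst (z T)) y - r_x r (xinf + fst (z T)) y') \<le> K * dist y y'"
      using assms(2) by (intro K) (simp add: mem_Times_iff)
    also have "\<dots> \<le> \<bar>K\<bar> * dist (x, y) (x', y')"
      using dist_snd_le[of "(x, y)" "(x', y')"] by (intro mult_mono) auto
    finally show "norm (r_x r (xinf + fst (z T)) y - r_x r (xinf + fst (z T)) y') \<le> \<bar>K\<bar> * dist (x, y) (x', y')" .
  qed
  finally show ?thesis by (simp add: algebra_simps)
qed

text \<open>Both sequences are compared as solutions for the same y. The shifted datum of the second
  one need not be below \<open>datum_radius\<close>; membership in the ball suffices for the
  Lipschitz bound.\<close>

lemma branch_joint_lipschitz: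
  assumes T: "T0 \<le> T" and y: "y \<in> Y1" "y' \<in> Y1"
    and b: "branch T x y z u" and b': "branch T x' y' z' u'"
    and K: "\<And>\<xi>. \<xi> \<in> Bx \<Longrightarrow> norm (r_x r (xinf + \<xi>) y - r_x r (xinf + \<xi>) y') \<le> K * dist y y'"
  shows "t < T \<Longrightarrow> norm (z t - z' t) + norm (u t - u' t)
      \<le> Cctl * (c / (1 - 2 * a * R)) * (1 + \<bar>K\<bar>) * weight \<alpha> T t * dist (x, y) (x', y')"
    and "norm (z T - z' T) \<le> Cctl * (c / (1 - 2 * a * R)) * (1 + \<bar>K\<bar>) * weight \<alpha> T T * dist (x, y) (x', y')"
proof -
  note b = b[unfolded branch_iff[OF T]] and b' = b'[unfolded branch_iff[OF T]]
  let ?\<Delta> = "datum x' y' + (endpoint_map r xinf y (z' 0, z' T) - endpoint_map r xinf y' (z' 0, z' T))"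
  let ?C = "Cctl * (c / (1 - 2 * a * R))"
  have c': "critical y T ?\<Delta> z'" using b' by (intro critical_change_parameter) auto
  have \<Delta>: "norm (datum x y - ?\<Delta>) \<le> (1 + \<bar>K\<bar>) * dist (x, y) (x', y')"
    using b' tube[OF T] by (intro datum_change_le K) auto
  have C0: "0 \<le> ?C" using Cctl_ge_1 c_ge_1 R by simp
  have le: "?C * weight \<alpha> T t * norm (datum x y - ?\<Delta>)
      \<le> ?C * (1 + \<bar>K\<bar>) * weight \<alpha> T t * dist (x, y) (x', y')" for t
  proof -
    have "0 \<le> ?C * weight \<alpha> T t"
      by (rule mult_nonneg_nonneg[OF C0 less_imp_le[OF weight_pos]])
    from mult_left_mono[OF \<Delta> this] show ?thesis by (simp only: mult_ac)
  qed
  note lip = branch_lipschitz[OF T y(1) conjunct1[OF b] conjunct1[OF conjunct2[OF b]] c' conjunct1[OF conjunct2[OF b']]]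
  show "norm (z T - z' T) \<le> ?C * (1 + \<bar>K\<bar>) * weight \<alpha> T T * dist (x, y) (x', y')"
    by (rule order_trans[OF lip(2) le])
  show "norm (z t - z' t) + norm (u t - u' t) \<le> ?C * (1 + \<bar>K\<bar>) * weight \<alpha> T t * dist (x, y) (x', y')"
    if "t < T"
    using order_trans[OF lip(1)[OF that] le] b b' that by simp
qed

end

section \<open>Admissible radii and assembly of the quantified statement\<close>

lemma LetI: "(\<And>x. x = t \<Longrightarrow> P x) \<Longrightarrow> Let t P"
  by simp

lemma (in control_setting) admissible_radius_exists:
  assumes "0 \<le> \<alpha>"
  shows "\<exists>R>0. 2 * a * R < 1 \<and> (\<forall>T\<ge>T0. \<forall>z. wnorm \<alpha> T z \<le> R \<longrightarrow> (\<forall>t\<le>T. z t \<in> Bx \<times> Bp))"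
proof -
  \<comment> \<open>The first entry gives a R < 1/2 for any real a, zero included; the second
    accounts for w \<le> 2, so that each component of z stays within its ball.\<close>
  define R where "R = min (1 / (4 * (\<bar>a\<bar> + 1))) (min \<rho>x \<rho>p / 2)"
  have R: "0 < R" "2 * R \<le> \<rho>x" "2 * R \<le> \<rho>p" using Bx Bp by (auto simp: R_def)
  have "a * R \<le> \<bar>a\<bar> * R" using R by (intro mult_right_mono) auto
  also have "\<dots> \<le> \<bar>a\<bar> * (1 / (4 * (\<bar>a\<bar> + 1)))" by (intro mult_left_mono) (auto simp: R_def)
  also have "\<dots> < 1 / 2" by (simp add: divide_simps)
  finally have "2 * a * R < 1" by simp
  moreover have "z t \<in> Bx \<times> Bp" if "wnorm \<alpha> T z \<le> R" "t \<le> T" for T t and z :: "nat \<Rightarrow> (real^'d) \<times> (real^'d)"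
  proof -
    have "norm (z t) \<le> R * weight \<alpha> T t" using that by (simp add: wnorm_le_iff)
    also have "\<dots> \<le> R * 2" using weight_le_2[OF assms that(2)] R by (intro mult_left_mono) auto
    finally show ?thesis
      using R norm_fst_snd_le[of "z t"] unfolding Bx(2) Bp(2) by (simp add: mem_Times_iff)
  qed
  ultimately show ?thesis using R(1) by blast
qed

context branch_setting
begin

lemma branches_well_posed:
  "\<forall>T\<ge>T0. \<forall>xin. \<forall>y\<in>Y1. norm (datum xin y) < datum_radius \<longrightarrow>
     (\<exists>z u. branch T xin y z u) \<and>
     (\<forall>z u z' u'. branch T xin y z u \<and> branch T xin y z' u' \<longrightarrow>
        (\<forall>t\<le>T. z t = z' t) \<and> (\<forall>t<T. u t = u' t)) \<and>
     (\<forall>z u. branch T xin y z u \<longrightarrow>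
        wnorm \<alpha> T z \<le>
          (if a = 0 then c * norm (datum xin y)
           else (1 - sqrt (1 - 4 * a * c * norm (datum xin y))) / (2 * a)))"
  by (intro allI impI ballI conjI branch_exists_unique_size(1)
      branch_exists_unique_size(2)[THEN conjunct1, rule_format]
      branch_exists_unique_size(2)[THEN conjunct2, rule_format]
      branch_exists_unique_size(3)) auto

lemma branches_estimates:
  "\<exists>C.
     (\<forall>T\<ge>T0. \<forall>xin. \<forall>y\<in>Y1. \<forall>z u h.
        norm (datum xin y) < datum_radius \<and> branch T xin y z u \<and>
        solves_bvp L (endpoint_lin r xinf y) T (\<lambda>t. 0) (datum xin y) h \<longrightarrow>
        (\<forall>t<T. norm (z t) + norm (u t - uinf) \<le> C * weight \<alpha> T t * norm (datum xin y)) \<and>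
        norm (z T) \<le> C * weight \<alpha> T T * norm (datum xin y) \<and>
        (\<forall>t<T. norm (z t - h t) + norm ((u t - uinf) - Dnu (fst (h t), snd (h (Suc t))))
                 \<le> C * (weight \<alpha> T t)\<^sup>2 * (norm (datum xin y))\<^sup>2) \<and>
        norm (z T - h T) \<le> C * (weight \<alpha> T T)\<^sup>2 * (norm (datum xin y))\<^sup>2) \<and>
     (\<forall>T\<ge>T0. \<forall>x1 x2. \<forall>y\<in>Y1. \<forall>z1 u1 z2 u2.
        norm (datum x1 y) < datum_radius \<and> norm (datum x2 y) < datum_radius \<and>
        branch T x1 y z1 u1 \<and> branch T x2 y z2 u2 \<longrightarrow>
        (\<forall>t<T. norm (z1 t - z2 t) + norm (u1 t - u2 t)
                 \<le> C * weight \<alpha> T t * norm (datum x1 y - datum x2 y)) \<and>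
        norm (z1 T - z2 T) \<le> C * weight \<alpha> T T * norm (datum x1 y - datum x2 y))"
  (is "\<exists>C. ?P C \<and> ?Q C")
proof -
  define C1 where "C1 = Cctl * (2 * c)"
  define C2 where "C2 = Cctl * (c / (1 - 2 * a * R))"
  define C where "C = C1 + Cexp_ctl + C2"
  have nn: "0 \<le> C1" "0 \<le> C2" "0 \<le> Cexp_ctl"
    using Cctl_ge_1 c_ge_1 R Cexp_ctl_ge Cexp_nonneg by (auto simp: C1_def C2_def)
  have w: "0 \<le> weight \<alpha> T t" for T t by (rule less_imp_le[OF weight_pos])
  have up: "x \<le> C * v * d" if "x \<le> C' * v * d" "C' \<in> {C1, C2, Cexp_ctl}" "0 \<le> v" "0 \<le> d" for x C' v d
  proof -
    have "C' \<le> C" using nn that(2) by (auto simp: C_def)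
    then have "C' * v * d \<le> C * v * d" using that by (intro mult_right_mono) auto
    then show ?thesis using that(1) by linarith
  qed
  have "?P C"
  proof (intro allI impI ballI, elim conjE, intro conjI allI impI)
    fix T xin y z u h assume T: "T0 \<le> T" and y: "y \<in> Y1" and b: "branch T xin y z u"
      and h: "solves_bvp L (endpoint_lin r xinf y) T (\<lambda>t. 0) (datum xin y) h"
    show "norm (z T) \<le> C * weight \<alpha> T T * norm (datum xin y)"
      by (rule up[OF branch_decay(2)[OF T y b, folded C1_def]]) (auto intro: w)
    show "norm (z T - h T) \<le> C * (weight \<alpha> T T)\<^sup>2 * (norm (datum xin y))\<^sup>2"
      by (rule up[OF branch_expansion(2)[OF T y b h]]) auto
    fix t assume t: "t < T"
    show "norm (z t) + norm (u t - uinf) \<le> C * weight \<alpha> T t * norm (datum xin y)"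
      by (rule up[OF branch_decay(1)[OF T y b t, folded C1_def]]) (auto intro: w)
    show "norm (z t - h t) + norm ((u t - uinf) - Dnu (fst (h t), snd (h (Suc t))))
        \<le> C * (weight \<alpha> T t)\<^sup>2 * (norm (datum xin y))\<^sup>2"
      by (rule up[OF branch_expansion(1)[OF T y b h t]]) auto
  qed
  moreover have "?Q C"
  proof (intro allI impI ballI, elim conjE, intro conjI allI impI)
    fix T x1 x2 y z1 u1 z2 u2 assume T: "T0 \<le> T" and y: "y \<in> Y1"
      and b: "branch T x1 y z1 u1" "branch T x2 y z2 u2"
    note b' = b[unfolded branch_iff[OF T]]
    have c: "critical y T (datum x1 y) z1" "wnorm \<alpha> T z1 \<le> R" "critical y T (datum x2 y) z2" "wnorm \<alpha> T z2 \<le> R"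
      using b' by auto
    note lip = branch_lipschitz[OF T y c, folded C2_def]
    show "norm (z1 T - z2 T) \<le> C * weight \<alpha> T T * norm (datum x1 y - datum x2 y)"
      by (rule up[OF lip(2)]) (auto intro: w)
    fix t assume t: "t < T"
    have "norm (z1 t - z2 t) + norm (control z1 t - control z2 t)
        \<le> C * weight \<alpha> T t * norm (datum x1 y - datum x2 y)"
      by (rule up[OF lip(1)[OF t]]) (auto intro: w)
    then show "norm (z1 t - z2 t) + norm (u1 t - u2 t) \<le> C * weight \<alpha> T t * norm (datum x1 y - datum x2 y)"
      using b' t by simp
  qed
  ultimately show ?thesis by blast
qed

lemma branches_joint_lipschitz:
  assumes K: "\<forall>y0\<in>Y0. \<exists>\<epsilon>>0. \<exists>K. \<forall>y\<in>Y0 \<inter> ball y0 \<epsilon>. \<forall>y'\<in>Y0 \<inter> ball y0 \<epsilon>. \<forall>\<xi>\<in>Bx.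
      norm (r_x r (xinf + \<xi>) y - r_x r (xinf + \<xi>) y') \<le> K * dist y y' \<and>
      onorm (\<lambda>h. r_xx r (xinf + \<xi>) y h - r_xx r (xinf + \<xi>) y' h) \<le> K * dist y y'"
    and D: "D = {(xin, y). y \<in> Y1 \<and> norm (datum xin y) < datum_radius}"
  shows "\<forall>e0\<in>D. \<exists>\<epsilon>>0. \<exists>K. \<forall>T\<ge>T0.
    \<forall>(x1, y1)\<in>D \<inter> ball e0 \<epsilon>. \<forall>(x2, y2)\<in>D \<inter> ball e0 \<epsilon>. \<forall>z1 u1 z2 u2.
      branch T x1 y1 z1 u1 \<and> branch T x2 y2 z2 u2 \<longrightarrow>
      (\<forall>t<T. norm (z1 t - z2 t) + norm (u1 t - u2 t)
               \<le> K * weight \<alpha> T t * dist (x1, y1) (x2, y2)) \<and>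
      norm (z1 T - z2 T) \<le> K * weight \<alpha> T T * dist (x1, y1) (x2, y2)"
proof
  fix e0 assume e0: "e0 \<in> D"
  obtain x0 y0 where e0_eq: "e0 = (x0, y0)" by fastforce
  have "y0 \<in> Y0" using e0 Y1 by (auto simp: D e0_eq)
  then obtain \<epsilon> K' where \<epsilon>: "0 < \<epsilon>"
    and K': "\<And>y y' \<xi>. y \<in> Y0 \<inter> ball y0 \<epsilon> \<Longrightarrow> y' \<in> Y0 \<inter> ball y0 \<epsilon> \<Longrightarrow> \<xi> \<in> Bx \<Longrightarrow>
      norm (r_x r (xinf + \<xi>) y - r_x r (xinf + \<xi>) y') \<le> K' * dist y y'"
    using K by meson
  have mem: "y \<in> Y1 \<and> y \<in> Y0 \<inter> ball y0 \<epsilon>" if "(x, y) \<in> D \<inter> ball e0 \<epsilon>" for x y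
    using that Y1(1) dist_snd_le[of "(x0, y0)" "(x, y)"] by (auto simp: D e0_eq)
  show "\<exists>\<epsilon>>0. \<exists>K. \<forall>T\<ge>T0.
    \<forall>(x1, y1)\<in>D \<inter> ball e0 \<epsilon>. \<forall>(x2, y2)\<in>D \<inter> ball e0 \<epsilon>. \<forall>z1 u1 z2 u2.
      branch T x1 y1 z1 u1 \<and> branch T x2 y2 z2 u2 \<longrightarrow>
      (\<forall>t<T. norm (z1 t - z2 t) + norm (u1 t - u2 t)
               \<le> K * weight \<alpha> T t * dist (x1, y1) (x2, y2)) \<and>
      norm (z1 T - z2 T) \<le> K * weight \<alpha> T T * dist (x1, y1) (x2, y2)"
  proof (rule exI[of _ \<epsilon>], rule conjI[OF \<epsilon>], rule exI[of _ "Cctl * (c / (1 - 2 * a * R)) * (1 + \<bar>K'\<bar>)"],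
      intro allI impI ballI, clarify, intro conjI allI impI)
    fix T x1 y1 x2 y2 z1 u1 z2 u2
    assume T: "T0 \<le> T" and b: "branch T x1 y1 z1 u1" "branch T x2 y2 z2 u2"
      and "(x1, y1) \<in> D" "(x1, y1) \<in> ball e0 \<epsilon>" "(x2, y2) \<in> D" "(x2, y2) \<in> ball e0 \<epsilon>"
    then have m: "y1 \<in> Y1 \<and> y1 \<in> Y0 \<inter> ball y0 \<epsilon>" "y2 \<in> Y1 \<and> y2 \<in> Y0 \<inter> ball y0 \<epsilon>"
      using mem by blast+
    note joint = branch_joint_lipschitz[OF T conjunct1[OF m(1)] conjunct1[OF m(2)] b
        K'[OF conjunct2[OF m(1)] conjunct2[OF m(2)]]]
    show "norm (z1 T - z2 T) \<le> Cctl * (c / (1 - 2 * a * R)) * (1 + \<bar>K'\<bar>) * weight \<alpha> T T * dist (x1, y1) (x2, y2)"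
      by (rule joint(2))
    show "norm (z1 t - z2 t) + norm (u1 t - u2 t)
        \<le> Cctl * (c / (1 - 2 * a * R)) * (1 + \<bar>K'\<bar>) * weight \<alpha> T t * dist (x1, y1) (x2, y2)" if "t < T" for t
      by (rule joint(1)[OF _ that])
  qed
qed

end

theorem theorem5p1:
  fixes F :: "real^'d \<Rightarrow> real^'m \<Rightarrow> real^'d"
    and l :: "real^'d \<Rightarrow> real^'m \<Rightarrow> real"
    and r :: "real^'d \<Rightarrow> real^'q \<Rightarrow> real"
    and lam Mint Mter \<rho>x \<rho>p :: real
    and U U0 V :: "(real^'m) set" and Y Y0 :: "(real^'q) set"
    and W :: "((real^'d) \<times> (real^'m)) set"
    and \<Omega> :: "((real^'d) \<times> (real^'d)) set"
    and Zx Zp Bx Bp :: "(real^'d) set"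
    and xinf pinf :: "real^'d" and uinf :: "real^'m" and yinf :: "real^'q"
    and nu :: "(real^'d) \<times> (real^'d) \<Rightarrow> real^'m"
    and Ftil L :: "((real^'d) \<times> (real^'d)) \<times> ((real^'d) \<times> (real^'d)) \<Rightarrow> (real^'d) \<times> (real^'d)"
  assumes "compact U" "convex U" "open Y" "lam > 0"
    \<comment> \<open>interior stationary reference and regularity\<close>
    and "xinf = F xinf uinf"
    and "pinf = ham_x lam l F xinf uinf pinf"
    and "ham_u lam l F xinf uinf pinf = 0"
    and "uinf \<in> interior U"
    and "open W" "(xinf, uinf) \<in> W"
    and "Ck_on 3 (\<lambda>(x, u). F x u) W" "Ck_on 3 (\<lambda>(x, u). l x u) W"
    and "\<forall>y\<in>Y. Ck_on 3 (\<lambda>x. r x y) UNIV"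
    and "det (ham_uu lam l F xinf uinf pinf) \<noteq> 0"
    \<comment> \<open>control elimination\<close>
    and "open \<Omega>" "(xinf, pinf) \<in> \<Omega>" "open V" "uinf \<in> V" "rel_compact_in V (interior U)"
    and "\<forall>(x, p)\<in>\<Omega>. \<forall>v\<in>V. (x, v) \<in> W"
    and "Ck_on 2 nu \<Omega>" "nu ` \<Omega> \<subseteq> V"
    and "\<forall>(x, p)\<in>\<Omega>. ham_u lam l F x (nu (x, p)) p = 0"
    and "nu (xinf, pinf) = uinf"
    and "\<forall>nu'. Ck_on 2 nu' \<Omega> \<and> nu' ` \<Omega> \<subseteq> V \<and>
           (\<forall>(x, p)\<in>\<Omega>. ham_u lam l F x (nu' (x, p)) p = 0) \<and> nu' (xinf, pinf) = uinf
           \<longrightarrow> (\<forall>\<omega>\<in>\<Omega>. nu' \<omega> = nu \<omega>)"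
    and "Ftil = shifted_step lam l F nu (xinf, pinf)"
    and "L = frechet_derivative Ftil (at (0, 0))"
    \<comment> \<open>uniform local assumptions\<close>
    and "0 \<in> interior Zx" "0 \<in> interior Zp"
    and "\<forall>\<xi>\<in>Zx. \<forall>\<pi>\<in>Zp. (xinf + \<xi>, pinf + \<pi>) \<in> \<Omega>"
    and "convex U0" "rel_compact_in U0 (interior U)"
    and "\<rho>x > 0" "Bx = cball 0 \<rho>x" "Bx \<subseteq> Zx"
    and "\<rho>p > 0" "Bp = cball 0 \<rho>p" "Bp \<subseteq> Zp"
    and "yinf \<in> interior Y0" "rel_compact_in Y0 Y"
    and "\<forall>\<xi>\<in>Zx. \<forall>\<pi>\<in>Zp. nu (xinf + \<xi>, pinf + \<pi>) \<in> U0"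
    and "bdd_above ((\<lambda>\<zeta>. deriv_norm 1 nu ((xinf, pinf) + \<zeta>)) ` (Zx \<times> Zp))"
    and "bdd_above ((\<lambda>\<zeta>. deriv_norm 2 nu ((xinf, pinf) + \<zeta>)) ` (Zx \<times> Zp))"
    and "(SUP \<zeta>\<in>Zx \<times> Zp. deriv_norm 1 nu ((xinf, pinf) + \<zeta>))
           + (SUP \<zeta>\<in>Zx \<times> Zp. deriv_norm 2 nu ((xinf, pinf) + \<zeta>)) \<le> Mint"
    and "\<forall>z\<in>Bx \<times> Bp. \<forall>z'\<in>Bx \<times> Bp. deriv_norm 2 Ftil (z, z') \<le> Mint"
    and "\<forall>\<xi>\<in>Bx. \<forall>y\<in>Y0. \<forall>j\<in>{1, 2, 3}. deriv_norm j (\<lambda>x. r x y) (xinf + \<xi>) \<le> Mter"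
    and "\<forall>y\<in>Y0. \<forall>\<epsilon>>0. \<exists>\<delta>>0. \<forall>y'\<in>Y0. dist y' y < \<delta> \<longrightarrow>
           (\<forall>\<xi>\<in>Bx. norm (r_x r (xinf + \<xi>) y' - r_x r (xinf + \<xi>) y) < \<epsilon> \<and>
              onorm (\<lambda>h. r_xx r (xinf + \<xi>) y' h - r_xx r (xinf + \<xi>) y h) < \<epsilon>)"
    \<comment> \<open>reference terminal parameter\<close>
    and "yinf \<in> Y" "pinf = r_x r xinf yinf"
  shows
    \<comment> \<open>meaning of the endpoint equation\<close>
    "(\<forall>y\<in>Y. \<forall>xin z0 zT.
        endpoint_map r xinf y (z0, zT) = oc_datum r xinf pinf xin y \<longleftrightarrow>
        xinf + fst z0 = xin \<and> pinf + snd zT = r_x r (xinf + fst zT) y)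
   \<and>
    \<comment> \<open>consequences of the Green hypothesis at the reference\<close>
     (\<forall>CG \<gamma> T0. uniform_green L (endpoint_lin r xinf yinf) CG \<gamma> T0 \<longrightarrow>
        (\<exists>Y1. yinf \<in> interior Y1 \<and> rel_compact_in Y1 Y0 \<and>
              2 * CG * (SUP y\<in>Y1. onorm (endpoint_perturbation r xinf yinf y)) < 1) \<and>
        (\<forall>Y1. yinf \<in> interior Y1 \<and> rel_compact_in Y1 Y0 \<and>
              2 * CG * (SUP y\<in>Y1. onorm (endpoint_perturbation r xinf yinf y)) < 1 \<longrightarrow>
          (let \<theta> = 2 * CG * (SUP y\<in>Y1. onorm (endpoint_perturbation r xinf yinf y));
               CGbar = CG * (1 + \<theta>) / (1 - \<theta>)
           in
           (\<forall>y\<in>Y1. uniform_green L (endpoint_lin r xinf y) CGbar \<gamma> T0) \<and>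
           (\<forall>\<alpha> CN Cconv.
              0 < \<alpha> \<and> \<alpha> < \<gamma> / 2 \<and>
              (\<forall>a\<in>Bx \<times> Bp. \<forall>b\<in>Bx \<times> Bp.
                 norm (Ftil (a, b) - L (a, b)) \<le> CN * (norm a + norm b)\<^sup>2) \<and>
              (\<forall>a\<in>Bx \<times> Bp. \<forall>b\<in>Bx \<times> Bp. \<forall>a'\<in>Bx \<times> Bp. \<forall>b'\<in>Bx \<times> Bp.
                 norm ((Ftil (a, b) - L (a, b)) - (Ftil (a', b') - L (a', b')))
                 \<le> CN * (norm a + norm b + norm a' + norm b') * (norm (a - a') + norm (b - b'))) \<and>
              (\<forall>T\<ge>T0. \<forall>t\<le>T.
                 (\<Sum>s<T. kappa \<gamma> T t s * (weight \<alpha> T s)\<^sup>2) \<le> Cconv * (weight \<alpha> T t)\<^sup>2 \<and>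
                 exp (- \<gamma> * real t) + exp (- \<gamma> * (real T - real t)) \<le> Cconv * (weight \<alpha> T t)\<^sup>2)
              \<longrightarrow>
              (let CB = Mter; c = CGbar;
                   a = 2 * CGbar * Cconv * CN * (1 + exp \<alpha>)\<^sup>2 + 16 * CGbar * CB;
                   admissible = (\<lambda>R. R > 0 \<and> 2 * a * R < 1 \<and>
                      (\<forall>T\<ge>T0. \<forall>z. wnorm \<alpha> T z \<le> R \<longrightarrow> (\<forall>t\<le>T. z t \<in> Bx \<times> Bp)))
               in
               (\<exists>R. admissible R) \<and>
               (\<forall>R. admissible R \<longrightarrow>
                 (let \<delta> = (R - a * R\<^sup>2) / c;
                      \<Delta> = oc_datum r xinf pinf;
                      branch = (\<lambda>T xin y z u.
                        pontryagin_branch U lam l F r \<Omega> nu (xinf, pinf) T xin y z u \<and>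
                        wnorm \<alpha> T z \<le> R);
                      lin = (\<lambda>T xin y.
                        solves_bvp L (endpoint_lin r xinf y) T (\<lambda>t. 0) (\<Delta> xin y));
                      ulin = (\<lambda>h t. frechet_derivative nu (at (xinf, pinf))
                                      (fst (h t), snd (h (Suc t))))
                  in
                  \<comment> \<open>existence, uniqueness and size of the branch\<close>
                  (\<forall>T\<ge>T0. \<forall>xin. \<forall>y\<in>Y1. norm (\<Delta> xin y) < \<delta> \<longrightarrow>
                     (\<exists>z u. branch T xin y z u) \<and>
                     (\<forall>z u z' u'. branch T xin y z u \<and> branch T xin y z' u' \<longrightarrow>
                        (\<forall>t\<le>T. z t = z' t) \<and> (\<forall>t<T. u t = u' t)) \<and>
                     (\<forall>z u. branch T xin y z u \<longrightarrow>
                        wnorm \<alpha> T z \<le>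
                          (if a = 0 then c * norm (\<Delta> xin y)
                           else (1 - sqrt (1 - 4 * a * c * norm (\<Delta> xin y))) / (2 * a)))) \<and>
                  (\<exists>C.
                     \<comment> \<open>decay and expansion\<close>
                     (\<forall>T\<ge>T0. \<forall>xin. \<forall>y\<in>Y1. \<forall>z u h.
                        norm (\<Delta> xin y) < \<delta> \<and> branch T xin y z u \<and> lin T xin y h \<longrightarrow>
                        (\<forall>t<T. norm (z t) + norm (u t - uinf)
                                 \<le> C * weight \<alpha> T t * norm (\<Delta> xin y)) \<and>
                        norm (z T) \<le> C * weight \<alpha> T T * norm (\<Delta> xin y) \<and>
                        (\<forall>t<T. norm (z t - h t) + norm ((u t - uinf) - ulin h t)
                                 \<le> C * (weight \<alpha> T t)\<^sup>2 * (norm (\<Delta> xin y))\<^sup>2) \<and>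
                        norm (z T - h T) \<le> C * (weight \<alpha> T T)\<^sup>2 * (norm (\<Delta> xin y))\<^sup>2) \<and>
                     \<comment> \<open>dependence on the datum at fixed terminal parameter\<close>
                     (\<forall>T\<ge>T0. \<forall>x1 x2. \<forall>y\<in>Y1. \<forall>z1 u1 z2 u2.
                        norm (\<Delta> x1 y) < \<delta> \<and> norm (\<Delta> x2 y) < \<delta> \<and>
                        branch T x1 y z1 u1 \<and> branch T x2 y z2 u2 \<longrightarrow>
                        (\<forall>t<T. norm (z1 t - z2 t) + norm (u1 t - u2 t)
                                 \<le> C * weight \<alpha> T t * norm (\<Delta> x1 y - \<Delta> x2 y)) \<and>
                        norm (z1 T - z2 T) \<le> C * weight \<alpha> T T * norm (\<Delta> x1 y - \<Delta> x2 y))) \<and>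
                  \<comment> \<open>joint local Lipschitz dependence, uniform in the horizon\<close>
                  ((\<forall>y0\<in>Y0. \<exists>\<epsilon>>0. \<exists>K. \<forall>y\<in>Y0 \<inter> ball y0 \<epsilon>. \<forall>y'\<in>Y0 \<inter> ball y0 \<epsilon>. \<forall>\<xi>\<in>Bx.
                      norm (r_x r (xinf + \<xi>) y - r_x r (xinf + \<xi>) y') \<le> K * dist y y' \<and>
                      onorm (\<lambda>h. r_xx r (xinf + \<xi>) y h - r_xx r (xinf + \<xi>) y' h)
                        \<le> K * dist y y')
                   \<longrightarrow>
                   (let D = {(xin, y). y \<in> Y1 \<and> norm (\<Delta> xin y) < \<delta>} in
                    \<forall>e0\<in>D. \<exists>\<epsilon>>0. \<exists>K. \<forall>T\<ge>T0.
                      \<forall>(x1, y1)\<in>D \<inter> ball e0 \<epsilon>. \<forall>(x2, y2)\<in>D \<inter> ball e0 \<epsilon>. \<forall>z1 u1 z2 u2.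
                        branch T x1 y1 z1 u1 \<and> branch T x2 y2 z2 u2 \<longrightarrow>
                        (\<forall>t<T. norm (z1 t - z2 t) + norm (u1 t - u2 t)
                                 \<le> K * weight \<alpha> T t * dist (x1, y1) (x2, y2)) \<and>
                        norm (z1 T - z2 T)
                          \<le> K * weight \<alpha> T T * dist (x1, y1) (x2, y2))))))))))
   \<and>
    \<comment> \<open>spectral criterion for the Green hypothesis\<close>
     (\<forall>(Vs :: real^'s^('d + 'd)) (Vu :: real^'u^('d + 'd)) (Ds :: real^'s^'s) (Du :: real^'u^'u)
        (\<gamma> :: real) (K :: real) (T0 :: nat).
        (let L0 = block_matrix (\<lambda>h. L (h, 0));
             L1 = block_matrix (\<lambda>h. L (0, h));
             M = - (matrix_inv L1 ** L0);
             B0 = block_matrix (\<lambda>h. endpoint_lin r xinf yinf (h, 0));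
             BT = block_matrix (\<lambda>h. endpoint_lin r xinf yinf (0, h));
             \<Gamma> = gamma_hat B0 BT Vs Ds Vu Du
         in
         \<gamma> > 0 \<and> T0 \<ge> 1 \<and> K \<ge> 1 \<and>
         det L1 \<noteq> 0 \<and> hyperbolic M \<and>
         columns_basis_of Vs (stable_subspace M) \<and> columns_basis_of Vu (unstable_subspace M) \<and>
         M ** Vs = Vs ** Ds \<and> M ** Vu = Vu ** Du \<and> invertible Du \<and>
         (\<forall>k. mat_norm (Vs ** mat_pow Ds k) \<le> K * exp (- \<gamma> * real k)) \<and>
         (\<forall>k. mat_norm (Vu ** mat_pow (matrix_inv Du) k) \<le> K * exp (- \<gamma> * real k)) \<and>
         (\<forall>T\<ge>T0. invertible (\<Gamma> T)) \<and>
         bdd_above ((\<lambda>T. mat_norm (matrix_inv (\<Gamma> T))) ` {T0..})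
         \<longrightarrow> (\<exists>CG. uniform_green L (endpoint_lin r xinf yinf) CG \<gamma> T0)))"
proof -
  have setting: "control_setting F l r lam Mint Mter \<rho>x \<rho>p U V Y Y0 W \<Omega> Zx Zp Bx Bp xinf pinf uinf yinf nu Ftil L"
  proof (rule control_setting.intro[OF assms(11,12) _ assms(15,16) _ _ assms(21,22) _ assms(24,26,27) _
        assms(33-39) _ assms(42-44)], goal_cases)
    case (1 y)
    then show ?case using assms(13) by blast
  next
    case 2
    show ?case using assms(19) unfolding rel_compact_in_def by blast
  next
    case (3 \<omega> v)
    then show ?case using bspec[OF assms(20), of \<omega>] by (simp add: case_prod_unfold)
  next
    case (4 \<omega>)
    then show ?case using bspec[OF assms(23), of \<omega>] by (simp add: case_prod_unfold)
  next
    case (5 \<xi> \<pi>)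
    then show ?case using assms(30) by blast
  next
    case 6
    show ?case using assms(40) unfolding rel_compact_in_def by blast
  next
    case (7 \<xi> y j)
    then show ?case using assms(46) by blast
  next
    case (8 y \<epsilon>)
    then show ?case using assms(47) by blast
  qed
  interpret control_setting F l r lam Mint Mter \<rho>x \<rho>p U V Y Y0 W \<Omega> Zx Zp Bx Bp xinf pinf uinf yinf nu Ftil L
    by (rule setting)
  show ?thesis
  proof (intro conjI allI impI, goal_cases)
    case 1
    show ?case by (intro ballI allI endpoint_eq_iff)
  next
    case (2 CG \<gamma> T0)
    then show ?case by (intro terminal_neighbourhood_exists uniform_green_linear(3))
  next
    case (3 CG \<gamma> T0 Y1)
    note green = 3(1)
    have Y1: "Y1 \<subseteq> Y0" "Y1 \<noteq> {}"
      using 3(2) closure_subset[of Y1] interior_subset[of Y1] unfolding rel_compact_in_def by blast+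
    show ?case
    proof (rule LetI, rule LetI, rule conjI, goal_cases)
      case (1 \<theta> CGbar)
      have "\<theta> < 1" using 1(1) 3(2) by simp
      then show ?case
        unfolding 1(2) by (intro ballI uniform_green_nearby[OF green Y1(1) _ 1(1)])
    next
      case (2 \<theta> CGbar)
      have "\<theta> < 1" using 2(1) 3(2) by simp
      then have green_y: "uniform_green L (endpoint_lin r xinf y) CGbar \<gamma> T0" if "y \<in> Y1" for y
        unfolding 2(2) by (intro uniform_green_nearby[OF green Y1(1) that 2(1)])
      show ?case
      proof (intro allI impI LetI, rule conjI, goal_cases)
        case (1 \<alpha> CN Cconv CB c a admissible)
        then show ?case using admissible_radius_exists[of \<alpha> a T0] by auto
      next
        case (2 \<alpha> CN Cconv CB c a admissible)
        note hyps = 2(1) and CB = 2(2) and c = 2(3) and a = 2(4) and adm = 2(5)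
        show ?case
        proof (intro allI impI LetI, goal_cases)
          case (1 R \<delta> \<Delta> branch lin ulin)
          note R = 1(1)[unfolded adm]
          \<comment> \<open>The constant \<open>CGbar\<close> from the perturbed Green property
            takes the role of c for all y in \<open>Y1\<close> at once.\<close>
          interpret bs: branch_setting F l r lam Mint Mter \<rho>x \<rho>p U V Y Y0 W \<Omega> Zx Zp Bx Bp
              xinf pinf uinf yinf nu Ftil L Y1 CGbar \<gamma> \<alpha> CN Cconv a R T0
          proof (unfold_locales, goal_cases)
            case 1 show ?case by (rule Y1)
          next
            case 2 show ?case by (rule Y1)
          next
            case (3 y) then show ?case by (rule green_y)
          next
            case 4 show ?case using hyps by blast
          next
            case 5 show ?case using hyps by blast
          next
            case (6 p p') then show ?case using hyps by blast
          next
            case (7 p p' q q') then show ?case using hyps by blast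
          next
            case (8 T t) then show ?case using hyps by blast
          next
            case (9 T t) then show ?case using hyps unfolding weight_def[of \<gamma>] by blast
          next
            case 10 show ?case unfolding a CB ..
          next
            case 11 show ?case using R by blast
          next
            case 12 show ?case using R by blast
          next
            case (13 T z t) then show ?case using R by blast
          qed
          have \<delta>: "\<delta> = bs.datum_radius" unfolding 1(2) bs.datum_radius_def c ..
          have branch: "branch = bs.branch"
            unfolding 1(4) by (intro ext) (simp add: bs.branch_def)
          show ?case
            unfolding \<delta> 1(3) branch 1(5) 1(6) c
          proof (intro conjI)
            show "\<forall>T\<ge>T0. \<forall>xin. \<forall>y\<in>Y1. norm (oc_datum r xinf pinf xin y) < bs.datum_radius \<longrightarrow>
               (\<exists>z u. bs.branch T xin y z u) \<and>
               (\<forall>z u z' u'. bs.branch T xin y z u \<and> bs.branch T xin y z' u' \<longrightarrow>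
                  (\<forall>t\<le>T. z t = z' t) \<and> (\<forall>t<T. u t = u' t)) \<and>
               (\<forall>z u. bs.branch T xin y z u \<longrightarrow>
                  wnorm \<alpha> T z \<le>
                    (if a = 0 then CGbar * norm (oc_datum r xinf pinf xin y)
                     else (1 - sqrt (1 - 4 * a * CGbar * norm (oc_datum r xinf pinf xin y))) / (2 * a)))"
              by (rule bs.branches_well_posed)
          qed (rule bs.branches_estimates, intro impI LetI, rule bs.branches_joint_lipschitz)
        qed
      qed
    qed
  next
    case (4 Vs Vu Ds Du \<gamma> K T0)
    show ?case
    proof (intro LetI impI, goal_cases)
      case (1 L0 L1 M B0 BT \<Gamma>)
      note h = 1(7)[unfolded 1(6) 1(5) 1(4) 1(3) 1(2) 1(1)]
      show ?case
        by (rule spectral_green[OF L_linear endpoint_lin_eq(2)[OF assms(48)], of \<gamma> T0 K Vs _ Vu _ Ds Du])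
          (use h in \<open>(elim conjE; blast)+\<close>)
    qed
  qed
qed

end
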